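(* For $k\in\{pp,pl,tc\}$ let $C_k(T,R,N)$ be the event that the time dependent model $k$ (Poisson process, perturbed lattice, triangular cluster, respectively) has at least $N$ points in $D_R=\{z\in\mathbb{C}:|z|\le R\}$ for all $t\in[0,T]$, where $R>0$ and $N\ge1$ is an integer. (1) For the Poisson process there is a constant $C>0$, not depending on $R$ and $N$, such that $$\liminf_{T\to\infty}\frac1T\log\mathbb{P}(C_{pp}(T,R,N))\ge -\frac{CN}{R^2}.$$ (2) For $k=pl$ and for $k=tc$ there is a constant $C(R)>0$, not depending on $N$, such that $$\liminf_{T\to\infty}\frac1T\log\mathbb{P}(C_k(T,R,N))\ge -C(R)N^2.$$
   Context: A complex Brownian motion is $B=\frac1{\sqrt2}(B_1+iB_2)$ with $B_1,B_2$ independent standard real Brownian motions. Let $\zeta_{k,\ell}(t)$, $k,\ell\in\mathbb{Z}$, be i.i.d. complex stationary Ornstein-Uhlenbeck processes, each distributed as $e^{-t/2}B(e^t)$ where $B$ is a complex Brownian motion started from $0$. A constant $c>0$ is fixed as a parameter of the models. The three time dependent models are: - Poisson process ($pp$): at time $0$ the points form a Poisson process in $\mathbb{C}$ with intensity $\pi^{-1}$ times Lebesgue measure, and the points then move as independent planar (complex) Brownian motions. - Perturbed lattice ($pl$): at time $t$ the points are $\{\sqrt{\pi}(k+i\ell)+c\,\zeta_{k,\ell}(t):k,\ell\in\mathbb{Z}\}$. - Triangular cluster ($tc$): at time $t$ the points are $\{\sqrt{3\pi}(k+i\ell)+c\,e^{2\pi i m/3}\zeta_{k,\ell}(t):k,\ell\in\mathbb{Z},\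 m=0,1,2\}$. *)

theory Defs
  imports "HOL-Probability.Probability"
begin

(* The trajectory of a process on the time set [0,\<infinity>), as an element of the product
   space whose sigma-algebra is generated by the evaluations at the times t \<ge> 0.
   Independence of processes and equality in law of processes refer to this space. *)

definition traj :: "(real \<Rightarrow> 'w \<Rightarrow> 'b) \<Rightarrow> 'w \<Rightarrow> real \<Rightarrow> 'b" where
  "traj X \<omega> = (\<lambda>t\<in>{0..}. X t \<omega>)"

abbreviation traj_space :: "(real \<Rightarrow> 'b::topological_space) measure" where
  "traj_space \<equiv> Pi\<^sub>M {0..} (\<lambda>_. borel)"

definition standard_BM :: "'w measure \<Rightarrow> (real \<Rightarrow> 'w \<Rightarrow> real) \<Rightarrow> bool" where
  "standard_BM M B \<longleftrightarrow>
     (\<forall>t\<ge>0. B t \<in> borel_measurable M) \<and>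
     (AE \<omega> in M. B 0 \<omega> = 0) \<and>
     (AE \<omega> in M. continuous_on {0..} (\<lambda>t. B t \<omega>)) \<and>
     (\<forall>s t. 0 \<le> s \<and> s < t \<longrightarrow>
        distributed M lborel (\<lambda>\<omega>. B t \<omega> - B s \<omega>) (\<lambda>x. ennreal (normal_density 0 (sqrt (t - s)) x))) \<and>
     (\<forall>(n::nat) \<tau>. (\<forall>i\<le>n. 0 \<le> \<tau> i) \<and> (\<forall>i<n. \<tau> i \<le> \<tau> (Suc i)) \<longrightarrow>
        prob_space.indep_vars M (\<lambda>_. borel) (\<lambda>i \<omega>. B (\<tau> (Suc i)) \<omega> - B (\<tau> i) \<omega>) {..<n})"

definition complex_BM :: "'w measure \<Rightarrow> (real \<Rightarrow> 'w \<Rightarrow> complex) \<Rightarrow> bool" where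
  "complex_BM M B \<longleftrightarrow>
     (\<exists>B1 B2. standard_BM M B1 \<and> standard_BM M B2 \<and>
        prob_space.indep_var M traj_space (traj B1) traj_space (traj B2) \<and>
        (\<forall>t\<ge>0. \<forall>\<omega>\<in>space M. B t \<omega> = (of_real (B1 t \<omega>) + \<i> * of_real (B2 t \<omega>)) / of_real (sqrt 2)))"

(* A continuous process with the law of exp(-t/2) B(exp t), B a complex Brownian motion.
   B may live on a different probability space; a space of functions real \<Rightarrow> complex
   (the Wiener space) is large enough to carry one. *)

definition complex_OU :: "'w measure \<Rightarrow> (real \<Rightarrow> 'w \<Rightarrow> complex) \<Rightarrow> bool" where
  "complex_OU M Z \<longleftrightarrow>
     (\<forall>t\<ge>0. Z t \<in> borel_measurable M) \<and>
     (AE \<omega> in M. continuous_on {0..} (\<lambda>t. Z t \<omega>)) \<and>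
     (\<exists>(M' :: (real \<Rightarrow> complex) measure) B. prob_space M' \<and> complex_BM M' B \<and>
        distr M traj_space (traj Z) =
        distr M' traj_space (traj (\<lambda>t \<omega>. of_real (exp (- t / 2)) * B (exp t) \<omega>)))"

definition iid_OU_family :: "'w measure \<Rightarrow> (int \<times> int \<Rightarrow> real \<Rightarrow> 'w \<Rightarrow> complex) \<Rightarrow> bool" where
  "iid_OU_family M \<zeta> \<longleftrightarrow>
     prob_space M \<and> (\<forall>kl. complex_OU M (\<zeta> kl)) \<and>
     prob_space.indep_vars M (\<lambda>_. traj_space) (\<lambda>kl. traj (\<zeta> kl)) UNIV"

(* The random points p 0, p 1, ... form a Poisson process of intensity measure
   d times Lebesgue measure, d > 0. Its total mass is infinite, so it has infinitely many
   points almost surely and can be enumerated by the natural numbers. *)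

definition poisson_points :: "'w measure \<Rightarrow> real \<Rightarrow> (nat \<Rightarrow> 'w \<Rightarrow> complex) \<Rightarrow> bool" where
  "poisson_points M d p \<longleftrightarrow>
     (\<forall>i. p i \<in> borel_measurable M) \<and>
     (\<forall>A\<in>sets borel. emeasure lborel A < \<infinity> \<longrightarrow>
        (AE \<omega> in M. finite {i. p i \<omega> \<in> A}) \<and>
        (\<forall>n. measure M {\<omega>\<in>space M. card {i. p i \<omega> \<in> A} = n} =
             exp (- (d * measure lborel A)) * (d * measure lborel A) ^ n / fact n)) \<and>
     (\<forall>(n::nat) A. (\<forall>j<n. A j \<in> sets borel \<and> emeasure lborel (A j) < \<infinity>) \<and>
        disjoint_family_on A {..<n} \<longrightarrow>
        prob_space.indep_vars M (\<lambda>_. count_space UNIV)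
          (\<lambda>j \<omega>. card {i. p i \<omega> \<in> A j}) {..<n})"

(* Starting points p i and displacements W i of the time dependent Poisson process.
   indep_set states that the families (p i) and (W i) are independent; indep_var would
   require both to have the same type. *)

definition poisson_BM :: "'w measure \<Rightarrow> (nat \<Rightarrow> 'w \<Rightarrow> complex) \<Rightarrow> (nat \<Rightarrow> real \<Rightarrow> 'w \<Rightarrow> complex) \<Rightarrow> bool" where
  "poisson_BM M p W \<longleftrightarrow>
     prob_space M \<and> poisson_points M (1 / pi) p \<and> (\<forall>i. complex_BM M (W i)) \<and>
     prob_space.indep_vars M (\<lambda>_. traj_space) (\<lambda>i. traj (W i)) UNIV \<and>
     prob_space.indep_set M
       {(\<lambda>\<omega> i. p i \<omega>) -` A \<inter> space M | A. A \<in> sets (Pi\<^sub>M UNIV (\<lambda>_. borel))}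
       {(\<lambda>\<omega> i. traj (W i) \<omega>) -` A \<inter> space M | A. A \<in> sets (Pi\<^sub>M UNIV (\<lambda>_. traj_space))}"

definition pp_points ::
  "(nat \<Rightarrow> 'w \<Rightarrow> complex) \<Rightarrow> (nat \<Rightarrow> real \<Rightarrow> 'w \<Rightarrow> complex) \<Rightarrow> nat \<Rightarrow> real \<Rightarrow> 'w \<Rightarrow> complex" where
  "pp_points p W i t \<omega> = p i \<omega> + W i t \<omega>"

definition pl_points ::
  "real \<Rightarrow> (int \<times> int \<Rightarrow> real \<Rightarrow> 'w \<Rightarrow> complex) \<Rightarrow> int \<times> int \<Rightarrow> real \<Rightarrow> 'w \<Rightarrow> complex" where
  "pl_points c \<zeta> = (\<lambda>(k, l) t \<omega>.
     of_real (sqrt pi) * (of_int k + \<i> * of_int l) + of_real c * \<zeta> (k, l) t \<omega>)"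

definition tc_points ::
  "real \<Rightarrow> (int \<times> int \<Rightarrow> real \<Rightarrow> 'w \<Rightarrow> complex) \<Rightarrow> int \<times> int \<times> nat \<Rightarrow> real \<Rightarrow> 'w \<Rightarrow> complex" where
  "tc_points c \<zeta> = (\<lambda>(k, l, m) t \<omega>.
     of_real (sqrt (3 * pi)) * (of_int k + \<i> * of_int l)
       + of_real c * exp (2 * of_real pi * \<i> * of_nat m / 3) * \<zeta> (k, l) t \<omega>)"

(* Points of the family (X i), i \<in> I, are counted with multiplicity. The case distinction
   is needed because card is 0 on infinite sets. *)

definition at_least_points_event ::
  "'w measure \<Rightarrow> 'i set \<Rightarrow> ('i \<Rightarrow> real \<Rightarrow> 'w \<Rightarrow> complex) \<Rightarrow> real \<Rightarrow> real \<Rightarrow> nat \<Rightarrow> 'w set" where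
  "at_least_points_event M I X T R N =
     {\<omega>\<in>space M. \<forall>t\<in>{0..T}.
        infinite {i\<in>I. X i t \<omega> \<in> cball 0 R} \<or> N \<le> card {i\<in>I. X i t \<omega> \<in> cball 0 R}}"

(* The library's ln is total, with ln 0 = 0. *)

definition log_prob :: "real \<Rightarrow> ereal" where
  "log_prob x = (if x = 0 then -\<infinity> else ereal (ln x))"

(* The event is an uncountable intersection over t and need only be measurable up to a null
   set (path continuity and local finiteness hold almost surely), hence the completion. *)

definition persistence_rate ::
  "'w measure \<Rightarrow> 'i set \<Rightarrow> ('i \<Rightarrow> real \<Rightarrow> 'w \<Rightarrow> complex) \<Rightarrow> real \<Rightarrow> nat \<Rightarrow> ereal" where
  "persistence_rate M I X R N =
     Liminf at_top (\<lambda>T::real.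
       ereal (1 / T) * log_prob (measure (completion M) (at_least_points_event M I X T R N)))"

end

theory Submission
  imports Defs
begin

text \<open>
  The probability that a walk with independent steps stays in a tube is bounded below by test
  functions that vanish outside the tube and shrink by at most a factor \<open>l\<close> under one step.
  For the disc of radius \<open>r\<close> the function \<open>exp (- (v / r)\<^sup>2) - exp (- 1)\<close> works: it is
  positive exactly inside, and its Gaussian averages are explicit. A tilt \<open>exp (\<beta> * v)\<close>
  absorbs the drift of an Ornstein-Uhlenbeck process around \<open>y\<close>, at a cost quadratic in \<open>y\<close>.
  The bounds are uniform in the mesh of the grid of times and so pass to all dyadic times.

  For the Poisson process, some \<open>N\<close> points start in the disc of radius \<open>R / 2\<close> with positive
  probability, and each displacement stays below \<open>R / 2\<close> at rate of order \<open>1 / R\<^sup>2\<close>. For the lattices,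
  \<open>N\<close> sites at distance of order \<open>sqrt N\<close> are held in the disc, each at rate of order \<open>N\<close>.

  Exit probabilities (from the test function \<open>1 - exp ((T - t) / 2) * cosh v / cosh a\<close>)
  and the Borel-Cantelli lemma show that almost surely only finitely many points enter the disc,
  which makes the event measurable for the completed measure.
\<close>

section \<open>Random walks in a tube\<close>

text \<open>The Brownian motions are given through their increments, so instead of a differential
  inequality for a generator there is an exact inequality for one step: a loss
  \<open>exp (- h * rate)\<close> per step of length \<open>h\<close> becomes
  \<open>exp (- T * rate)\<close> after \<open>T / h\<close> steps, whatever the mesh. The
  difficulty is the edge of the tube, where the test function vanishes and a bound by a factor must
  still hold. It holds because the bell \<open>exp (- (v / r)\<^sup>2)\<close> has its inflection
  points at distance r / sqrt 2, inside the tube: near the edge it is convex and averaging raises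
  it. Cutting off the negative part raises averages further, so the overshoot of a step never has to
  be controlled. An Ornstein-Uhlenbeck process is Brownian motion read at the times exp t and
  rescaled; hence the grids may be irregular and the tubes may vary with time. Staying near y means
  resisting a drift of order y / 2 with a tilt of order y, which costs a rate of order y^2.\<close>

lemma tube_PiM:
  fixes \<mu> :: "nat \<Rightarrow> real measure" and g :: "nat \<Rightarrow> real \<Rightarrow> ennreal"
  assumes prob: "\<And>i. prob_space (\<mu> i)" and sets[measurable_cong]: "\<And>i. sets (\<mu> i) = sets borel"
    and g[measurable]: "\<And>k. g k \<in> borel_measurable borel"
    and A[measurable]: "\<And>k. A k \<in> sets borel"
    and step: "\<And>k s. k < n \<Longrightarrow> s \<in> A k \<Longrightarrow> l * g k s \<le> (\<integral>\<^sup>+x. g (Suc k) (s + x) \<partial>\<mu> k)"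
    and supp: "\<And>k s. k \<le> n \<Longrightarrow> g k s \<le> G * indicator (A k) s"
  shows "l ^ n * g 0 0 \<le>
    G * emeasure (PiM {..<n} \<mu>) {x \<in> space (PiM {..<n} \<mu>). \<forall>k\<le>n. (\<Sum>i<k. x i) \<in> A k}"
proof -
  interpret prob_space "\<mu> i" for i by (rule prob)
  interpret product_sigma_finite \<mu> ..
  define S :: "nat \<Rightarrow> (nat \<Rightarrow> real) \<Rightarrow> real" where "S k x = (\<Sum>i<k. x i)" for k x
  have S_meas[measurable]: "S k \<in> borel_measurable (PiM {..<m} \<mu>)" if "k \<le> m" for k m
    unfolding S_def using that by (intro borel_measurable_sum measurable_component_singleton) auto
  \<comment> \<open>The test function killed on leaving the tube. The product stops before
    \<open>k\<close> because \<open>supp\<close> already makes \<open>g k\<close> vanish off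
    \<open>A k\<close>. Integrating out the last coordinate shows that its expectation shrinks by at
    most the factor \<open>l\<close> per step.\<close>
  define \<Phi> where "\<Phi> k x = g k (S k x) * (\<Prod>j<k. indicator (A j) (S j x))" for k x
  have \<Phi>_meas[measurable]: "\<Phi> k \<in> borel_measurable (PiM {..<k} \<mu>)" for k
    unfolding \<Phi>_def by measurable
  have ind: "l ^ k * g 0 0 \<le> (\<integral>\<^sup>+x. \<Phi> k x \<partial>PiM {..<k} \<mu>)" if "k \<le> n" for k
    using that
  proof (induction k)
    case 0
    then show ?case by (simp add: \<Phi>_def S_def PiM_empty nn_integral_count_space_finite)
  next
    case (Suc k)
    have S_upd: "S j (x(k := y)) = S j x" if "j \<le> k" for j x y
      unfolding S_def using that by (intro sum.cong) auto
    have S_Suc: "S (Suc k) (x(k := y)) = S k x + y" for x y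
      using S_upd[of k x y] by (simp add: S_def)
    have P_upd: "(\<Prod>j<Suc k. indicator (A j) (S j (x(k := y)))) = (\<Prod>j<Suc k. indicator (A j) (S j x) :: ennreal)" for x y
      by (intro prod.cong) (auto simp: S_upd)
    have "l ^ Suc k * g 0 0 = l * (l ^ k * g 0 0)" by (simp add: mult.assoc)
    also have "\<dots> \<le> l * (\<integral>\<^sup>+x. \<Phi> k x \<partial>PiM {..<k} \<mu>)"
      using Suc by (intro mult_left_mono) auto
    also have "\<dots> = (\<integral>\<^sup>+x. l * \<Phi> k x \<partial>PiM {..<k} \<mu>)"
      by (simp add: nn_integral_cmult)
    also have "\<dots> \<le> (\<integral>\<^sup>+x. (\<integral>\<^sup>+y. \<Phi> (Suc k) (x(k := y)) \<partial>\<mu> k) \<partial>PiM {..<k} \<mu>)"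
    proof (rule nn_integral_mono)
      fix x
      have "l * \<Phi> k x \<le> (\<integral>\<^sup>+y. g (Suc k) (S k x + y) \<partial>\<mu> k) * (\<Prod>j<Suc k. indicator (A j) (S j x))"
      proof (cases "S k x \<in> A k")
        case True
        then have "l * g k (S k x) \<le> (\<integral>\<^sup>+y. g (Suc k) (S k x + y) \<partial>\<mu> k)"
          using step Suc.prems by auto
        from mult_right_mono[OF this, of "\<Prod>j<k. indicator (A j) (S j x)"] True show ?thesis
          by (simp add: \<Phi>_def mult.assoc)
      next
        case False
        then have "g k (S k x) = 0" using supp[of k "S k x"] Suc.prems by simp
        then show ?thesis by (simp add: \<Phi>_def)
      qed
      also have "\<dots> = (\<integral>\<^sup>+y. g (Suc k) (S k x + y) * (\<Prod>j<Suc k. indicator (A j) (S j x)) \<partial>\<mu> k)"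
        by (subst nn_integral_multc) auto
      also have "\<dots> = (\<integral>\<^sup>+y. \<Phi> (Suc k) (x(k := y)) \<partial>\<mu> k)"
        unfolding \<Phi>_def S_Suc P_upd ..
      finally show "l * \<Phi> k x \<le> (\<integral>\<^sup>+y. \<Phi> (Suc k) (x(k := y)) \<partial>\<mu> k)" .
    qed
    also have "\<dots> = (\<integral>\<^sup>+x. \<Phi> (Suc k) x \<partial>PiM {..<Suc k} \<mu>)"
      unfolding lessThan_Suc by (subst product_nn_integral_insert) (auto simp flip: lessThan_Suc)
    finally show ?case .
  qed
  let ?E = "{x \<in> space (PiM {..<n} \<mu>). \<forall>k\<le>n. S k x \<in> A k}"
  have E: "?E \<in> sets (PiM {..<n} \<mu>)"
  proof -
    have "?E = {x \<in> space (PiM {..<n} \<mu>). \<forall>k\<in>{..n}. S k x \<in> A k}" by auto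
    also have "\<dots> \<in> sets (PiM {..<n} \<mu>)"
    proof (rule sets.sets_Collect_finite_All')
      fix k assume "k \<in> {..n}"
      then have [measurable]: "S k \<in> borel_measurable (PiM {..<n} \<mu>)" by auto
      show "{x \<in> space (PiM {..<n} \<mu>). S k x \<in> A k} \<in> sets (PiM {..<n} \<mu>)" by measurable
    qed auto
    finally show ?thesis .
  qed
  have "l ^ n * g 0 0 \<le> (\<integral>\<^sup>+x. \<Phi> n x \<partial>PiM {..<n} \<mu>)" using ind by auto
  also have "\<dots> \<le> (\<integral>\<^sup>+x. G * indicator ?E x \<partial>PiM {..<n} \<mu>)"
  proof (rule nn_integral_mono)
    fix x assume x: "x \<in> space (PiM {..<n} \<mu>)"
    show "\<Phi> n x \<le> G * indicator ?E x"
    proof (cases "\<forall>k\<le>n. S k x \<in> A k")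
      case True
      then have "\<Phi> n x = g n (S n x)" by (simp add: \<Phi>_def)
      also have "\<dots> \<le> G * indicator (A n) (S n x)" using supp by auto
      finally show ?thesis using True x by (simp add: indicator_def)
    next
      case False
      then obtain k where k: "k \<le> n" "S k x \<notin> A k" by auto
      have "\<Phi> n x = 0"
      proof (cases "k = n")
        case True then show ?thesis using supp[of n "S n x"] k by (simp add: \<Phi>_def)
      next
        case False
        then have "(\<Prod>j<n. indicator (A j) (S j x) :: ennreal) = 0"
          using k by (intro prod_zero) (auto intro!: bexI[of _ k])
        then show ?thesis by (simp add: \<Phi>_def)
      qed
      then show ?thesis by simp
    qed
  qed
  also have "\<dots> = G * emeasure (PiM {..<n} \<mu>) ?E" using E by (simp add: nn_integral_cmult)
  finally show ?thesis by (simp add: S_def)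
qed

abbreviation gauss :: "real \<Rightarrow> real measure" where
  "gauss \<sigma> \<equiv> density lborel (\<lambda>x. ennreal (normal_density 0 \<sigma> x))"

text \<open>The increments of Brownian motion along the grid have the product law of
  \<open>tube_PiM\<close>, and their partial sums telescope to the values of the motion.\<close>

lemma standard_BM_tube:
  fixes g :: "nat \<Rightarrow> real \<Rightarrow> ennreal"
  assumes M: "prob_space M" and B: "standard_BM M B"
    and \<tau>0: "\<tau> 0 = 0" and \<tau>: "\<And>k. k < n \<Longrightarrow> \<tau> k < \<tau> (Suc k)" and n: "0 < n"
    and g: "\<And>k. g k \<in> borel_measurable borel"
    and A[measurable]: "\<And>k. A k \<in> sets borel"
    and step: "\<And>k s. k < n \<Longrightarrow> s \<in> A k \<Longrightarrow>
      l * g k s \<le> (\<integral>\<^sup>+x. g (Suc k) (s + x) \<partial>gauss (sqrt (\<tau> (Suc k) - \<tau> k)))"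
    and supp: "\<And>k s. k \<le> n \<Longrightarrow> g k s \<le> G * indicator (A k) s"
  shows "l ^ n * g 0 0 \<le> G * emeasure M {\<omega> \<in> space M. \<forall>k\<le>n. B (\<tau> k) \<omega> \<in> A k}"
proof -
  interpret prob_space M by (rule M)
  \<comment> \<open>\<open>\<tau>\<close> is known to increase only up to \<open>n\<close>; the
    default \<open>gauss 1\<close> keeps every factor a probability measure, as
    \<open>tube_PiM\<close> demands.\<close>
  define \<mu> where "\<mu> i = (if i < n then gauss (sqrt (\<tau> (Suc i) - \<tau> i)) else gauss 1)" for i
  define X where "X i \<omega> = B (\<tau> (Suc i)) \<omega> - B (\<tau> i) \<omega>" for i \<omega>
  have mono: "0 \<le> \<tau> k" if "k \<le> n" for k
    using that by (induction k) (auto simp: \<tau>0 intro: order_trans[OF _ less_imp_le[OF \<tau>]])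
  have meas: "B (\<tau> k) \<in> borel_measurable M" if "k \<le> n" for k
    using B mono[OF that] by (auto simp: standard_BM_def)
  have dist: "distr M borel (X i) = \<mu> i" if "i < n" for i
  proof -
    have "distributed M lborel (X i) (\<lambda>x. ennreal (normal_density 0 (sqrt (\<tau> (Suc i) - \<tau> i)) x))"
      using B \<tau>[OF that] mono[of i] that unfolding standard_BM_def X_def by auto
    then have "distr M lborel (X i) = \<mu> i" using that by (simp add: distributed_def \<mu>_def)
    moreover have "distr M lborel (X i) = distr M borel (X i)" by (rule distr_cong) auto
    ultimately show ?thesis by simp
  qed
  have X_meas[measurable]: "X i \<in> borel_measurable M" if "i < n" for i
    using meas[of i] meas[of "Suc i"] that unfolding X_def by auto
  have \<mu>_prob: "prob_space (\<mu> i)" for i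
    unfolding \<mu>_def using \<tau>[of i] by (auto intro!: prob_space_normal_density)
  have indep: "indep_vars (\<lambda>_. borel) X {..<n}"
  proof -
    have "(\<forall>i\<le>n. 0 \<le> \<tau> i) \<and> (\<forall>i<n. \<tau> i \<le> \<tau> (Suc i))" using mono \<tau> by (auto intro: less_imp_le)
    then show ?thesis using B unfolding standard_BM_def X_def[abs_def] by blast
  qed
  have law: "distr M (PiM {..<n} (\<lambda>_. borel)) (\<lambda>\<omega>. \<lambda>i\<in>{..<n}. X i \<omega>) = PiM {..<n} \<mu>"
  proof -
    have "distr M (PiM {..<n} (\<lambda>_. borel)) (\<lambda>\<omega>. \<lambda>i\<in>{..<n}. X i \<omega>) = PiM {..<n} (\<lambda>i. distr M borel (X i))"
      using indep n by (subst (asm) indep_vars_iff_distr_eq_PiM') auto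
    also have "\<dots> = PiM {..<n} \<mu>" by (rule PiM_cong) (auto simp: dist)
    finally show ?thesis .
  qed
  have sets_PiM: "sets (PiM {..<n} \<mu>) = sets (PiM {..<n} (\<lambda>_. borel))"
    by (rule sets_PiM_cong) (auto simp: \<mu>_def)
  let ?E = "{x \<in> space (PiM {..<n} \<mu>). \<forall>k\<le>n. (\<Sum>i<k. x i) \<in> A k}"
  have E: "?E \<in> sets (PiM {..<n} (\<lambda>_. borel))"
  proof -
    have "?E = {x \<in> space (PiM {..<n} (\<lambda>_. borel)). \<forall>k\<in>{..n}. (\<Sum>i<k. x i) \<in> A k}"
      using sets_eq_imp_space_eq[OF sets_PiM] by auto
    also have "\<dots> \<in> sets (PiM {..<n} (\<lambda>_. borel))"
    proof (rule sets.sets_Collect_finite_All')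
      fix k assume "k \<in> {..n}"
      then have [measurable]: "(\<lambda>x. \<Sum>i<k. x i :: real) \<in> borel_measurable (PiM {..<n} (\<lambda>_. borel))"
        by (auto intro!: borel_measurable_sum measurable_component_singleton)
      show "{x \<in> space (PiM {..<n} (\<lambda>_. borel)). (\<Sum>i<k. x i) \<in> A k} \<in> sets (PiM {..<n} (\<lambda>_. borel))"
        by measurable
    qed auto
    finally show ?thesis .
  qed
  have tup: "(\<lambda>\<omega>. \<lambda>i\<in>{..<n}. X i \<omega>) \<in> measurable M (PiM {..<n} (\<lambda>_. borel))"
    by (intro measurable_restrict) auto
  have E_M: "{\<omega> \<in> space M. \<forall>k\<le>n. B (\<tau> k) \<omega> \<in> A k} \<in> sets M"
  proof -
    have "{\<omega> \<in> space M. \<forall>k\<in>{..n}. B (\<tau> k) \<omega> \<in> A k} \<in> sets M"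
    proof (rule sets.sets_Collect_finite_All')
      fix k assume "k \<in> {..n}"
      then have [measurable]: "B (\<tau> k) \<in> borel_measurable M" using meas by auto
      show "{\<omega> \<in> space M. B (\<tau> k) \<omega> \<in> A k} \<in> sets M" by measurable
    qed auto
    then show ?thesis by (rule back_subst[of "\<lambda>E. E \<in> sets M"]) auto
  qed
  \<comment> \<open>The motion starts at 0 only almost surely, so the telescoping sums agree with it
    outside a null set.\<close>
  have "AE \<omega> in M. B 0 \<omega> = 0" using B by (auto simp: standard_BM_def)
  then have AE: "AE \<omega> in M. (\<lambda>i\<in>{..<n}. X i \<omega>) \<in> ?E \<longleftrightarrow> (\<forall>k\<le>n. B (\<tau> k) \<omega> \<in> A k)"
  proof eventually_elim
    case (elim \<omega>)
    have sum: "(\<Sum>i<k. (\<lambda>i\<in>{..<n}. X i \<omega>) i) = B (\<tau> k) \<omega>" if "k \<le> n" for k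
    proof -
      have "(\<Sum>i<k. (\<lambda>i\<in>{..<n}. X i \<omega>) i) = (\<Sum>i<k. B (\<tau> (Suc i)) \<omega> - B (\<tau> i) \<omega>)"
        using that by (intro sum.cong) (auto simp: X_def)
      also have "\<dots> = B (\<tau> k) \<omega>" using elim \<tau>0 sum_lessThan_telescope[of "\<lambda>i. B (\<tau> i) \<omega>" k] by simp
      finally show ?thesis .
    qed
    have "(\<lambda>i\<in>{..<n}. X i \<omega>) \<in> space (PiM {..<n} \<mu>)"
      by (auto simp: space_PiM \<mu>_def)
    then have "(\<lambda>i\<in>{..<n}. X i \<omega>) \<in> ?E \<longleftrightarrow> (\<forall>k\<le>n. (\<Sum>i<k. (\<lambda>i\<in>{..<n}. X i \<omega>) i) \<in> A k)"
      by blast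
    also have "\<dots> \<longleftrightarrow> (\<forall>k\<le>n. B (\<tau> k) \<omega> \<in> A k)" by (metis sum)
    finally show ?case .
  qed
  have "emeasure (PiM {..<n} \<mu>) ?E = emeasure M ((\<lambda>\<omega>. \<lambda>i\<in>{..<n}. X i \<omega>) -` ?E \<inter> space M)"
    by (subst emeasure_distr[OF tup E, symmetric]) (simp only: law)
  also have "\<dots> = emeasure M {\<omega> \<in> space M. \<forall>k\<le>n. B (\<tau> k) \<omega> \<in> A k}"
  proof (rule emeasure_eq_AE)
    show "AE \<omega> in M. \<omega> \<in> (\<lambda>\<omega>. \<lambda>i\<in>{..<n}. X i \<omega>) -` ?E \<inter> space M \<longleftrightarrow>
        \<omega> \<in> {\<omega> \<in> space M. \<forall>k\<le>n. B (\<tau> k) \<omega> \<in> A k}"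
      using AE AE_space by eventually_elim blast
    show "(\<lambda>\<omega>. \<lambda>i\<in>{..<n}. X i \<omega>) -` ?E \<inter> space M \<in> sets M" by (rule measurable_sets[OF tup E])
  qed (rule E_M)
  finally have "emeasure (PiM {..<n} \<mu>) ?E = emeasure M {\<omega> \<in> space M. \<forall>k\<le>n. B (\<tau> k) \<omega> \<in> A k}" .
  moreover have "l ^ n * g 0 0 \<le> G * emeasure (PiM {..<n} \<mu>) ?E"
    using step supp by (intro tube_PiM \<mu>_prob g A) (auto simp: \<mu>_def)
  ultimately show ?thesis by simp
qed

section \<open>Gaussian test functions\<close>

text \<open>\<open>ennreal\<close> cuts off negative values. This leads from the exact integrals of
  signed functions to the nonnegative test functions of the tube lemma.\<close>

lemma ennreal_integral_le_nn_integral: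
  fixes f :: "'a \<Rightarrow> real"
  assumes "integrable M f"
  shows "ennreal (\<integral>x. f x \<partial>M) \<le> (\<integral>\<^sup>+x. ennreal (f x) \<partial>M)"
proof -
  have "(\<integral>\<^sup>+x. ennreal (f x) \<partial>M) < \<infinity>"
    using assms by (auto simp: real_integrable_def less_top)
  moreover have "(\<integral>x. f x \<partial>M) \<le> enn2real (\<integral>\<^sup>+x. ennreal (f x) \<partial>M)"
    using assms by (simp add: real_lebesgue_integral_def)
  ultimately show ?thesis by (metis ennreal_enn2real ennreal_leI infinity_ennreal_def)
qed

text \<open>Completing the square: an exponential tilt moves the mean of a Gaussian. It serves to
  cancel the drift and, with \<open>b\<close> equal to 1 and -1, to average
  \<open>cosh\<close>.\<close>

lemma normal_density_mult_exp:
  assumes "0 < \<sigma>"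
  shows "normal_density 0 \<sigma> x * exp (b * x) = exp (b\<^sup>2 * \<sigma>\<^sup>2 / 2) * normal_density (b * \<sigma>\<^sup>2) \<sigma> x"
proof -
  have "- x\<^sup>2 / (2 * \<sigma>\<^sup>2) + b * x = b\<^sup>2 * \<sigma>\<^sup>2 / 2 + - (x - b * \<sigma>\<^sup>2)\<^sup>2 / (2 * \<sigma>\<^sup>2)"
    using assms by (simp add: field_simps power2_eq_square)
  then have "exp (- x\<^sup>2 / (2 * \<sigma>\<^sup>2)) * exp (b * x) =
      exp (b\<^sup>2 * \<sigma>\<^sup>2 / 2) * exp (- (x - b * \<sigma>\<^sup>2)\<^sup>2 / (2 * \<sigma>\<^sup>2))"
    by (metis exp_add)
  then show ?thesis by (simp add: normal_density_def)
qed

text \<open>A product of Gaussians adds precisions: \<open>m\<close> is the factor by which the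
  precision \<open>1 / \<sigma>\<^sup>2\<close> grows, and what stands before the new density is the
  Gaussian average of the bell.\<close>

lemma normal_density_mult_gaussian:
  assumes \<sigma>: "0 < \<sigma>" and \<kappa>: "0 \<le> \<kappa>" and m: "m = 1 + 2 * \<kappa> * \<sigma>\<^sup>2"
  shows "normal_density \<mu> \<sigma> x * exp (- (\<kappa> * (a + x)\<^sup>2)) =
    exp (- (\<kappa> * (a + \<mu>)\<^sup>2 / m)) / sqrt m * normal_density ((\<mu> - 2 * \<kappa> * \<sigma>\<^sup>2 * a) / m) (\<sigma> / sqrt m) x"
proof -
  have m1: "m \<ge> 1" using assms by auto
  have "- (x - \<mu>)\<^sup>2 / (2 * \<sigma>\<^sup>2) + - (\<kappa> * (a + x)\<^sup>2)
     = - (\<kappa> * (a + \<mu>)\<^sup>2 / m) + - (x - (\<mu> - 2 * \<kappa> * \<sigma>\<^sup>2 * a) / m)\<^sup>2 / (2 * (\<sigma>\<^sup>2 / m))"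
  proof -
    have key: "m * (x - \<mu>)\<^sup>2 + 2 * \<sigma>\<^sup>2 * m * \<kappa> * (a + x)\<^sup>2 = 2 * \<sigma>\<^sup>2 * \<kappa> * (a + \<mu>)\<^sup>2 + (m * x - (\<mu> - 2 * \<kappa> * \<sigma>\<^sup>2 * a))\<^sup>2"
      unfolding m by algebra
    have e: "(x - (\<mu> - 2 * \<kappa> * \<sigma>\<^sup>2 * a) / m)\<^sup>2 / (2 * (\<sigma>\<^sup>2 / m)) = (m * x - (\<mu> - 2 * \<kappa> * \<sigma>\<^sup>2 * a))\<^sup>2 / (2 * \<sigma>\<^sup>2 * m)"
    proof -
      have "x - (\<mu> - 2 * \<kappa> * \<sigma>\<^sup>2 * a) / m = (m * x - (\<mu> - 2 * \<kappa> * \<sigma>\<^sup>2 * a)) / m"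
        using m1 by (simp add: field_simps)
      then show ?thesis using m1 \<sigma> by (simp add: power_divide power2_eq_square)
    qed
    have "(x - \<mu>)\<^sup>2 / (2 * \<sigma>\<^sup>2) + \<kappa> * (a + x)\<^sup>2 = (m * (x - \<mu>)\<^sup>2 + 2 * \<sigma>\<^sup>2 * m * \<kappa> * (a + x)\<^sup>2) / (2 * \<sigma>\<^sup>2 * m)"
      using m1 \<sigma> by (simp add: field_simps)
    also have "\<dots> = \<kappa> * (a + \<mu>)\<^sup>2 / m + (m * x - (\<mu> - 2 * \<kappa> * \<sigma>\<^sup>2 * a))\<^sup>2 / (2 * \<sigma>\<^sup>2 * m)"
      unfolding key using m1 \<sigma> by (simp add: add_divide_distrib)
    finally show ?thesis using e by simp
  qed
  moreover have "(\<sigma> / sqrt m)\<^sup>2 = \<sigma>\<^sup>2 / m" using m1 by (simp add: power_divide)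
  ultimately have "exp (- (x - \<mu>)\<^sup>2 / (2 * \<sigma>\<^sup>2)) * exp (- (\<kappa> * (a + x)\<^sup>2))
     = exp (- (\<kappa> * (a + \<mu>)\<^sup>2 / m)) * exp (- (x - (\<mu> - 2 * \<kappa> * \<sigma>\<^sup>2 * a) / m)\<^sup>2 / (2 * (\<sigma> / sqrt m)\<^sup>2))"
    by (metis exp_add)
  moreover have "sqrt (2 * pi * \<sigma>\<^sup>2) = sqrt m * sqrt (2 * pi * (\<sigma> / sqrt m)\<^sup>2)"
    using m1 by (simp add: power_divide flip: real_sqrt_mult)
  ultimately show ?thesis by (simp add: normal_density_def)
qed

text \<open>With \<open>w = (v / r)\<^sup>2\<close> the right side is the Gaussian average of the
  bell minus its edge value. To first order in \<open>d = 1 - 1 / m\<close> averaging multiplies the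
  bell by \<open>1 + d * (w - 1 / 2)\<close>: a loss in the centre, but a gain at the edge
  \<open>w = 1\<close>, where the left side is 0.\<close>

lemma gaussian_bump_decay:
  fixes w m :: real
  assumes w: "0 \<le> w" "w \<le> 1" and m: "1 \<le> m" "m \<le> 3 / 2"
  shows "(1 - 2 * (m - 1)) * (exp (- w) - exp (- 1)) \<le> exp (- (w / m)) / sqrt m - exp (- 1)"
proof -
  define d where "d = 1 - 1 / m"
  have d: "0 \<le> d" "d \<le> 1 / 3" using m by (auto simp: d_def field_simps)
  have dm: "d \<le> m - 1"
  proof -
    have "d = (m - 1) / m" using m by (simp add: d_def field_simps)
    also have "\<dots> \<le> (m - 1) / 1" using m by (intro divide_left_mono) auto
    finally show ?thesis by simp
  qed
  \<comment> \<open>The coefficient 3 / 4 in place of the first order 1 / 2 pays for the quadratic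
    term of the square root.\<close>
  have sq: "1 - 3 / 4 * d \<le> 1 / sqrt m"
  proof -
    have "1 - 3 / 4 * d \<le> sqrt (1 - d)"
    proof (rule real_le_rsqrt)
      have "d * d \<le> d * (1 / 3)" using d by (intro mult_left_mono) auto
      then show "(1 - 3 / 4 * d)\<^sup>2 \<le> 1 - d" using d by (simp add: power2_eq_square algebra_simps)
    qed
    also have "\<dots> = 1 / sqrt m" using m by (simp add: d_def real_sqrt_divide)
    finally show ?thesis .
  qed
  have ew: "exp (- w) * (1 + w * d) \<le> exp (- (w / m))"
  proof -
    have "exp (- (w / m)) = exp (- w) * exp (w * d)"
      by (simp add: d_def exp_add[symmetric] algebra_simps)
    then show ?thesis using exp_ge_add_one_self[of "w * d"] by simp
  qed
  \<comment> \<open>The condition that remains at first order, with equality at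
    \<open>w = 1\<close>. The coefficient 3 / 4 of \<open>w\<close>, instead of 1, keeps
    \<open>d * w / 4\<close> in reserve for the mixed term \<open>3 / 4 * (d * (d * w))\<close>;
    this uses \<open>d \<le> 1 / 3\<close>.\<close>
  have e1: "2 * exp (- 1) \<le> (5 / 4 + 3 / 4 * w) * exp (- w)"
  proof -
    have "exp (- w) = exp (- 1) * exp (1 - w)" by (simp add: exp_add[symmetric])
    also have "\<dots> \<ge> exp (- 1) * (2 - w)"
      using exp_ge_add_one_self[of "1 - w"] by (intro mult_left_mono) auto
    finally have "(5 / 4 + 3 / 4 * w) * (exp (- 1) * (2 - w)) \<le> (5 / 4 + 3 / 4 * w) * exp (- w)"
      using w by (intro mult_left_mono) auto
    moreover have "2 * exp (-1) \<le> (5 / 4 + 3 / 4 * w) * (exp (- 1) * (2 - w))"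
    proof -
      have "w * w \<le> w" using w mult_left_mono[of w 1 w] by simp
      moreover have "(5 / 4 + 3 / 4 * w) * (2 - w) = 5 / 2 + w / 4 - 3 / 4 * (w * w)"
        by (simp add: field_simps)
      ultimately have "2 \<le> (5 / 4 + 3 / 4 * w) * (2 - w)" using w by linarith
      then have "exp (- 1) * 2 \<le> exp (- 1) * ((5 / 4 + 3 / 4 * w) * (2 - w))"
        by (intro mult_left_mono) auto
      also have "\<dots> = (5 / 4 + 3 / 4 * w) * (exp (- 1) * (2 - w))" by (simp only: mult_ac)
      finally show ?thesis by (simp only: mult_ac)
    qed
    ultimately show ?thesis by (rule order_trans[rotated])
  qed
  have "(1 - 2 * d) * exp (- w) + d * (2 * exp (- 1)) \<le>
      (1 - 2 * d) * exp (- w) + d * ((5 / 4 + 3 / 4 * w) * exp (- w))"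
    using e1 d by (intro add_left_mono mult_left_mono) auto
  also have "\<dots> = (1 + d * (3 / 4 * w - 3 / 4)) * exp (- w)" by (simp add: algebra_simps)
  also have "\<dots> \<le> ((1 - 3 / 4 * d) * (1 + w * d)) * exp (- w)"
  proof (intro mult_right_mono)
    have e3: "3 / 4 * (d * (d * w)) \<le> 1 / 4 * (d * w)"
      using d w mult_right_mono[of d "1/3" "d * w"] by simp
    have e2: "(1 - 3 / 4 * d) * (1 + w * d) = 1 - 3 / 4 * d + d * w - 3 / 4 * (d * (d * w))"
      "1 + d * (3 / 4 * w - 3 / 4) = 1 + 3 / 4 * (d * w) - 3 / 4 * d"
      by (simp_all add: field_simps)
    show "1 + d * (3 / 4 * w - 3 / 4) \<le> (1 - 3 / 4 * d) * (1 + w * d)"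
      unfolding e2 using e3 by linarith
  qed auto
  also have "\<dots> = (1 - 3 / 4 * d) * (exp (- w) * (1 + w * d))" by simp
  also have "\<dots> \<le> 1 / sqrt m * exp (- (w / m))"
    using sq ew d w m by (intro mult_mono) auto
  finally have "(1 - 2 * d) * (exp (- w) - exp (- 1)) \<le> exp (- (w / m)) / sqrt m - exp (- 1)"
    by (simp add: algebra_simps)
  moreover have "(1 - 2 * (m - 1)) * (exp (- w) - exp (- 1)) \<le> (1 - 2 * d) * (exp (- w) - exp (- 1))"
    using dm w by (intro mult_right_mono) auto
  ultimately show ?thesis by simp
qed

text \<open>Left negative outside the tube so that Gaussian averages stay in closed form;
  \<open>ennreal\<close> makes the cut where the function is used. The subtracted
  \<open>exp (- 1)\<close> is the value of the bell at the edge.\<close>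

definition bump :: "real \<Rightarrow> real \<Rightarrow> real \<Rightarrow> real" where
  "bump r \<beta> v = exp (\<beta> * v) * (exp (- (v / r)\<^sup>2) - exp (- 1))"

lemma bump_measurable[measurable]: "bump r \<beta> \<in> borel_measurable borel"
  unfolding bump_def[abs_def] by measurable

lemma bump_le_0:
  assumes "0 < r" "r \<le> \<bar>v\<bar>"
  shows "bump r \<beta> v \<le> 0"
proof -
  have "1 \<le> (\<bar>v\<bar> / r)\<^sup>2" using assms by (intro one_le_power) (simp add: field_simps)
  then have "exp (- (v / r)\<^sup>2) \<le> exp (- 1)" by (simp add: power_divide)
  then show ?thesis by (simp add: bump_def mult_le_0_iff)
qed

lemma bump_le:
  assumes "0 < r"
  shows "ennreal (bump r \<beta> v) \<le> ennreal (exp (\<bar>\<beta>\<bar> * r)) * indicator {-r..r} v"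
proof (cases "\<bar>v\<bar> \<le> r")
  case True
  have "\<beta> * v \<le> \<bar>\<beta>\<bar> * \<bar>v\<bar>" by (metis abs_ge_self abs_mult)
  also have "\<dots> \<le> \<bar>\<beta>\<bar> * r" using True by (intro mult_left_mono) auto
  finally have le: "exp (\<beta> * v) \<le> exp (\<bar>\<beta>\<bar> * r)" by simp
  have "exp (- (v / r)\<^sup>2) \<le> 1" by simp
  then have "exp (- (v / r)\<^sup>2) - exp (- 1) \<le> 1" by (smt (verit) exp_ge_zero)
  then have "bump r \<beta> v \<le> exp (\<beta> * v) * 1"
    unfolding bump_def by (intro mult_left_mono) auto
  then have "bump r \<beta> v \<le> exp (\<bar>\<beta>\<bar> * r)" using le by linarith
  moreover have "indicator {-r..r} v = (1::ennreal)" using True by (intro indicator_simps(1)) auto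
  ultimately show ?thesis by (simp add: ennreal_leI)
next
  case False
  then show ?thesis using bump_le_0[OF assms, of v \<beta>] by (simp add: ennreal_neg)
qed

text \<open>If \<open>v\<close> is the deviation of an Ornstein-Uhlenbeck process from
  \<open>y\<close>, one step leads to \<open>\<rho> * v - (1 - \<rho>) * y\<close> plus noise. The
  tilt moves the mean of the noise by \<open>\<beta> * s\<^sup>2\<close>, which by the choice of
  \<open>\<beta>\<close> cancels the drift, so the bell is averaged around
  \<open>\<rho> * v\<close>; the contraction by \<open>\<rho>\<close> only helps. The two terms of
  the exponent are the decay of the bell and the change of the tilting factor.\<close>

lemma bump_gauss:
  assumes r: "0 < r" and s: "0 < s" "8 * s\<^sup>2 \<le> r\<^sup>2" and \<rho>: "0 \<le> \<rho>" "\<rho> \<le> 1"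
    and \<beta>: "\<beta> * s\<^sup>2 = (1 - \<rho>) * y" and v: "\<bar>v\<bar> \<le> r"
  shows "ennreal (exp (- (8 * s\<^sup>2 / r\<^sup>2 + \<bar>\<beta>\<bar> * (1 - \<rho>) * (r + \<bar>y\<bar>)))) * ennreal (bump r \<beta> v)
    \<le> (\<integral>\<^sup>+x. ennreal (bump r \<beta> (\<rho> * v - (1 - \<rho>) * y + x)) \<partial>gauss s)"
proof -
  define a where "a = \<rho> * v - (1 - \<rho>) * y"
  define m where "m = 1 + 2 * (1 / r\<^sup>2) * s\<^sup>2"
  define w where "w = (v / r)\<^sup>2"
  define I where "I = exp (\<beta> * a + \<beta>\<^sup>2 * s\<^sup>2 / 2) * (exp (- ((\<rho> * v / r)\<^sup>2 / m)) / sqrt m - exp (- 1))"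
  have m1: "1 \<le> m" "m \<le> 5 / 4" using s r by (auto simp: m_def field_simps)
  have w01: "0 \<le> w" "w \<le> 1"
  proof -
    have "(\<bar>v\<bar> / r)\<^sup>2 \<le> 1" using v r by (intro power_le_one) (auto simp: field_simps)
    then show "w \<le> 1" by (simp add: w_def power_divide)
  qed (simp add: w_def)
  have eq: "normal_density 0 s x * bump r \<beta> (a + x) = exp (\<beta> * a + \<beta>\<^sup>2 * s\<^sup>2 / 2) *
      (exp (- ((\<rho> * v / r)\<^sup>2 / m)) / sqrt m * normal_density ((\<beta> * s\<^sup>2 - 2 * (1 / r\<^sup>2) * s\<^sup>2 * a) / m) (s / sqrt m) x
        - exp (- 1) * normal_density (\<beta> * s\<^sup>2) s x)" for x
  proof -
    have "normal_density 0 s x * bump r \<beta> (a + x) =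
       exp (\<beta> * a) * (normal_density 0 s x * exp (\<beta> * x)) * (exp (- (1 / r\<^sup>2 * (a + x)\<^sup>2)) - exp (- 1))"
      by (simp add: bump_def distrib_left exp_add power_divide)
    also have "\<dots> = exp (\<beta> * a) * exp (\<beta>\<^sup>2 * s\<^sup>2 / 2) *
       (normal_density (\<beta> * s\<^sup>2) s x * exp (- (1 / r\<^sup>2 * (a + x)\<^sup>2)) - exp (- 1) * normal_density (\<beta> * s\<^sup>2) s x)"
      by (subst normal_density_mult_exp[OF s(1)]) (simp add: algebra_simps)
    also have "normal_density (\<beta> * s\<^sup>2) s x * exp (- (1 / r\<^sup>2 * (a + x)\<^sup>2)) =
       exp (- (1 / r\<^sup>2 * (a + \<beta> * s\<^sup>2)\<^sup>2 / m)) / sqrt m * normal_density ((\<beta> * s\<^sup>2 - 2 * (1 / r\<^sup>2) * s\<^sup>2 * a) / m) (s / sqrt m) x"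
      using s r by (intro normal_density_mult_gaussian) (auto simp: m_def)
    also have "a + \<beta> * s\<^sup>2 = \<rho> * v" using \<beta> by (simp add: a_def)
    finally show ?thesis by (simp add: exp_add power_divide)
  qed
  have pos: "0 < s / sqrt m" using s m1 by simp
  have "has_bochner_integral lborel (\<lambda>x. normal_density 0 s x * bump r \<beta> (a + x))
     (exp (\<beta> * a + \<beta>\<^sup>2 * s\<^sup>2 / 2) * (exp (- ((\<rho> * v / r)\<^sup>2 / m)) / sqrt m * 1 - exp (- 1) * 1))"
    unfolding eq
    by (intro has_bochner_integral_mult_right has_bochner_integral_diff)
       (use pos s(1) in \<open>auto simp: has_bochner_integral_iff\<close>)
  then have int: "integrable (gauss s) (\<lambda>x. bump r \<beta> (a + x))" "(\<integral>x. bump r \<beta> (a + x) \<partial>gauss s) = I"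
    by (auto simp: has_bochner_integral_iff I_def integrable_density integral_density)
  \<comment> \<open>Here \<open>v - a = (1 - \<rho>) * (v + y)\<close>, and
    \<open>\<bar>v + y\<bar>\<close> is at most \<open>r + \<bar>y\<bar>\<close>.\<close>
  have "\<beta> * a \<ge> \<beta> * v - \<bar>\<beta>\<bar> * (1 - \<rho>) * (r + \<bar>y\<bar>)"
  proof -
    have "\<beta> * (1 - \<rho>) * (v + y) \<le> \<bar>\<beta>\<bar> * (1 - \<rho>) * (r + \<bar>y\<bar>)"
    proof -
      have "\<beta> * (1 - \<rho>) * (v + y) \<le> \<bar>\<beta> * (1 - \<rho>)\<bar> * \<bar>v + y\<bar>" by (metis abs_ge_self abs_mult)
      also have "\<dots> \<le> \<bar>\<beta> * (1 - \<rho>)\<bar> * (r + \<bar>y\<bar>)" using v by (intro mult_left_mono) auto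
      finally show ?thesis using \<rho> by (simp add: abs_mult)
    qed
    then show ?thesis by (simp add: a_def algebra_simps)
  qed
  then have A: "exp (- (\<bar>\<beta>\<bar> * (1 - \<rho>) * (r + \<bar>y\<bar>))) * exp (\<beta> * v) \<le> exp (\<beta> * a + \<beta>\<^sup>2 * s\<^sup>2 / 2)"
    by (simp flip: exp_add add: add_increasing2)
  have B: "exp (- (8 * s\<^sup>2 / r\<^sup>2)) * (exp (- w) - exp (- 1)) \<le> exp (- ((\<rho> * v / r)\<^sup>2 / m)) / sqrt m - exp (- 1)"
  proof -
    \<comment> \<open>The right side is \<open>1 - u\<close> with
      \<open>u = 4 * s\<^sup>2 / r\<^sup>2\<close>, and \<open>exp (- (2 * u)) \<le> 1 - u\<close>
      for \<open>u \<le> 1 / 2\<close>: the origin of the 8 and of the mesh condition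
      \<open>8 * s\<^sup>2 \<le> r\<^sup>2\<close>.\<close>
    have "exp (- (8 * s\<^sup>2 / r\<^sup>2)) \<le> 1 - 2 * (m - 1)"
    proof -
      define u where "u = 4 * s\<^sup>2 / r\<^sup>2"
      have u: "0 \<le> u" "u \<le> 1 / 2" using s r by (auto simp: u_def field_simps)
      have "1 / (1 - u) \<le> 1 + 2 * u"
      proof -
        have "u * (2 * u) \<le> u" using u mult_left_mono[of "2 * u" 1 u] by simp
        then have "1 \<le> (1 + 2 * u) * (1 - u)" by (simp add: algebra_simps)
        then show ?thesis using u by (simp add: field_simps)
      qed
      also have "\<dots> \<le> exp (2 * u)" by (rule exp_ge_add_one_self)
      finally have "exp (- (2 * u)) \<le> 1 - u" using u by (simp add: exp_minus field_simps)
      then show ?thesis by (simp add: u_def m_def)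
    qed
    then have "exp (- (8 * s\<^sup>2 / r\<^sup>2)) * (exp (- w) - exp (- 1)) \<le> (1 - 2 * (m - 1)) * (exp (- w) - exp (- 1))"
      using w01 by (intro mult_right_mono) auto
    also have "\<dots> \<le> exp (- (w / m)) / sqrt m - exp (- 1)"
      using w01 m1 by (intro gaussian_bump_decay) auto
    also have "\<dots> \<le> exp (- ((\<rho> * v / r)\<^sup>2 / m)) / sqrt m - exp (- 1)"
    proof -
      have "\<rho>\<^sup>2 * w \<le> 1 * w" using \<rho> w01 by (intro mult_right_mono power_le_one) auto
      then have "(\<rho> * v / r)\<^sup>2 \<le> w" by (simp add: w_def power_mult_distrib power_divide)
      then have "(\<rho> * v / r)\<^sup>2 / m \<le> w / m" using m1 by (intro divide_right_mono) auto
      then show ?thesis using m1 by (intro diff_right_mono divide_right_mono) auto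
    qed
    finally show ?thesis .
  qed
  have "exp (- (8 * s\<^sup>2 / r\<^sup>2 + \<bar>\<beta>\<bar> * (1 - \<rho>) * (r + \<bar>y\<bar>))) * bump r \<beta> v
    = (exp (- (\<bar>\<beta>\<bar> * (1 - \<rho>) * (r + \<bar>y\<bar>))) * exp (\<beta> * v)) * (exp (- (8 * s\<^sup>2 / r\<^sup>2)) * (exp (- w) - exp (- 1)))"
    unfolding bump_def w_def minus_add_distrib exp_add by (simp only: mult_ac)
  also have "\<dots> \<le> I"
    unfolding I_def using A B w01 by (intro mult_mono) auto
  finally have le: "exp (- (8 * s\<^sup>2 / r\<^sup>2 + \<bar>\<beta>\<bar> * (1 - \<rho>) * (r + \<bar>y\<bar>))) * bump r \<beta> v \<le> I" .
  have "ennreal (exp (- (8 * s\<^sup>2 / r\<^sup>2 + \<bar>\<beta>\<bar> * (1 - \<rho>) * (r + \<bar>y\<bar>)))) * ennreal (bump r \<beta> v) \<le> ennreal I"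
    using le by (subst ennreal_mult'[symmetric]) (auto intro: ennreal_leI)
  also have "\<dots> \<le> (\<integral>\<^sup>+x. ennreal (bump r \<beta> (a + x)) \<partial>gauss s)"
    using ennreal_integral_le_nn_integral[OF int(1)] int(2) by simp
  finally show ?thesis by (simp add: a_def)
qed

text \<open>\<open>cosh\<close> is an eigenfunction of Gaussian averaging, which makes
  \<open>exp (- t / 2) * cosh (B t)\<close> a martingale.\<close>

lemma cosh_gauss:
  assumes s: "0 < s"
  shows "has_bochner_integral (gauss s) (\<lambda>x. cosh (a + x)) (exp (s\<^sup>2 / 2) * cosh a)"
proof -
  have eq: "normal_density 0 s x * cosh (a + x) = exp (s\<^sup>2 / 2) / 2 *
     (exp a * normal_density (s\<^sup>2) s x + exp (- a) * normal_density (- s\<^sup>2) s x)" for x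
    using normal_density_mult_exp[OF s, of x 1] normal_density_mult_exp[OF s, of x "-1"]
    by (simp add: cosh_field_def exp_add exp_diff exp_minus field_simps)
  have "has_bochner_integral lborel (\<lambda>x. normal_density 0 s x * cosh (a + x))
     (exp (s\<^sup>2 / 2) / 2 * (exp a * 1 + exp (- a) * 1))"
    unfolding eq
    by (intro has_bochner_integral_mult_right has_bochner_integral_add)
       (use s in \<open>auto simp: has_bochner_integral_iff\<close>)
  also have "exp (s\<^sup>2 / 2) / 2 * (exp a * 1 + exp (- a) * 1) = exp (s\<^sup>2 / 2) * cosh a"
    by (simp add: cosh_field_def)
  finally have "has_bochner_integral lborel (\<lambda>x. normal_density 0 s x *\<^sub>R cosh (a + x)) (exp (s\<^sup>2 / 2) * cosh a)"
    unfolding real_scaleR_def .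
  moreover have "(\<lambda>x. cosh (a + x)) \<in> borel_measurable lborel"
  proof -
    have "(\<lambda>x. (exp (a + x) + exp (- (a + x))) / 2) \<in> borel_measurable lborel" by measurable
    then show ?thesis by (simp only: cosh_field_def)
  qed
  ultimately show ?thesis
    by (rule has_bochner_integral_density[rotated 3]) simp_all
qed

section \<open>Brownian motion on dyadic times\<close>

definition dyadic_times :: "real \<Rightarrow> real set" where
  "dyadic_times T = {T * real j / 2 ^ m | j m. j \<le> 2 ^ m}"

lemma countable_dyadic_times: "countable (dyadic_times T)"
proof -
  have "dyadic_times T \<subseteq> (\<lambda>(j, m). T * real j / 2 ^ m) ` (UNIV :: (nat \<times> nat) set)"
    by (auto simp: dyadic_times_def image_def)
  then show ?thesis by (rule countable_subset) auto
qed

lemma dyadic_times_subset: "0 \<le> T \<Longrightarrow> dyadic_times T \<subseteq> {0..T}"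
proof
  fix t assume T: "0 \<le> T" and "t \<in> dyadic_times T"
  then obtain j m where t: "t = T * real j / 2 ^ m" and j: "j \<le> (2::nat) ^ m" by (auto simp: dyadic_times_def)
  have "real j \<le> 2 ^ m" using j by (metis of_nat_le_iff of_nat_numeral of_nat_power)
  then have "real j / 2 ^ m \<le> 1" by simp
  then have "T * (real j / 2 ^ m) \<le> T * 1" using T by (intro mult_left_mono) auto
  then show "t \<in> {0..T}" using T t by simp
qed

text \<open>The grids with \<open>2 ^ m\<close> steps are nested, so their events decrease to the
  event over all dyadic times, and a bound that does not depend on the mesh passes to the limit by
  continuity from above.\<close>

lemma dyadic_times_limit:
  assumes M: "prob_space M" and T: "0 \<le> T"
    and meas: "\<And>t. t \<in> {0..T} \<Longrightarrow> {\<omega> \<in> space M. P t \<omega>} \<in> sets M"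
    and ev: "eventually (\<lambda>n. q \<le> measure M {\<omega> \<in> space M. \<forall>k\<le>n. P (T * real k / real n) \<omega>}) sequentially"
  shows "q \<le> measure M {\<omega> \<in> space M. \<forall>t\<in>dyadic_times T. P t \<omega>}"
proof -
  interpret prob_space M by (rule M)
  define E where "E m = {\<omega> \<in> space M. \<forall>k\<in>{..2 ^ m}. P (T * real k / 2 ^ m) \<omega>}" for m :: nat
  have E_sets: "E m \<in> sets M" for m
    unfolding E_def
  proof (rule sets.sets_Collect_finite_All')
    fix k assume "k \<in> {..(2::nat) ^ m}"
    then have "T * real k / 2 ^ m \<in> dyadic_times T" by (auto simp: dyadic_times_def)
    then show "{\<omega> \<in> space M. P (T * real k / 2 ^ m) \<omega>} \<in> sets M"
      using meas dyadic_times_subset[OF T] by blast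
  qed auto
  have dec: "decseq E"
  proof (rule decseq_SucI, rule subsetI)
    fix m \<omega> assume \<omega>: "\<omega> \<in> E (Suc m)"
    have "P (T * real k / 2 ^ m) \<omega>" if "k \<le> 2 ^ m" for k
    proof -
      have "2 * k \<in> {..2 ^ Suc m}" using that by simp
      with \<omega> have "P (T * real (2 * k) / 2 ^ Suc m) \<omega>" unfolding E_def by blast
      then show ?thesis by simp
    qed
    then show "\<omega> \<in> E m" using \<omega> by (simp add: E_def)
  qed
  have "(\<lambda>m. measure M (E m)) \<longlonglongrightarrow> measure M (\<Inter>m. E m)"
    using E_sets dec by (intro finite_Lim_measure_decseq) auto
  moreover have "eventually (\<lambda>m. q \<le> measure M (E m)) sequentially"
  proof -
    have "filterlim (\<lambda>m::nat. (2::nat) ^ m) sequentially sequentially"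
      by (intro filterlim_subseq) (simp add: strict_mono_def)
    from eventually_compose_filterlim[OF ev this] show ?thesis by (simp add: E_def Ball_def)
  qed
  ultimately have "q \<le> measure M (\<Inter>m. E m)"
    by (intro tendsto_lowerbound[of "\<lambda>m. measure M (E m)" _ sequentially]) auto
  also have "(\<Inter>m. E m) = {\<omega> \<in> space M. \<forall>t\<in>dyadic_times T. P t \<omega>}"
    unfolding E_def dyadic_times_def by blast
  finally show ?thesis .
qed

lemma standard_BM_measurable: "standard_BM M B \<Longrightarrow> 0 \<le> t \<Longrightarrow> B t \<in> borel_measurable M"
  by (simp add: standard_BM_def)

text \<open>Doob's maximal inequality for the martingale \<open>exp (- t / 2) * cosh (B t)\<close>,
  in the form of a tube bound with \<open>l = 1\<close>: each step preserves the untruncated test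
  function exactly.\<close>

lemma standard_BM_max_grid:
  assumes M: "prob_space M" and B: "standard_BM M B"
    and \<tau>0: "\<tau> 0 = 0" and \<tau>: "\<And>k. k < n \<Longrightarrow> \<tau> k < \<tau> (Suc k)" and n: "0 < n" and a: "0 \<le> a"
  shows "1 - exp (\<tau> n / 2) / cosh a \<le> measure M {\<omega> \<in> space M. \<forall>k\<le>n. \<bar>B (\<tau> k) \<omega>\<bar> \<le> a}"
proof -
  interpret prob_space M by (rule M)
  define h where "h k s = 1 - exp ((\<tau> n - \<tau> k) / 2) * cosh s / cosh a" for k s
  have mono: "\<tau> k \<le> \<tau> n" if "k \<le> n" for k
    using that by (induction rule: inc_induct) (auto dest!: \<tau>)
  have step: "1 * ennreal (h k s) \<le> (\<integral>\<^sup>+x. ennreal (h (Suc k) (s + x)) \<partial>gauss (sqrt (\<tau> (Suc k) - \<tau> k)))"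
    if "k < n" for k s
  proof -
    define \<sigma> where "\<sigma> = sqrt (\<tau> (Suc k) - \<tau> k)"
    have \<sigma>: "0 < \<sigma>" "\<sigma>\<^sup>2 = \<tau> (Suc k) - \<tau> k" using \<tau>[OF that] by (auto simp: \<sigma>_def)
    interpret g: prob_space "gauss \<sigma>" by (rule prob_space_normal_density[OF \<sigma>(1)])
    let ?c = "exp ((\<tau> n - \<tau> (Suc k)) / 2) / cosh a"
    have "has_bochner_integral (gauss \<sigma>) (\<lambda>x. 1 - ?c * cosh (s + x)) (1 - ?c * (exp (\<sigma>\<^sup>2 / 2) * cosh s))"
      by (intro has_bochner_integral_diff has_bochner_integral_mult_right cosh_gauss \<sigma>)
        (use g.prob_space in \<open>simp add: has_bochner_integral_iff\<close>)
    moreover have "?c * (exp (\<sigma>\<^sup>2 / 2) * cosh s) = exp ((\<tau> n - \<tau> k) / 2) * cosh s / cosh a"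
      by (simp add: \<sigma> exp_add[symmetric] diff_divide_distrib)
    ultimately have "has_bochner_integral (gauss \<sigma>) (\<lambda>x. 1 - ?c * cosh (s + x)) (1 - exp ((\<tau> n - \<tau> k) / 2) * cosh s / cosh a)"
      by (simp only:)
    then have "has_bochner_integral (gauss \<sigma>) (\<lambda>x. h (Suc k) (s + x)) (h k s)"
      by (simp add: h_def)
    then show ?thesis
      using ennreal_integral_le_nn_integral[of "gauss \<sigma>" "\<lambda>x. h (Suc k) (s + x)"]
      by (simp add: has_bochner_integral_iff \<sigma>_def)
  qed
  have supp: "ennreal (h k s) \<le> 1 * indicator {-a..a} s" if "k \<le> n" for k s
  proof (cases "\<bar>s\<bar> \<le> a")
    case True
    have "h k s \<le> 1" by (simp add: h_def)
    moreover have "indicator {-a..a} s = (1::ennreal)" using True by (intro indicator_simps(1)) auto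
    ultimately show ?thesis by simp
  next
    case False
    have "cosh a \<le> cosh s"
      using False a cosh_real_nonneg_le_iff[of a "\<bar>s\<bar>"] by simp
    then have "1 * cosh a \<le> exp ((\<tau> n - \<tau> k) / 2) * cosh s"
      using mono[OF that] by (intro mult_mono) auto
    then have "h k s \<le> 0" by (simp add: h_def field_simps)
    then show ?thesis by (simp add: ennreal_neg)
  qed
  have "1 ^ n * ennreal (h 0 0) \<le> 1 * emeasure M {\<omega> \<in> space M. \<forall>k\<le>n. B (\<tau> k) \<omega> \<in> {-a..a}}"
  proof (rule standard_BM_tube[OF M B \<tau>0 \<tau> n])
    have "h k \<in> borel_measurable borel" for k
      unfolding h_def[abs_def] cosh_field_def by measurable
    then show "(\<lambda>s. ennreal (h k s)) \<in> borel_measurable borel" for k by measurable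
  qed (use step supp in auto)
  moreover have "{\<omega> \<in> space M. \<forall>k\<le>n. B (\<tau> k) \<omega> \<in> {-a..a}} = {\<omega> \<in> space M. \<forall>k\<le>n. \<bar>B (\<tau> k) \<omega>\<bar> \<le> a}"
    by (auto simp: abs_le_iff)
  ultimately have "ennreal (h 0 0) \<le> ennreal (measure M {\<omega> \<in> space M. \<forall>k\<le>n. \<bar>B (\<tau> k) \<omega>\<bar> \<le> a})"
    by (simp add: emeasure_eq_measure)
  then show ?thesis by (subst (asm) ennreal_le_iff) (auto simp: h_def \<tau>0)
qed

text \<open>The case of \<open>bump_gauss\<close> without drift: \<open>\<rho> = 1\<close>,
  \<open>y = 0\<close>, \<open>\<beta> = 0\<close>. The prefactor \<open>1 - exp (- 1)\<close> is
  \<open>bump r 0 0\<close>.\<close>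

lemma standard_BM_stay_grid:
  assumes M: "prob_space M" and B: "standard_BM M B" and r: "0 < r" and T: "0 < T"
    and n: "0 < n" "8 * (T / real n) \<le> r\<^sup>2"
  shows "(1 - exp (- 1)) * exp (- 8 * T / r\<^sup>2) \<le>
    measure M {\<omega> \<in> space M. \<forall>k\<le>n. \<bar>B (T * real k / real n) \<omega>\<bar> \<le> r}"
proof -
  interpret prob_space M by (rule M)
  define h where "h = T / real n"
  have h: "0 < h" "8 * h \<le> r\<^sup>2" using T n by (auto simp: h_def)
  have "ennreal (exp (- (8 * h / r\<^sup>2))) ^ n * ennreal (bump r 0 0) \<le>
    ennreal (exp (\<bar>0\<bar> * r)) * emeasure M {\<omega> \<in> space M. \<forall>k\<le>n. B (h * real k) \<omega> \<in> {-r..r}}"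
  proof (rule standard_BM_tube[OF M B, where \<tau> = "\<lambda>k. h * real k" and A = "\<lambda>_. {-r..r}" and g = "\<lambda>_ x. ennreal (bump r 0 x)"])
    fix k s assume "s \<in> {-r..r}"
    then have "ennreal (exp (- (8 * (sqrt h)\<^sup>2 / r\<^sup>2 + \<bar>0\<bar> * (1 - 1) * (r + \<bar>0\<bar>)))) * ennreal (bump r 0 s)
      \<le> (\<integral>\<^sup>+x. ennreal (bump r 0 (1 * s - (1 - 1) * 0 + x)) \<partial>gauss (sqrt h))"
      using h r by (intro bump_gauss) auto
    then show "ennreal (exp (- (8 * h / r\<^sup>2))) * ennreal (bump r 0 s)
      \<le> (\<integral>\<^sup>+x. ennreal (bump r 0 (s + x)) \<partial>gauss (sqrt (h * real (Suc k) - h * real k)))"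
      using h by (simp add: algebra_simps)
  qed (use h n bump_le[OF r, of 0] in auto)
  moreover have "ennreal (exp (- (8 * h / r\<^sup>2))) ^ n * ennreal (bump r 0 0) = ennreal ((1 - exp (- 1)) * exp (- 8 * T / r\<^sup>2))"
  proof -
    have "exp (- (8 * h / r\<^sup>2)) ^ n = exp (- 8 * T / r\<^sup>2)"
      using n by (simp add: exp_of_nat_mult[symmetric] h_def)
    then show ?thesis by (simp add: ennreal_power ennreal_mult'[symmetric] bump_def mult.commute)
  qed
  moreover have "{\<omega> \<in> space M. \<forall>k\<le>n. B (h * real k) \<omega> \<in> {-r..r}} =
      {\<omega> \<in> space M. \<forall>k\<le>n. \<bar>B (T * real k / real n) \<omega>\<bar> \<le> r}"
    by (auto simp: abs_le_iff h_def)
  ultimately show ?thesis by (simp add: emeasure_eq_measure)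
qed

section \<open>Ornstein-Uhlenbeck processes as Brownian motion on exponential time grids\<close>

lemma nn_integral_gauss_scale:
  assumes [measurable]: "f \<in> borel_measurable borel" and c: "0 < c" and s: "0 < s"
  shows "(\<integral>\<^sup>+x. f (c * x) \<partial>gauss s) = (\<integral>\<^sup>+x. f x \<partial>gauss (c * s))"
proof -
  have "(\<integral>\<^sup>+x. f x \<partial>gauss (c * s)) = (\<integral>\<^sup>+x. ennreal (normal_density 0 (c * s) x) * f x \<partial>lborel)"
    by (subst nn_integral_density) auto
  also have "\<dots> = ennreal c * (\<integral>\<^sup>+x. ennreal (normal_density 0 (c * s) (c * x)) * f (c * x) \<partial>lborel)"
    using c by (subst nn_integral_real_affine[where c=c and t=0]) auto
  also have "\<dots> = (\<integral>\<^sup>+x. ennreal (c * normal_density 0 (c * s) (c * x)) * f (c * x) \<partial>lborel)"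
    using c by (subst nn_integral_cmult[symmetric]) (auto simp: ennreal_mult mult.assoc)
  also have "\<dots> = (\<integral>\<^sup>+x. ennreal (normal_density 0 s x) * f (c * x) \<partial>lborel)"
  proof -
    have "c * normal_density 0 (c * s) (c * x) = normal_density 0 s x" for x
      using c s by (simp add: normal_density_def power_mult_distrib real_sqrt_mult)
    then show ?thesis by simp
  qed
  also have "\<dots> = (\<integral>\<^sup>+x. f (c * x) \<partial>gauss s)" by (subst nn_integral_density) auto
  finally show ?thesis ..
qed

text \<open>\<open>gauss 1\<close> is the law of \<open>B 1\<close>, the initial value of
  \<open>exp (- t / 2) * B (exp t)\<close>; the process starts in the tube around \<open>y\<close>
  with positive weight.\<close>

lemma bump_gauss_pos:
  assumes r: "0 < r"
  shows "0 < (\<integral>\<^sup>+x. ennreal (bump r 0 (x - y)) \<partial>gauss 1)"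
proof (rule ccontr)
  assume "\<not> ?thesis"
  then have "(\<integral>\<^sup>+x. ennreal (bump r 0 (x - y)) \<partial>gauss 1) = 0" by simp
  then have "AE x in gauss 1. ennreal (bump r 0 (x - y)) = 0" by (subst (asm) nn_integral_0_iff_AE) auto
  then have "AE x in lborel. ennreal (bump r 0 (x - y)) = 0"
    by (subst (asm) AE_density) (auto simp: normal_density_pos)
  then have "AE x in lborel. x \<notin> {y - r<..<y + r}"
  proof eventually_elim
    case (elim x)
    show ?case
    proof
      assume "x \<in> {y - r<..<y + r}"
      then have "\<bar>x - y\<bar> / r < 1" using r by (auto simp: field_simps abs_less_iff)
      then have "(\<bar>x - y\<bar> / r)\<^sup>2 < 1" using r by (subst power_less_one_iff) auto
      then have "0 < bump r 0 (x - y)" by (simp add: bump_def power_divide)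
      then show False using elim by (simp add: ennreal_eq_0_iff)
    qed
  qed
  then have "emeasure lborel {y - r<..<y + r} = 0"
    by (subst (asm) AE_iff_measurable[of "{y - r<..<y + r}"]) auto
  then show False using r by simp
qed

text \<open>An upper bound for the exponent of \<open>bump_gauss\<close> per unit of time: the cost
  of confinement, and the product of the tilt, at most \<open>\<bar>y\<bar>\<close>, the drift
  coefficient 1 / 2 and the distance \<open>r + \<bar>y\<bar>\<close>.\<close>

definition ou_rate :: "real \<Rightarrow> real \<Rightarrow> real" where
  "ou_rate r y = 8 / r\<^sup>2 + \<bar>y\<bar> * (r + \<bar>y\<bar>) / 2"

lemma ou_rate_nonneg: "0 < r \<Longrightarrow> 0 \<le> ou_rate r y"
  by (simp add: ou_rate_def)

text \<open>Over a time step \<open>h\<close> the noise has variance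
  \<open>1 - \<rho>\<^sup>2 = (1 - \<rho>) * (1 + \<rho>)\<close>, so the tilt that cancels the
  drift is \<open>y / (1 + \<rho>)\<close>. The exponent is linear in \<open>h\<close> because the
  variance is at most \<open>h\<close> and \<open>1 - \<rho>\<close> at most
  \<open>h / 2\<close>.\<close>

lemma bump_gauss_ou:
  assumes r: "0 < r" and h: "0 < h" "8 * h \<le> r\<^sup>2" and \<rho>: "\<rho> = exp (- h / 2)" and \<beta>: "\<beta> = y / (1 + \<rho>)"
    and v: "\<bar>v\<bar> \<le> r"
  shows "ennreal (exp (- h * ou_rate r y)) * ennreal (bump r \<beta> v)
    \<le> (\<integral>\<^sup>+x. ennreal (bump r \<beta> (\<rho> * v - (1 - \<rho>) * y + x)) \<partial>gauss (sqrt (1 - exp (- h))))"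
proof -
  define s where "s = sqrt (1 - exp (- h))"
  have s: "0 < s" "s\<^sup>2 = 1 - exp (- h)" using h by (auto simp: s_def)
  have \<rho>01: "0 < \<rho>" "\<rho> < 1" using h by (auto simp: \<rho>)
  have \<rho>2: "\<rho> * \<rho> = exp (- h)" by (simp add: \<rho> flip: exp_add)
  have sh: "s\<^sup>2 \<le> h" using exp_ge_add_one_self[of "- h"] by (simp add: s)
  have \<rho>h: "1 - \<rho> \<le> h / 2" using exp_ge_add_one_self[of "- h / 2"] by (simp add: \<rho>)
  have "\<beta> * s\<^sup>2 = (1 - \<rho>) * y"
  proof -
    have "s\<^sup>2 = (1 - \<rho>) * (1 + \<rho>)" using \<rho>2 by (simp add: s algebra_simps)
    then show ?thesis using \<rho>01 by (simp add: \<beta>)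
  qed
  then have "ennreal (exp (- (8 * s\<^sup>2 / r\<^sup>2 + \<bar>\<beta>\<bar> * (1 - \<rho>) * (r + \<bar>y\<bar>)))) * ennreal (bump r \<beta> v)
    \<le> (\<integral>\<^sup>+x. ennreal (bump r \<beta> (\<rho> * v - (1 - \<rho>) * y + x)) \<partial>gauss s)"
    using r s \<rho>01 v sh h by (intro bump_gauss) auto
  moreover have "8 * s\<^sup>2 / r\<^sup>2 + \<bar>\<beta>\<bar> * (1 - \<rho>) * (r + \<bar>y\<bar>) \<le> h * ou_rate r y"
  proof -
    have "8 * s\<^sup>2 / r\<^sup>2 \<le> 8 * h / r\<^sup>2" using sh by (intro divide_right_mono) auto
    moreover have "\<bar>\<beta>\<bar> * (1 - \<rho>) * (r + \<bar>y\<bar>) \<le> \<bar>y\<bar> * (h / 2) * (r + \<bar>y\<bar>)"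
    proof (intro mult_mono)
      have "\<bar>y\<bar> * 1 \<le> \<bar>y\<bar> * (1 + \<rho>)" using \<rho>01 by (intro mult_left_mono) auto
      then show "\<bar>\<beta>\<bar> \<le> \<bar>y\<bar>" using \<rho>01 by (simp add: \<beta> field_simps)
    qed (use \<rho>01 \<rho>h r in auto)
    moreover have "h * ou_rate r y = 8 * h / r\<^sup>2 + \<bar>y\<bar> * (h / 2) * (r + \<bar>y\<bar>)"
      by (simp add: ou_rate_def algebra_simps)
    ultimately show ?thesis by linarith
  qed
  then have "ennreal (exp (- h * ou_rate r y)) * ennreal (bump r \<beta> v) \<le>
     ennreal (exp (- (8 * s\<^sup>2 / r\<^sup>2 + \<bar>\<beta>\<bar> * (1 - \<rho>) * (r + \<bar>y\<bar>)))) * ennreal (bump r \<beta> v)"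
    by (intro mult_right_mono ennreal_leI) auto
  ultimately show ?thesis by (simp add: s_def)
qed

text \<open>The tilt depends on the mesh. Comparison with tilt 0 bounds the initial weight below by
  a quantity that does not.\<close>

lemma bump_tilt_ge:
  assumes r: "0 < r" and \<beta>: "\<bar>\<beta>\<bar> \<le> \<bar>y\<bar>"
  shows "ennreal (exp (- \<bar>y\<bar> * r)) * ennreal (bump r 0 v) \<le> ennreal (bump r \<beta> v)"
proof (cases "0 < bump r 0 v")
  case True
  then have "\<bar>v\<bar> \<le> r" using bump_le_0[OF r, of v 0] by linarith
  have "- (\<beta> * v) \<le> \<bar>\<beta>\<bar> * \<bar>v\<bar>" by (metis abs_ge_minus_self abs_mult)
  also have "\<dots> \<le> \<bar>y\<bar> * r" using \<beta> \<open>\<bar>v\<bar> \<le> r\<close> by (intro mult_mono) auto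
  finally have "exp (- \<bar>y\<bar> * r) \<le> exp (\<beta> * v)" by simp
  then have "exp (- \<bar>y\<bar> * r) * bump r 0 v \<le> exp (\<beta> * v) * bump r 0 v"
    using True by (intro mult_right_mono) auto
  also have "\<dots> = bump r \<beta> v" by (simp add: bump_def)
  finally show ?thesis by (simp add: ennreal_leI flip: ennreal_mult')
qed (simp add: ennreal_neg not_less)

text \<open>The Brownian grid consists of the time 0 and the times \<open>exp (h * real j)\<close>.
  The first step, from 0 to 1, produces the initial value of the process; each later step advances
  it by \<open>h\<close>. The constant is chosen before horizon and mesh.\<close>

lemma standard_BM_ou_grid:
  assumes r: "0 < r"
  shows "\<exists>q>0. \<forall>(M :: 'w measure) B T n. prob_space M \<longrightarrow> standard_BM M B \<longrightarrow> 0 < T \<longrightarrow> 0 < n \<longrightarrow>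
      T / real n \<le> 1 \<longrightarrow> 8 * (T / real n) \<le> r\<^sup>2 \<longrightarrow>
    q * exp (- T * ou_rate r y) \<le>
      measure M {\<omega> \<in> space M. \<forall>k\<le>n. \<bar>exp (- (T * real k / real n) / 2) * B (exp (T * real k / real n)) \<omega> - y\<bar> \<le> r}"
proof -
  define J where "J = (\<integral>\<^sup>+x. ennreal (bump r 0 (x - y)) \<partial>gauss 1)"
  interpret g1: prob_space "gauss 1" by (rule prob_space_normal_density) simp
  have J: "0 < J" "J < \<infinity>"
  proof -
    show "0 < J" unfolding J_def by (rule bump_gauss_pos[OF r])
    have "J \<le> (\<integral>\<^sup>+x. 1 \<partial>gauss 1)"
      unfolding J_def
    proof (rule nn_integral_mono)
      show "ennreal (bump r 0 (x - y)) \<le> 1" for x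
        using bump_le[OF r, of 0 "x - y"] by (rule order_trans) (simp add: indicator_def)
    qed
    also have "\<dots> = 1" using g1.emeasure_space_1 by simp
    finally show "J < \<infinity>" by (auto intro: le_less_trans)
  qed
  \<comment> \<open>The factors pay for the additional power of \<open>l\<close> (where
    \<open>h \<le> 1\<close>), for replacing the tilted initial weight by the untilted one, and for
    dividing by \<open>G\<close>; \<open>J\<close> is the weight of starting in the tube.\<close>
  define q where "q = exp (- ou_rate r y) * exp (- \<bar>y\<bar> * r) * exp (- \<bar>y\<bar> * r) * enn2real J"
  have "q * exp (- T * ou_rate r y) \<le>
      measure M {\<omega> \<in> space M. \<forall>k\<le>n. \<bar>exp (- (T * real k / real n) / 2) * B (exp (T * real k / real n)) \<omega> - y\<bar> \<le> r}"
    if M: "prob_space M" and B: "standard_BM M B" and T: "0 < T" and n: "0 < n" "T / real n \<le> 1" "8 * (T / real n) \<le> r\<^sup>2"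
    for M :: "'w measure" and B T n
  proof -
    interpret prob_space M by (rule M)
    define h where "h = T / real n"
    have h: "0 < h" "8 * h \<le> r\<^sup>2" "h \<le> 1" using T n by (auto simp: h_def)
    define \<rho> where "\<rho> = exp (- h / 2)"
    define \<beta> where "\<beta> = y / (1 + \<rho>)"
    have \<beta>y: "\<bar>\<beta>\<bar> \<le> \<bar>y\<bar>"
    proof -
      have \<rho>: "0 < \<rho>" by (simp add: \<rho>_def)
      then have "\<bar>y\<bar> * 1 \<le> \<bar>y\<bar> * (1 + \<rho>)" by (intro mult_left_mono) auto
      then show ?thesis using \<rho> by (simp add: \<beta>_def field_simps)
    qed
    define V where "V k s = exp (- h * real k / 2) * s - y" for k s
    define \<tau> where "\<tau> k = (case k of 0 \<Rightarrow> 0 | Suc j \<Rightarrow> exp (h * real j))" for k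
    define A where "A k = (case k of 0 \<Rightarrow> UNIV | Suc j \<Rightarrow> {s. \<bar>V j s\<bar> \<le> r})" for k
    define q' where "q' = (\<integral>\<^sup>+x. ennreal (bump r \<beta> (x - y)) \<partial>gauss 1)"
    \<comment> \<open>At index 0 the walk sits at 0 and is not confined. The indicator of
      \<open>{0}\<close> makes the step inequality trivial elsewhere; at 0 it reduces to
      \<open>l \<le> 1\<close>.\<close>
    define g where "g k s = (case k of 0 \<Rightarrow> q' * indicator {0} s | Suc j \<Rightarrow> ennreal (bump r \<beta> (V j s)))" for k s
    define l where "l = ennreal (exp (- h * ou_rate r y))"
    define G where "G = ennreal (exp (\<bar>y\<bar> * r))"
    have l1: "l \<le> 1" using h ou_rate_nonneg[OF r, of y] by (simp add: l_def)
    have bump_G: "ennreal (bump r \<beta> v) \<le> G * indicator {-r..r} v" for v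
    proof -
      have "ennreal (exp (\<bar>\<beta>\<bar> * r)) \<le> G"
        using \<beta>y r unfolding G_def by (intro ennreal_leI) (auto intro: mult_right_mono)
      then have "ennreal (exp (\<bar>\<beta>\<bar> * r)) * indicator {-r..r} v \<le> G * indicator {-r..r} v"
        by (intro mult_right_mono) auto
      with bump_le[OF r, of \<beta> v] show ?thesis by (rule order_trans)
    qed
    have q'_G: "q' \<le> G"
    proof -
      have "ennreal (bump r \<beta> v) \<le> G" for v
        using bump_G[of v] by (rule order_trans) (simp add: indicator_def)
      then have "q' \<le> (\<integral>\<^sup>+x. G \<partial>gauss 1)"
        unfolding q'_def by (intro nn_integral_mono)
      also have "\<dots> = G" using g1.emeasure_space_1 by simp
      finally show ?thesis .
    qed
    have step: "l * g k s \<le> (\<integral>\<^sup>+x. g (Suc k) (s + x) \<partial>gauss (sqrt (\<tau> (Suc k) - \<tau> k)))"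
      if "s \<in> A k" for k s
    proof (cases k)
      case 0
      show ?thesis
      proof (cases "s = 0")
        case True
        have "l * q' \<le> 1 * q'" using l1 by (intro mult_right_mono) auto
        then show ?thesis using True 0 by (simp add: g_def \<tau>_def V_def q'_def)
      qed (simp add: g_def 0)
    next
      case (Suc j)
      have v: "\<bar>V j s\<bar> \<le> r" using that by (simp add: A_def Suc)
      let ?c = "exp (- h * real (Suc j) / 2)"
      let ?s = "sqrt (exp (h * real (Suc j)) - exp (h * real j))"
      have s: "0 < ?s" using h by simp
      \<comment> \<open>After rescaling, the increment over each exponential interval has variance
        \<open>1 - exp (- h)\<close>, whatever \<open>j\<close> is, so one and the same one-step
        bound applies.\<close>
      have cs: "?c * ?s = sqrt (1 - exp (- h))"
      proof -
        have "?c = sqrt (?c * ?c)" by simp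
        also have "?c * ?c = exp (- h * real (Suc j))" by (simp flip: exp_add)
        finally have "?c * ?s = sqrt (exp (- h * real (Suc j)) * (exp (h * real (Suc j)) - exp (h * real j)))"
          by (simp add: real_sqrt_mult)
        also have "exp (- h * real (Suc j)) * (exp (h * real (Suc j)) - exp (h * real j)) = 1 - exp (- h)"
          by (simp add: right_diff_distrib flip: exp_add) (simp add: algebra_simps)
        finally show ?thesis .
      qed
      have V_Suc: "V (Suc j) (s + x) = \<rho> * V j s - (1 - \<rho>) * y + ?c * x" for x
      proof -
        have "- h * real (Suc j) / 2 = - h / 2 + - h * real j / 2" by (simp add: field_simps)
        then have "?c = \<rho> * exp (- h * real j / 2)" unfolding \<rho>_def by (simp only: exp_add)
        then show ?thesis by (simp add: V_def algebra_simps)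
      qed
      have "l * ennreal (bump r \<beta> (V j s))
          \<le> (\<integral>\<^sup>+x. ennreal (bump r \<beta> (\<rho> * V j s - (1 - \<rho>) * y + x)) \<partial>gauss (?c * ?s))"
        unfolding cs l_def using v h r by (intro bump_gauss_ou) (auto simp: \<rho>_def \<beta>_def)
      also have "\<dots> = (\<integral>\<^sup>+x. ennreal (bump r \<beta> (V (Suc j) (s + x))) \<partial>gauss ?s)"
        unfolding V_Suc by (subst nn_integral_gauss_scale[symmetric]) (use s in auto)
      finally show ?thesis by (simp add: g_def Suc \<tau>_def)
    qed
    have "l ^ Suc n * g 0 0 \<le> G * emeasure M {\<omega> \<in> space M. \<forall>k\<le>Suc n. B (\<tau> k) \<omega> \<in> A k}"
    proof (rule standard_BM_tube[OF M B])
      show "\<tau> 0 = 0" by (simp add: \<tau>_def)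
      show "\<tau> k < \<tau> (Suc k)" for k using h by (auto simp: \<tau>_def split: nat.split)
      show "g k \<in> borel_measurable borel" for k
        by (cases k) (simp_all add: g_def[abs_def] V_def)
      show "A k \<in> sets borel" for k
        by (cases k) (simp_all add: A_def V_def)
      show "g k s \<le> G * indicator (A k) s" for k s
      proof (cases k)
        case 0
        then show ?thesis using q'_G by (auto simp: g_def A_def indicator_def)
      next
        case (Suc j)
        have "indicator {-r..r} (V j s) = (indicator (A k) s :: ennreal)"
          by (auto simp: Suc A_def indicator_def abs_le_iff)
        then show ?thesis using bump_G[of "V j s"] by (simp add: g_def Suc)
      qed
    qed (use step in auto)
    also have "{\<omega> \<in> space M. \<forall>k\<le>Suc n. B (\<tau> k) \<omega> \<in> A k} =
      {\<omega> \<in> space M. \<forall>k\<le>n. \<bar>exp (- (T * real k / real n) / 2) * B (exp (T * real k / real n)) \<omega> - y\<bar> \<le> r}" (is "?L = ?R")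
    proof -
      have "(\<forall>k\<le>Suc n. B (\<tau> k) \<omega> \<in> A k) \<longleftrightarrow> (\<forall>k\<le>n. B (\<tau> (Suc k)) \<omega> \<in> A (Suc k))" for \<omega>
      proof -
        have "B (\<tau> 0) \<omega> \<in> A 0" by (simp add: A_def)
        then show ?thesis by (metis Suc_le_mono not0_implies_Suc)
      qed
      then show ?thesis by (simp add: \<tau>_def A_def V_def h_def)
    qed
    finally have main: "l ^ Suc n * q' \<le> G * ennreal (measure M ?R)"
      by (simp add: g_def emeasure_eq_measure)
    have q': "ennreal (exp (- \<bar>y\<bar> * r)) * J \<le> q'"
    proof -
      have "ennreal (exp (- \<bar>y\<bar> * r)) * J = (\<integral>\<^sup>+x. ennreal (exp (- \<bar>y\<bar> * r)) * ennreal (bump r 0 (x - y)) \<partial>gauss 1)"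
        unfolding J_def by (subst nn_integral_cmult) auto
      also have "\<dots> \<le> q'" unfolding q'_def using bump_tilt_ge[OF r \<beta>y] by (intro nn_integral_mono) auto
      finally show ?thesis .
    qed
    have Jr: "J = ennreal (enn2real J)" using J by simp
    have lSuc: "l ^ Suc n = ennreal (exp (- h * ou_rate r y) * exp (- T * ou_rate r y))"
    proof -
      have "exp (- h * ou_rate r y) ^ n = exp (- T * ou_rate r y)"
        using n by (simp add: exp_of_nat_mult[symmetric] h_def)
      then show ?thesis by (simp add: l_def ennreal_power flip: ennreal_mult')
    qed
    have "ennreal (exp (- h * ou_rate r y) * exp (- T * ou_rate r y) * (exp (- \<bar>y\<bar> * r) * enn2real J)) = l ^ Suc n * (ennreal (exp (- \<bar>y\<bar> * r)) * J)"
      unfolding lSuc by (subst (2) Jr) (simp add: ennreal_mult)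
    also have "\<dots> \<le> l ^ Suc n * q'" by (intro mult_left_mono q') auto
    also note main
    also have "G * ennreal (measure M ?R) = ennreal (exp (\<bar>y\<bar> * r) * measure M ?R)"
      by (simp add: G_def ennreal_mult)
    finally have "exp (- h * ou_rate r y) * exp (- T * ou_rate r y) * (exp (- \<bar>y\<bar> * r) * enn2real J) \<le> exp (\<bar>y\<bar> * r) * measure M ?R"
      by (subst (asm) ennreal_le_iff) auto
    then have "exp (- \<bar>y\<bar> * r) * (exp (- h * ou_rate r y) * exp (- T * ou_rate r y) * (exp (- \<bar>y\<bar> * r) * enn2real J)) \<le>
      exp (- \<bar>y\<bar> * r) * (exp (\<bar>y\<bar> * r) * measure M ?R)"
      by (intro mult_left_mono) auto
    also have "\<dots> = measure M ?R" by (simp add: exp_minus)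
    finally have fin: "exp (- h * ou_rate r y) * (exp (- T * ou_rate r y) * (exp (- \<bar>y\<bar> * r) * (exp (- \<bar>y\<bar> * r) * enn2real J))) \<le> measure M ?R"
      by (simp only: mult_ac)
    have "h * ou_rate r y \<le> 1 * ou_rate r y" using h ou_rate_nonneg[OF r] by (intro mult_right_mono) auto
    then have "exp (- ou_rate r y) * (exp (- T * ou_rate r y) * (exp (- \<bar>y\<bar> * r) * (exp (- \<bar>y\<bar> * r) * enn2real J))) \<le>
       exp (- h * ou_rate r y) * (exp (- T * ou_rate r y) * (exp (- \<bar>y\<bar> * r) * (exp (- \<bar>y\<bar> * r) * enn2real J)))"
      by (intro mult_right_mono) auto
    also note fin
    finally show ?thesis unfolding q_def by (simp only: mult_ac)
  qed
  moreover have "0 < q" using J by (simp add: q_def enn2real_positive_iff)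
  ultimately show ?thesis by blast
qed

section \<open>From grids to all dyadic times\<close>

lemma eventually_over_n_le:
  assumes "0 < (c::real)"
  shows "\<forall>\<^sub>F n in sequentially. 0 < n \<and> T / real n \<le> c"
proof -
  have "\<forall>\<^sub>F n in sequentially. T / real n < c"
    using lim_const_over_n[of T] assms by (rule order_tendstoD(2))
  then show ?thesis using eventually_gt_at_top[of 0] by eventually_elim auto
qed

lemma standard_BM_stay:
  assumes M: "prob_space M" and B: "standard_BM M B" and r: "0 < r" and T: "0 < T"
  shows "(1 - exp (- 1)) * exp (- 8 * T / r\<^sup>2) \<le> measure M {\<omega> \<in> space M. \<forall>t\<in>dyadic_times T. \<bar>B t \<omega>\<bar> \<le> r}"
proof (rule dyadic_times_limit[OF M])
  show "{\<omega> \<in> space M. \<bar>B t \<omega>\<bar> \<le> r} \<in> sets M" if "t \<in> {0..T}" for t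
    using standard_BM_measurable[OF B, of t] that by auto
  have "\<forall>\<^sub>F n in sequentially. 0 < n \<and> T / real n \<le> r\<^sup>2 / 8"
    using r by (intro eventually_over_n_le) auto
  then show "\<forall>\<^sub>F n in sequentially. (1 - exp (- 1)) * exp (- 8 * T / r\<^sup>2)
      \<le> measure M {\<omega> \<in> space M. \<forall>k\<le>n. \<bar>B (T * real k / real n) \<omega>\<bar> \<le> r}"
    by eventually_elim (intro standard_BM_stay_grid[OF M B r T], auto simp: mult.commute)
qed (use T in auto)

lemma standard_BM_max:
  assumes M: "prob_space M" and B: "standard_BM M B" and a: "0 \<le> a" and T: "0 < T"
  shows "1 - exp (T / 2) / cosh a \<le> measure M {\<omega> \<in> space M. \<forall>t\<in>dyadic_times T. \<bar>B t \<omega>\<bar> \<le> a}"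
proof (rule dyadic_times_limit[OF M])
  show "{\<omega> \<in> space M. \<bar>B t \<omega>\<bar> \<le> a} \<in> sets M" if "t \<in> {0..T}" for t
    using standard_BM_measurable[OF B, of t] that by auto
  show "\<forall>\<^sub>F n in sequentially. 1 - exp (T / 2) / cosh a
      \<le> measure M {\<omega> \<in> space M. \<forall>k\<le>n. \<bar>B (T * real k / real n) \<omega>\<bar> \<le> a}"
    using eventually_gt_at_top[of 0]
  proof eventually_elim
    case (elim n)
    then show ?case
      using standard_BM_max_grid[OF M B, of "\<lambda>k. T * real k / real n" n a] T a
      by (simp add: divide_strict_right_mono)
  qed
qed (use T in auto)

text \<open>The times \<open>exp t\<close> begin at 1, so the starting time 0 of the walk is put in
  front of the grid; the horizon becomes \<open>exp T\<close>.\<close>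

lemma standard_BM_max_exp:
  assumes M: "prob_space M" and B: "standard_BM M B" and a: "0 \<le> a" and T: "0 < T"
  shows "1 - exp (exp T / 2) / cosh a \<le> measure M {\<omega> \<in> space M. \<forall>t\<in>dyadic_times T. \<bar>B (exp t) \<omega>\<bar> \<le> a}"
proof (rule dyadic_times_limit[OF M])
  interpret prob_space M by (rule M)
  show meas: "{\<omega> \<in> space M. \<bar>B (exp t) \<omega>\<bar> \<le> a} \<in> sets M" if "t \<in> {0..T}" for t
    using standard_BM_measurable[OF B, of "exp t"] by measurable
  show "\<forall>\<^sub>F n in sequentially. 1 - exp (exp T / 2) / cosh a
      \<le> measure M {\<omega> \<in> space M. \<forall>k\<le>n. \<bar>B (exp (T * real k / real n)) \<omega>\<bar> \<le> a}"
    using eventually_gt_at_top[of 0]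
  proof eventually_elim
    case (elim n)
    define \<tau> where "\<tau> k = (case k of 0 \<Rightarrow> 0 | Suc j \<Rightarrow> exp (T * real j / real n))" for k
    have "1 - exp (\<tau> (Suc n) / 2) / cosh a \<le> measure M {\<omega> \<in> space M. \<forall>k\<le>Suc n. \<bar>B (\<tau> k) \<omega>\<bar> \<le> a}"
      using elim T a
      by (intro standard_BM_max_grid[OF M B]) (auto simp: \<tau>_def divide_strict_right_mono split: nat.split)
    also have "\<dots> \<le> measure M {\<omega> \<in> space M. \<forall>k\<in>{..n}. \<bar>B (exp (T * real k / real n)) \<omega>\<bar> \<le> a}"
    proof (rule finite_measure_mono)
      have "\<bar>B (exp (T * real k / real n)) \<omega>\<bar> \<le> a" if "\<forall>k\<le>Suc n. \<bar>B (\<tau> k) \<omega>\<bar> \<le> a" "k \<le> n" for k \<omega>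
        using that(1)[rule_format, of "Suc k"] that(2) by (simp add: \<tau>_def)
      then show "{\<omega> \<in> space M. \<forall>k\<le>Suc n. \<bar>B (\<tau> k) \<omega>\<bar> \<le> a} \<subseteq> {\<omega> \<in> space M. \<forall>k\<in>{..n}. \<bar>B (exp (T * real k / real n)) \<omega>\<bar> \<le> a}"
        by auto
      show "{\<omega> \<in> space M. \<forall>k\<in>{..n}. \<bar>B (exp (T * real k / real n)) \<omega>\<bar> \<le> a} \<in> sets M"
      proof (rule sets.sets_Collect_finite_All')
        fix k assume "k \<in> {..n}"
        have "B (exp (T * real k / real n)) \<in> borel_measurable M"
          using B by (simp add: standard_BM_measurable)
        then show "{\<omega> \<in> space M. \<bar>B (exp (T * real k / real n)) \<omega>\<bar> \<le> a} \<in> sets M" by measurable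
      qed auto
    qed
    finally show ?case using elim by (simp add: \<tau>_def Ball_def)
  qed
qed (use T in auto)

lemma standard_BM_ou_stay:
  assumes r: "0 < r"
  shows "\<exists>q>0. \<forall>(M :: 'w measure) B T. prob_space M \<longrightarrow> standard_BM M B \<longrightarrow> 0 < T \<longrightarrow>
    q * exp (- T * ou_rate r y) \<le> measure M {\<omega> \<in> space M. \<forall>t\<in>dyadic_times T. \<bar>exp (- t / 2) * B (exp t) \<omega> - y\<bar> \<le> r}"
proof -
  obtain q where q: "q > 0" and grid: "\<And>(M :: 'w measure) B T n. prob_space M \<Longrightarrow> standard_BM M B \<Longrightarrow> 0 < T \<Longrightarrow> 0 < n \<Longrightarrow>
      T / real n \<le> 1 \<Longrightarrow> 8 * (T / real n) \<le> r\<^sup>2 \<Longrightarrow>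
    q * exp (- T * ou_rate r y) \<le>
      measure M {\<omega> \<in> space M. \<forall>k\<le>n. \<bar>exp (- (T * real k / real n) / 2) * B (exp (T * real k / real n)) \<omega> - y\<bar> \<le> r}"
    using standard_BM_ou_grid[OF r, of y] by blast
  have "q * exp (- T * ou_rate r y) \<le> measure M {\<omega> \<in> space M. \<forall>t\<in>dyadic_times T. \<bar>exp (- t / 2) * B (exp t) \<omega> - y\<bar> \<le> r}"
    if M: "prob_space M" and B: "standard_BM M B" and T: "0 < T" for M :: "'w measure" and B T
  proof (rule dyadic_times_limit[OF M])
    show "{\<omega> \<in> space M. \<bar>exp (- t / 2) * B (exp t) \<omega> - y\<bar> \<le> r} \<in> sets M" if "t \<in> {0..T}" for t
      using standard_BM_measurable[OF B, of "exp t"] by measurable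
    have "\<forall>\<^sub>F n in sequentially. 0 < n \<and> T / real n \<le> min 1 (r\<^sup>2 / 8)"
      using r by (intro eventually_over_n_le) auto
    then show "\<forall>\<^sub>F n in sequentially. q * exp (- T * ou_rate r y) \<le>
      measure M {\<omega> \<in> space M. \<forall>k\<le>n. \<bar>exp (- (T * real k / real n) / 2) * B (exp (T * real k / real n)) \<omega> - y\<bar> \<le> r}"
    proof eventually_elim
      case (elim n)
      then have "T / real n \<le> 1" "8 * (T / real n) \<le> r\<^sup>2" by (simp_all only: min.bounded_iff) linarith+
      then show ?case using elim by (intro grid M B T) auto
    qed
  qed (use T in auto)
  then show ?thesis using q by blast
qed

section \<open>Trajectory events at countably many times\<close>

lemma traj_event:
  assumes "countable D" "D \<subseteq> {0..}" "\<And>t. t \<in> D \<Longrightarrow> C t \<in> sets borel"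
  shows "{x \<in> space traj_space. \<forall>t\<in>D. x t \<in> C t} \<in> sets traj_space"
proof (rule sets.sets_Collect_countable_All'[OF _ assms(1)])
  fix t assume t: "t \<in> D"
  have "(\<lambda>x. x t) \<in> measurable traj_space borel"
    using t assms(2) by (intro measurable_component_singleton) auto
  from measurable_sets[OF this assms(3)[OF t]]
  show "{x \<in> space traj_space. x t \<in> C t} \<in> sets traj_space"
    by (simp add: vimage_def Int_def conj_commute)
qed

lemma traj_measurable:
  assumes "\<And>t. 0 \<le> t \<Longrightarrow> X t \<in> borel_measurable M"
  shows "traj X \<in> measurable M traj_space"
  unfolding traj_def[abs_def] using assms by (intro measurable_restrict) auto

lemma traj_vimage:
  assumes "D \<subseteq> {0..}"
  shows "traj X -` {x \<in> space traj_space. \<forall>t\<in>D. x t \<in> C t} \<inter> space M = {\<omega> \<in> space M. \<forall>t\<in>D. X t \<omega> \<in> C t}"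
  using assms by (auto simp: traj_def space_PiM PiE_def extensional_def subset_iff)

text \<open>A law on \<open>traj_space\<close> determines events that depend on countably many
  times. This is the reason for stating tubes over dyadic times.\<close>

lemma measure_traj_event_cong:
  assumes X: "\<And>t. 0 \<le> t \<Longrightarrow> X t \<in> borel_measurable M" and Y: "\<And>t. 0 \<le> t \<Longrightarrow> Y t \<in> borel_measurable M'"
    and law: "distr M traj_space (traj X) = distr M' traj_space (traj Y)"
    and D: "countable D" "D \<subseteq> {0..}" and C: "\<And>t. t \<in> D \<Longrightarrow> C t \<in> sets borel"
  shows "measure M {\<omega> \<in> space M. \<forall>t\<in>D. X t \<omega> \<in> C t} = measure M' {\<omega> \<in> space M'. \<forall>t\<in>D. Y t \<omega> \<in> C t}"
proof -
  let ?S = "{x \<in> space traj_space. \<forall>t\<in>D. x t \<in> C t}"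
  have "measure M {\<omega> \<in> space M. \<forall>t\<in>D. X t \<omega> \<in> C t} = measure (distr M traj_space (traj X)) ?S"
    by (subst measure_distr) (auto intro!: traj_measurable X traj_event D C simp only: traj_vimage[OF D(2)])
  also have "\<dots> = measure M' {\<omega> \<in> space M'. \<forall>t\<in>D. Y t \<omega> \<in> C t}"
    unfolding law
    by (subst measure_distr) (auto intro!: traj_measurable Y traj_event D C simp only: traj_vimage[OF D(2)])
  finally show ?thesis .
qed

lemma indep_traj_events:
  assumes M: "prob_space M" and ind: "prob_space.indep_var M traj_space (traj X) traj_space (traj Y)"
    and D: "countable D" "D \<subseteq> {0..}" and C: "\<And>t. t \<in> D \<Longrightarrow> C t \<in> sets borel" "\<And>t. t \<in> D \<Longrightarrow> C' t \<in> sets borel"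
  shows "measure M {\<omega> \<in> space M. \<forall>t\<in>D. X t \<omega> \<in> C t \<and> Y t \<omega> \<in> C' t} =
    measure M {\<omega> \<in> space M. \<forall>t\<in>D. X t \<omega> \<in> C t} * measure M {\<omega> \<in> space M. \<forall>t\<in>D. Y t \<omega> \<in> C' t}"
proof -
  interpret prob_space M by (rule M)
  let ?S = "{x \<in> space traj_space. \<forall>t\<in>D. x t \<in> C t}" and ?S' = "{x \<in> space traj_space. \<forall>t\<in>D. x t \<in> C' t}"
  have "prob ((\<lambda>\<omega>. (traj X \<omega>, traj Y \<omega>)) -` (?S \<times> ?S') \<inter> space M) =
     prob (traj X -` ?S \<inter> space M) * prob (traj Y -` ?S' \<inter> space M)"
    using ind by (rule indep_varD) (intro traj_event D C; assumption)+
  moreover have "(\<lambda>\<omega>. (traj X \<omega>, traj Y \<omega>)) -` (?S \<times> ?S') \<inter> space M =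
    (traj X -` ?S \<inter> space M) \<inter> (traj Y -` ?S' \<inter> space M)" by auto
  ultimately have "prob ((traj X -` ?S \<inter> space M) \<inter> (traj Y -` ?S' \<inter> space M)) =
     prob (traj X -` ?S \<inter> space M) * prob (traj Y -` ?S' \<inter> space M)" by simp
  then show ?thesis
    unfolding traj_vimage[OF D(2)] by (simp add: Collect_conj_eq[symmetric] ball_conj_distrib conj_ac cong: conj_cong)
qed

section \<open>Complex Brownian motion and the complex Ornstein-Uhlenbeck process\<close>

lemma cmod_coords_le:
  assumes "\<bar>x\<bar> \<le> r" "\<bar>y\<bar> \<le> r"
  shows "cmod ((of_real x + \<i> * of_real y) / of_real (sqrt 2)) \<le> r"
proof -
  have r: "0 \<le> r" using assms by linarith
  have "x\<^sup>2 \<le> r\<^sup>2" "y\<^sup>2 \<le> r\<^sup>2" using assms abs_le_square_iff[of x r] abs_le_square_iff[of y r] r by auto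
  then have "sqrt (x\<^sup>2 + y\<^sup>2) \<le> sqrt (2 * r\<^sup>2)" by simp
  also have "\<dots> = sqrt 2 * r" using r by (simp add: real_sqrt_mult)
  finally have "cmod (of_real x + \<i> * of_real y) \<le> sqrt 2 * r"
    by (simp add: cmod_def)
  then show ?thesis by (simp add: norm_divide field_simps)
qed

lemma complex_BM_measurable:
  assumes "complex_BM M W" "0 \<le> t"
  shows "W t \<in> borel_measurable M"
proof -
  obtain B1 B2 where B: "standard_BM M B1" "standard_BM M B2"
    "\<forall>t\<ge>0. \<forall>\<omega>\<in>space M. W t \<omega> = (of_real (B1 t \<omega>) + \<i> * of_real (B2 t \<omega>)) / of_real (sqrt 2)"
    using assms unfolding complex_BM_def by blast
  have [measurable]: "B1 t \<in> borel_measurable M" "B2 t \<in> borel_measurable M"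
    using B assms by (auto simp: standard_BM_measurable)
  have "(\<lambda>\<omega>. (of_real (B1 t \<omega>) + \<i> * of_real (B2 t \<omega>)) / of_real (sqrt 2)) \<in> borel_measurable M"
    by measurable
  then show ?thesis using B(3) assms(2) by (subst measurable_cong) auto
qed

lemma countable_ball_event:
  assumes "countable D" "\<And>t. t \<in> D \<Longrightarrow> X t \<in> borel_measurable M" "\<And>t. t \<in> D \<Longrightarrow> C t \<in> sets borel"
  shows "{\<omega> \<in> space M. \<forall>t\<in>D. X t \<omega> \<in> C t} \<in> sets M"
proof (rule sets.sets_Collect_countable_All'[OF _ assms(1)])
  fix t assume "t \<in> D"
  from measurable_sets[OF assms(2)[OF this] assms(3)[OF this]]
  show "{\<omega> \<in> space M. X t \<omega> \<in> C t} \<in> sets M" by (simp add: vimage_def Int_def conj_commute)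
qed

text \<open>By the normalisation with \<open>sqrt 2\<close>, two coordinates in
  \<open>[-r, r]\<close> give a point of the disc of radius \<open>r\<close>. Their independence
  squares the one-dimensional bound, so 8 becomes 16.\<close>

lemma complex_BM_stay:
  assumes M: "prob_space M" and W: "complex_BM M W" and r: "0 < r" and T: "0 < T"
  shows "(1 - exp (- 1))\<^sup>2 * exp (- 16 * T / r\<^sup>2) \<le> measure M {\<omega> \<in> space M. \<forall>t\<in>dyadic_times T. W t \<omega> \<in> cball 0 r}"
proof -
  interpret prob_space M by (rule M)
  obtain B1 B2 where B: "standard_BM M B1" "standard_BM M B2" "indep_var traj_space (traj B1) traj_space (traj B2)"
    "\<forall>t\<ge>0. \<forall>\<omega>\<in>space M. W t \<omega> = (of_real (B1 t \<omega>) + \<i> * of_real (B2 t \<omega>)) / of_real (sqrt 2)"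
    using W unfolding complex_BM_def by blast
  have D: "countable (dyadic_times T)" "dyadic_times T \<subseteq> {0..}"
    using dyadic_times_subset[of T] T by (auto simp: countable_dyadic_times)
  let ?p = "(1 - exp (- 1)) * exp (- 8 * T / r\<^sup>2)"
  have "?p * ?p \<le> measure M {\<omega> \<in> space M. \<forall>t\<in>dyadic_times T. \<bar>B1 t \<omega>\<bar> \<le> r} * measure M {\<omega> \<in> space M. \<forall>t\<in>dyadic_times T. \<bar>B2 t \<omega>\<bar> \<le> r}"
    by (intro mult_mono standard_BM_stay M B r T) auto
  also have "\<dots> = measure M {\<omega> \<in> space M. \<forall>t\<in>dyadic_times T. B1 t \<omega> \<in> {x. \<bar>x\<bar> \<le> r} \<and> B2 t \<omega> \<in> {x. \<bar>x\<bar> \<le> r}}"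
    by (subst indep_traj_events[OF M B(3) D]) auto
  also have "\<dots> \<le> measure M {\<omega> \<in> space M. \<forall>t\<in>dyadic_times T. W t \<omega> \<in> cball 0 r}"
  proof (rule finite_measure_mono)
    show "{\<omega> \<in> space M. \<forall>t\<in>dyadic_times T. B1 t \<omega> \<in> {x. \<bar>x\<bar> \<le> r} \<and> B2 t \<omega> \<in> {x. \<bar>x\<bar> \<le> r}}
       \<subseteq> {\<omega> \<in> space M. \<forall>t\<in>dyadic_times T. W t \<omega> \<in> cball 0 r}"
      using B(4) D(2) cmod_coords_le[of _ r] by (auto simp: subset_iff)
    show "{\<omega> \<in> space M. \<forall>t\<in>dyadic_times T. W t \<omega> \<in> cball 0 r} \<in> sets M"
      using complex_BM_measurable[OF W] D by (intro countable_ball_event) auto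
  qed
  also have "?p * ?p = (1 - exp (- 1))\<^sup>2 * exp (- 16 * T / r\<^sup>2)"
    by (simp add: power2_eq_square mult_ac flip: exp_add)
  finally show ?thesis .
qed

text \<open>The failure probabilities of the two coordinates add up. \<open>D\<close> is left open
  because it is the set of dyadic times for the Poisson process and its image under
  \<open>exp\<close> for the lattices.\<close>

lemma complex_BM_max:
  assumes M: "prob_space M" and W: "complex_BM M W" and D: "countable D" "D \<subseteq> {0..}"
    and max: "\<And>B. standard_BM M B \<Longrightarrow> 1 - e \<le> measure M {\<omega> \<in> space M. \<forall>t\<in>D. \<bar>B t \<omega>\<bar> \<le> a}"
  shows "1 - 2 * e \<le> measure M {\<omega> \<in> space M. \<forall>t\<in>D. W t \<omega> \<in> cball 0 a}"
proof -
  interpret prob_space M by (rule M)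
  obtain B1 B2 where B: "standard_BM M B1" "standard_BM M B2"
    "\<forall>t\<ge>0. \<forall>\<omega>\<in>space M. W t \<omega> = (of_real (B1 t \<omega>) + \<i> * of_real (B2 t \<omega>)) / of_real (sqrt 2)"
    using W unfolding complex_BM_def by blast
  define E where "E B = {\<omega> \<in> space M. \<forall>t\<in>D. B t \<omega> \<in> {x. \<bar>x\<bar> \<le> a}}" for B
  have E: "E B \<in> sets M" if "standard_BM M B" for B
    unfolding E_def using that D by (intro countable_ball_event) (auto simp: standard_BM_measurable)
  have "1 - e \<le> measure M (E B1)" "1 - e \<le> measure M (E B2)"
    using max[OF B(1)] max[OF B(2)] by (simp_all add: E_def)
  moreover have "measure M (E B1 \<union> E B2) + measure M (E B1 \<inter> E B2) = measure M (E B1) + measure M (E B2)"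
    using E[OF B(1)] E[OF B(2)] by (simp add: finite_measure_Union' finite_measure_Diff' Int_commute)
  moreover have "measure M (E B1 \<union> E B2) \<le> 1" by simp
  ultimately have "1 - 2 * e \<le> measure M (E B1 \<inter> E B2)" by linarith
  also have "\<dots> \<le> measure M {\<omega> \<in> space M. \<forall>t\<in>D. W t \<omega> \<in> cball 0 a}"
  proof (rule finite_measure_mono)
    show "E B1 \<inter> E B2 \<subseteq> {\<omega> \<in> space M. \<forall>t\<in>D. W t \<omega> \<in> cball 0 a}"
      using B(3) D(2) cmod_coords_le[of _ a] by (auto simp: subset_iff E_def)
    show "{\<omega> \<in> space M. \<forall>t\<in>D. W t \<omega> \<in> cball 0 a} \<in> sets M"
      using complex_BM_measurable[OF W] D by (intro countable_ball_event) auto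
  qed
  finally show ?thesis .
qed

lemma complex_OU_measurable: "complex_OU M Z \<Longrightarrow> 0 \<le> t \<Longrightarrow> Z t \<in> borel_measurable M"
  by (simp add: complex_OU_def)

lemma complex_BM_ou_measurable:
  assumes "complex_BM M W"
  shows "(\<lambda>\<omega>. of_real (exp (- t / 2)) * W (exp t) \<omega>) \<in> borel_measurable M"
  using complex_BM_measurable[OF assms, of "exp t"] by measurable

text \<open>The coordinates of the driving motion carry a factor \<open>sqrt 2\<close>, hence the
  centres \<open>sqrt 2 * Re z\<close> and \<open>sqrt 2 * Im z\<close>. The constant precedes
  \<open>T\<close>, so that it disappears from the rate.\<close>

lemma complex_OU_stay:
  assumes \<rho>: "0 < \<rho>"
  shows "\<exists>q>0. \<forall>(M :: 'w measure) Z T. complex_OU M Z \<longrightarrow> 0 < T \<longrightarrow>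
    q * exp (- T * (ou_rate \<rho> (sqrt 2 * Re z) + ou_rate \<rho> (sqrt 2 * Im z)))
      \<le> measure M {\<omega> \<in> space M. \<forall>t\<in>dyadic_times T. Z t \<omega> \<in> cball z \<rho>}"
proof -
  define y1 y2 where "y1 = sqrt 2 * Re z" and "y2 = sqrt 2 * Im z"
  obtain q1 where q1: "q1 > 0" and stay1: "\<And>(M :: (real \<Rightarrow> complex) measure) B T. prob_space M \<Longrightarrow> standard_BM M B \<Longrightarrow> 0 < T \<Longrightarrow>
    q1 * exp (- T * ou_rate \<rho> y1) \<le> measure M {\<omega> \<in> space M. \<forall>t\<in>dyadic_times T. \<bar>exp (- t / 2) * B (exp t) \<omega> - y1\<bar> \<le> \<rho>}"
    using standard_BM_ou_stay[OF \<rho>, of y1] by blast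
  obtain q2 where q2: "q2 > 0" and stay2: "\<And>(M :: (real \<Rightarrow> complex) measure) B T. prob_space M \<Longrightarrow> standard_BM M B \<Longrightarrow> 0 < T \<Longrightarrow>
    q2 * exp (- T * ou_rate \<rho> y2) \<le> measure M {\<omega> \<in> space M. \<forall>t\<in>dyadic_times T. \<bar>exp (- t / 2) * B (exp t) \<omega> - y2\<bar> \<le> \<rho>}"
    using standard_BM_ou_stay[OF \<rho>, of y2] by blast
  have z: "z = (of_real y1 + \<i> * of_real y2) / of_real (sqrt 2)"
    by (simp add: y1_def y2_def complex_eq_iff)
  have "q1 * q2 * exp (- T * (ou_rate \<rho> y1 + ou_rate \<rho> y2))
      \<le> measure M {\<omega> \<in> space M. \<forall>t\<in>dyadic_times T. Z t \<omega> \<in> cball z \<rho>}"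
    if Z: "complex_OU M Z" and T: "0 < T" for M :: "'w measure" and Z T
  proof -
    obtain M' :: "(real \<Rightarrow> complex) measure" and W where M': "prob_space M'" and W: "complex_BM M' W" and
      law: "distr M traj_space (traj Z) = distr M' traj_space (traj (\<lambda>t \<omega>. of_real (exp (- t / 2)) * W (exp t) \<omega>))"
      using Z unfolding complex_OU_def by blast
    interpret prob_space M' by (rule M')
    obtain B1 B2 where B: "standard_BM M' B1" "standard_BM M' B2" "indep_var traj_space (traj B1) traj_space (traj B2)"
      "\<forall>t\<ge>0. \<forall>\<omega>\<in>space M'. W t \<omega> = (of_real (B1 t \<omega>) + \<i> * of_real (B2 t \<omega>)) / of_real (sqrt 2)"
      using W unfolding complex_BM_def by blast
    have D: "countable (dyadic_times T)" "dyadic_times T \<subseteq> {0..}"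
      using dyadic_times_subset[of T] T by (auto simp: countable_dyadic_times)
    \<comment> \<open>Independence concerns the trajectories of the driving motions in their own
      time \<open>s = exp t\<close>; the condition at time \<open>t\<close> is therefore written at
      time \<open>s\<close>, with \<open>t = ln s\<close>.\<close>
    define C where "C y s = {x::real. \<bar>exp (- ln s / 2) * x - y\<bar> \<le> \<rho>}" for y s :: real
    have C[measurable]: "C y s \<in> sets borel" for y s unfolding C_def by measurable
    have exp_ball: "(\<forall>s\<in>exp ` dyadic_times T. Q s) \<longleftrightarrow> (\<forall>t\<in>dyadic_times T. Q (exp t))" for Q by blast
    have "q1 * q2 * exp (- T * (ou_rate \<rho> y1 + ou_rate \<rho> y2)) = (q1 * exp (- T * ou_rate \<rho> y1)) * (q2 * exp (- T * ou_rate \<rho> y2))"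
      by (simp add: distrib_left exp_add exp_diff field_simps exp_minus)
    also have "\<dots> \<le> measure M' {\<omega> \<in> space M'. \<forall>t\<in>dyadic_times T. \<bar>exp (- t / 2) * B1 (exp t) \<omega> - y1\<bar> \<le> \<rho>} *
      measure M' {\<omega> \<in> space M'. \<forall>t\<in>dyadic_times T. \<bar>exp (- t / 2) * B2 (exp t) \<omega> - y2\<bar> \<le> \<rho>}"
      using q1 q2 by (intro mult_mono stay1 stay2 M' B T) auto
    also have "\<dots> = measure M' {\<omega> \<in> space M'. \<forall>s\<in>exp ` dyadic_times T. B1 s \<omega> \<in> C y1 s} * measure M' {\<omega> \<in> space M'. \<forall>s\<in>exp ` dyadic_times T. B2 s \<omega> \<in> C y2 s}"
      unfolding exp_ball by (simp add: C_def)
    also have "\<dots> = measure M' {\<omega> \<in> space M'. \<forall>s\<in>exp ` dyadic_times T. B1 s \<omega> \<in> C y1 s \<and> B2 s \<omega> \<in> C y2 s}"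
      by (rule indep_traj_events[OF M' B(3), symmetric]) (use D in auto)
    also have "\<dots> \<le> measure M' {\<omega> \<in> space M'. \<forall>t\<in>dyadic_times T. of_real (exp (- t / 2)) * W (exp t) \<omega> \<in> cball z \<rho>}"
    proof (rule finite_measure_mono)
      have "of_real (exp (- t / 2)) * W (exp t) \<omega> \<in> cball z \<rho>"
        if \<omega>: "\<omega> \<in> space M'" and b: "B1 (exp t) \<omega> \<in> C y1 (exp t)" "B2 (exp t) \<omega> \<in> C y2 (exp t)" for t \<omega>
      proof -
        let ?u = "exp (- t / 2) * B1 (exp t) \<omega> - y1" and ?v = "exp (- t / 2) * B2 (exp t) \<omega> - y2"
        have "cmod ((of_real ?u + \<i> * of_real ?v) / of_real (sqrt 2)) \<le> \<rho>"
          using b by (intro cmod_coords_le) (auto simp: C_def)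
        also have "(of_real ?u + \<i> * of_real ?v) / of_real (sqrt 2) = of_real (exp (- t / 2)) * W (exp t) \<omega> - z"
          using B(4)[rule_format, of "exp t" \<omega>] \<omega> unfolding z
          by (simp add: diff_divide_distrib[symmetric] algebra_simps)
        finally show ?thesis by (simp add: dist_norm norm_minus_commute)
      qed
      then show "{\<omega> \<in> space M'. \<forall>s\<in>exp ` dyadic_times T. B1 s \<omega> \<in> C y1 s \<and> B2 s \<omega> \<in> C y2 s}
       \<subseteq> {\<omega> \<in> space M'. \<forall>t\<in>dyadic_times T. of_real (exp (- t / 2)) * W (exp t) \<omega> \<in> cball z \<rho>}"
        by blast
      show "{\<omega> \<in> space M'. \<forall>t\<in>dyadic_times T. of_real (exp (- t / 2)) * W (exp t) \<omega> \<in> cball z \<rho>} \<in> sets M'"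
        using complex_BM_ou_measurable[OF W] D by (intro countable_ball_event) auto
    qed
    also have "\<dots> = measure M {\<omega> \<in> space M. \<forall>t\<in>dyadic_times T. Z t \<omega> \<in> cball z \<rho>}"
      using complex_OU_measurable[OF Z] complex_BM_ou_measurable[OF W] D
      by (intro measure_traj_event_cong[OF _ _ law, symmetric]) auto
    finally show ?thesis .
  qed
  moreover have "0 < q1 * q2" using q1 q2 by simp
  ultimately show ?thesis unfolding y1_def y2_def by blast
qed

text \<open>The factor \<open>exp (- t / 2)\<close> is at most 1, so it suffices to bound the
  driving motion up to time \<open>exp T\<close>. The double exponential is harmless:
  \<open>T\<close> is fixed where this is used, and only the decay in \<open>a\<close>
  counts.\<close>

lemma complex_OU_max:
  assumes Z: "complex_OU M Z" and T: "0 < T" and a: "0 \<le> a"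
  shows "1 - 2 * (exp (exp T / 2) / cosh a) \<le> measure M {\<omega> \<in> space M. \<forall>t\<in>dyadic_times T. Z t \<omega> \<in> cball 0 a}"
proof -
  obtain M' :: "(real \<Rightarrow> complex) measure" and W where M': "prob_space M'" and W: "complex_BM M' W" and
    law: "distr M traj_space (traj Z) = distr M' traj_space (traj (\<lambda>t \<omega>. of_real (exp (- t / 2)) * W (exp t) \<omega>))"
    using Z unfolding complex_OU_def by blast
  interpret prob_space M' by (rule M')
  have D: "countable (dyadic_times T)" "dyadic_times T \<subseteq> {0..}"
    using dyadic_times_subset[of T] T by (auto simp: countable_dyadic_times)
  have "1 - 2 * (exp (exp T / 2) / cosh a) \<le> measure M' {\<omega> \<in> space M'. \<forall>s\<in>exp ` dyadic_times T. W s \<omega> \<in> cball 0 a}"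
  proof (rule complex_BM_max[OF M' W])
    fix B assume "standard_BM M' B"
    then show "1 - exp (exp T / 2) / cosh a \<le> measure M' {\<omega> \<in> space M'. \<forall>t\<in>exp ` dyadic_times T. \<bar>B t \<omega>\<bar> \<le> a}"
      using standard_BM_max_exp[OF M' _ a T] by simp
  qed (use D in auto)
  also have "\<dots> \<le> measure M' {\<omega> \<in> space M'. \<forall>t\<in>dyadic_times T. of_real (exp (- t / 2)) * W (exp t) \<omega> \<in> cball 0 a}"
  proof (rule finite_measure_mono)
    have "cmod (of_real (exp (- t / 2)) * W (exp t) \<omega>) \<le> a" if "cmod (W (exp t) \<omega>) \<le> a" "0 \<le> t" for t \<omega>
    proof -
      have "exp (- t / 2) * cmod (W (exp t) \<omega>) \<le> 1 * a" using that by (intro mult_mono) auto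
      then show ?thesis by (simp add: norm_mult)
    qed
    then show "{\<omega> \<in> space M'. \<forall>s\<in>exp ` dyadic_times T. W s \<omega> \<in> cball 0 a} \<subseteq>
      {\<omega> \<in> space M'. \<forall>t\<in>dyadic_times T. of_real (exp (- t / 2)) * W (exp t) \<omega> \<in> cball 0 a}"
      using D by (auto simp: subset_iff)
    show "{\<omega> \<in> space M'. \<forall>t\<in>dyadic_times T. of_real (exp (- t / 2)) * W (exp t) \<omega> \<in> cball 0 a} \<in> sets M'"
      using complex_BM_ou_measurable[OF W] D by (intro countable_ball_event) auto
  qed
  also have "\<dots> = measure M {\<omega> \<in> space M. \<forall>t\<in>dyadic_times T. Z t \<omega> \<in> cball 0 a}"
    using complex_OU_measurable[OF Z] complex_BM_ou_measurable[OF W] D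
    by (intro measure_traj_event_cong[OF _ _ law, symmetric]) auto
  finally show ?thesis .
qed

section \<open>Measurability and persistence rates\<close>

lemma closure_dyadic_times:
  assumes T: "0 < T" and t: "t \<in> {0..T}"
  shows "t \<in> closure (dyadic_times T)"
  unfolding closure_approachable
proof (intro allI impI)
  fix e :: real assume e: "0 < e"
  then obtain m where "(1 / 2) ^ m < e / T"
    using real_arch_pow_inv[of "e / T" "1 / 2"] T by auto
  then have m: "T / 2 ^ m < e" using T by (simp add: power_one_over field_simps)
  define u where "u = t * 2 ^ m / T"
  define j where "j = nat \<lfloor>u\<rfloor>"
  have u: "0 \<le> u" "u \<le> 2 ^ m" using T t by (auto simp: u_def field_simps)
  have j: "real j \<le> u" "u < real j + 1" using u by (auto simp: j_def)
  have tu: "t = T * u / 2 ^ m" using T by (simp add: u_def)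
  have "real j \<le> 2 ^ m" using j u by linarith
  then have "j \<le> 2 ^ m" by (metis of_nat_le_iff of_nat_numeral of_nat_power)
  then have mem: "T * real j / 2 ^ m \<in> dyadic_times T" by (auto simp: dyadic_times_def)
  have "dist (T * real j / 2 ^ m) t = T / 2 ^ m * (u - real j)"
  proof -
    have "T * real j / 2 ^ m \<le> t" unfolding tu using T j by (intro divide_right_mono mult_left_mono) auto
    then show ?thesis by (simp add: dist_real_def tu field_simps)
  qed
  also have "\<dots> \<le> T / 2 ^ m * 1" using j T by (intro mult_left_mono) auto
  also have "\<dots> < e" using m by simp
  finally show "\<exists>y\<in>dyadic_times T. dist y t < e" using mem by blast
qed

lemma infinite_or_card_ge_iff:
  "infinite S \<or> n \<le> card S \<longleftrightarrow> (\<exists>F. finite F \<and> F \<subseteq> S \<and> card F = n)"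
proof
  assume "infinite S \<or> n \<le> card S"
  then show "\<exists>F. finite F \<and> F \<subseteq> S \<and> card F = n"
    using infinite_arbitrarily_large[of S n] obtain_subset_with_card_n[of n S] by metis
next
  assume "\<exists>F. finite F \<and> F \<subseteq> S \<and> card F = n"
  then show "infinite S \<or> n \<le> card S" using card_mono by blast
qed

text \<open>Because only finitely many points enter the closed disc, the times at which at least \<open>N\<close>
  points are in it form a closed set, so it suffices to look at a dense set of times.\<close>

lemma at_least_points_dyadic_times:
  fixes X :: "'i \<Rightarrow> real \<Rightarrow> complex"
  assumes T: "0 < T" and cont: "\<And>i. i \<in> I \<Longrightarrow> continuous_on {0..} (X i)"
    and fin: "finite {i \<in> I. \<exists>t\<in>dyadic_times T. X i t \<in> cball 0 R}"
    and ev: "\<And>t. t \<in> dyadic_times T \<Longrightarrow> \<exists>F. finite F \<and> F \<subseteq> I \<and> card F = N \<and> (\<forall>i\<in>F. X i t \<in> cball 0 R)"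
    and t: "t \<in> {0..T}"
  shows "\<exists>F. finite F \<and> F \<subseteq> I \<and> card F = N \<and> (\<forall>i\<in>F. X i t \<in> cball 0 R)"
proof -
  define J where "J = {i \<in> I. \<exists>t\<in>dyadic_times T. X i t \<in> cball 0 R}"
  define K where "K = (\<Union>F\<in>{F. F \<subseteq> J \<and> card F = N}. {0..T} \<inter> (\<Inter>i\<in>F. {0..T} \<inter> X i -` cball 0 R))"
  have J: "finite J" "J \<subseteq> I" using fin by (auto simp: J_def)
  have "closed K"
    unfolding K_def
  proof (intro closed_UN ballI)
    show "finite {F. F \<subseteq> J \<and> card F = N}" using J by simp
    fix F assume "F \<in> {F. F \<subseteq> J \<and> card F = N}"
    then have "F \<subseteq> I" using J by auto
    have "closed ({0..T} \<inter> X i -` cball 0 R)" if "i \<in> F" for i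
      using continuous_on_subset[OF cont[of i], of "{0..T}"] that \<open>F \<subseteq> I\<close>
      by (intro continuous_closed_preimage) auto
    then show "closed ({0..T} \<inter> (\<Inter>i\<in>F. {0..T} \<inter> X i -` cball 0 R))" by (intro closed_Int closed_INT) auto
  qed
  moreover have "dyadic_times T \<subseteq> K"
  proof
    fix s assume s: "s \<in> dyadic_times T"
    from ev[OF s] obtain F where F: "F \<subseteq> I" "card F = N" "\<forall>i\<in>F. X i s \<in> cball 0 R" by blast
    moreover have "F \<subseteq> J" using F s by (auto simp: J_def)
    moreover have "s \<in> {0..T}" using dyadic_times_subset[of T] T s by auto
    ultimately show "s \<in> K" unfolding K_def by blast
  qed
  ultimately have "closure (dyadic_times T) \<subseteq> K" by (rule closure_minimal[rotated])
  then have "t \<in> K" using closure_dyadic_times[OF T t] by blast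
  then obtain F where F: "F \<subseteq> J" "card F = N" "t \<in> (\<Inter>i\<in>F. {0..T} \<inter> X i -` cball 0 R)"
    unfolding K_def by blast
  have "\<forall>i\<in>F. X i t \<in> cball 0 R" using F(3) by blast
  moreover have "finite F" "F \<subseteq> I" using F(1) J finite_subset by auto
  ultimately show ?thesis using F(2) by blast
qed

text \<open>Read at dyadic times, and with the count expressed by a set of \<open>N\<close> indices,
  the event becomes a measurable set \<open>D\<close>. The true event is always contained in
  \<open>D\<close> and almost surely contains it, so it is measurable for the completion and has the
  same probability.\<close>

lemma measure_at_least_points_ge:
  fixes X :: "'i \<Rightarrow> real \<Rightarrow> 'w \<Rightarrow> complex"
  assumes M: "prob_space M" and I: "countable I" and T: "0 < T"
    and meas: "\<And>i t. i \<in> I \<Longrightarrow> 0 \<le> t \<Longrightarrow> X i t \<in> borel_measurable M"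
    and cont: "\<And>i. i \<in> I \<Longrightarrow> AE \<omega> in M. continuous_on {0..} (\<lambda>t. X i t \<omega>)"
    and fin: "AE \<omega> in M. finite {i \<in> I. \<exists>t\<in>dyadic_times T. X i t \<omega> \<in> cball 0 R}"
    and F: "finite F" "F \<subseteq> I" "card F = N"
  shows "measure M {\<omega> \<in> space M. \<forall>i\<in>F. \<forall>t\<in>dyadic_times T. X i t \<omega> \<in> cball 0 R}
    \<le> measure (completion M) (at_least_points_event M I X T R N)"
proof -
  interpret prob_space M by (rule M)
  interpret c: prob_space "completion M" by (rule prob_space_completion)
  define E where "E = at_least_points_event M I X T R N"
  have E_eq: "E = {\<omega> \<in> space M. \<forall>t\<in>{0..T}. \<exists>F. finite F \<and> F \<subseteq> I \<and> card F = N \<and> (\<forall>i\<in>F. X i t \<omega> \<in> cball 0 R)}"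
    unfolding E_def at_least_points_event_def infinite_or_card_ge_iff by (intro Collect_cong conj_cong ball_cong refl) blast
  define FF where "FF = {F. F \<in> {F. finite F \<and> F \<subseteq> I} \<and> card F = N}"
  define D where "D = {\<omega> \<in> space M. \<forall>t\<in>dyadic_times T. \<exists>F\<in>FF. \<forall>i\<in>F. X i t \<omega> \<in> cball 0 R}"
  have dy: "t \<in> dyadic_times T \<Longrightarrow> t \<in> {0..T}" for t using dyadic_times_subset[of T] T by auto
  have "countable FF" unfolding FF_def
    by (rule countable_subset[OF _ countable_Collect_finite_subset[OF I]]) auto
  then have D_sets: "D \<in> sets M"
    unfolding D_def
  proof (intro sets.sets_Collect_countable_All'[OF _ countable_dyadic_times] sets.sets_Collect_countable_Ex')
    fix t G assume t: "t \<in> dyadic_times T" and G: "G \<in> FF"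
    show "{\<omega> \<in> space M. \<forall>i\<in>G. X i t \<omega> \<in> cball 0 R} \<in> sets M"
    proof (rule countable_ball_event)
      show "countable G" using G I by (auto simp: FF_def intro: countable_subset)
      show "X i t \<in> borel_measurable M" if "i \<in> G" for i
        using that t G dy[OF t] by (intro meas) (auto simp: FF_def)
    qed auto
  qed
  have "AE \<omega> in M. \<forall>i\<in>I. continuous_on {0..} (\<lambda>t. X i t \<omega>)"
    using cont I by (simp add: AE_ball_countable)
  then have "AE \<omega> in M. \<omega> \<in> D \<longrightarrow> \<omega> \<in> E"
    using fin
  proof eventually_elim
    case (elim \<omega>)
    show ?case
    proof
      assume \<omega>: "\<omega> \<in> D"
      have "\<exists>F. finite F \<and> F \<subseteq> I \<and> card F = N \<and> (\<forall>i\<in>F. X i t \<omega> \<in> cball 0 R)" if "t \<in> {0..T}" for t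
        using T _ elim(2) _ that
      proof (rule at_least_points_dyadic_times)
        show "continuous_on {0..} (\<lambda>t. X i t \<omega>)" if "i \<in> I" for i using elim(1) that by blast
        show "\<exists>F. finite F \<and> F \<subseteq> I \<and> card F = N \<and> (\<forall>i\<in>F. X i t \<omega> \<in> cball 0 R)" if "t \<in> dyadic_times T" for t
          using \<omega> that unfolding D_def FF_def by blast
      qed
      then show "\<omega> \<in> E" unfolding E_eq using \<omega> unfolding D_def by blast
    qed
  qed
  then obtain N' where N': "N' \<in> null_sets M" "{\<omega> \<in> space M. \<not> (\<omega> \<in> D \<longrightarrow> \<omega> \<in> E)} \<subseteq> N'"
    unfolding eventually_ae_filter by blast
  have ED: "E \<subseteq> D"
  proof
    fix \<omega> assume "\<omega> \<in> E"
    then show "\<omega> \<in> D" unfolding E_eq D_def FF_def using dy by blast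
  qed
  have D_space: "D \<subseteq> space M" by (auto simp: D_def)
  have "E = (D - N') \<union> (E \<inter> N')" using N' ED D_space by blast
  then have E_sets: "E \<in> sets (completion M)"
    using N' D_sets by (intro sets_completionI[of E "D - N'" "E \<inter> N'" N' M]) auto
  have "measure M {\<omega> \<in> space M. \<forall>i\<in>F. \<forall>t\<in>dyadic_times T. X i t \<omega> \<in> cball 0 R} \<le> measure M D"
  proof (rule finite_measure_mono[OF _ D_sets])
    have "F \<in> FF" using F by (auto simp: FF_def)
    then show "{\<omega> \<in> space M. \<forall>i\<in>F. \<forall>t\<in>dyadic_times T. X i t \<omega> \<in> cball 0 R} \<subseteq> D"
      unfolding D_def by blast
  qed
  also have "\<dots> = measure M (D - N')" using N' D_sets by (simp add: measure_Diff_null_set)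
  also have "\<dots> = measure (completion M) (D - N')" using N' D_sets by (subst measure_completion) auto
  also have "\<dots> \<le> measure (completion M) E"
    using N' D_space by (intro c.finite_measure_mono E_sets) blast
  finally show ?thesis by (simp add: E_def)
qed

text \<open>\<open>ln q / T\<close> tends to 0, so a factor that does not depend on \<open>T\<close>
  leaves no trace in the rate. Positivity of \<open>q\<close> keeps \<open>log_prob\<close>
  finite.\<close>

lemma persistence_rate_ge:
  assumes q: "0 < q" and lower: "\<And>T. 0 < T \<Longrightarrow>
    q * exp (- T * \<Lambda>) \<le> measure (completion M) (at_least_points_event M I X T R N)"
  shows "ereal (- \<Lambda>) \<le> persistence_rate M I X R N"
proof -
  have lim: "((\<lambda>T::real. ereal (1 / T * ln q - \<Lambda>)) \<longlongrightarrow> ereal (- \<Lambda>)) at_top"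
  proof -
    have "((\<lambda>T::real. 1 / T) \<longlongrightarrow> 0) at_top"
      using tendsto_inverse_0_at_top[OF filterlim_ident] by (simp add: inverse_eq_divide)
    then have "((\<lambda>T::real. 1 / T * ln q - \<Lambda>) \<longlongrightarrow> 0 * ln q - \<Lambda>) at_top"
      by (intro tendsto_intros)
    then show ?thesis by (simp add: tendsto_ereal)
  qed
  have "ereal (- \<Lambda>) = Liminf at_top (\<lambda>T::real. ereal (1 / T * ln q - \<Lambda>))"
    using lim_imp_Liminf[OF _ lim] by simp
  also have "\<dots> \<le> persistence_rate M I X R N"
    unfolding persistence_rate_def
  proof (rule Liminf_mono)
    show "\<forall>\<^sub>F T in at_top. ereal (1 / T * ln q - \<Lambda>)
      \<le> ereal (1 / T) * log_prob (measure (completion M) (at_least_points_event M I X T R N))"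
      using eventually_gt_at_top[of 0]
    proof eventually_elim
      case (elim T)
      let ?m = "measure (completion M) (at_least_points_event M I X T R N)"
      have m: "0 < ?m" using lower[OF elim] q by (metis exp_gt_zero less_le_trans mult_pos_pos)
      have "ln q - T * \<Lambda> = ln (q * exp (- T * \<Lambda>))" using q by (simp add: ln_mult)
      also have "\<dots> \<le> ln ?m" using lower[OF elim] q m by (subst ln_le_cancel_iff) auto
      finally have "1 / T * (ln q - T * \<Lambda>) \<le> 1 / T * ln ?m" using elim by (intro mult_left_mono) auto
      then show ?case using m elim by (simp add: log_prob_def right_diff_distrib)
    qed
  qed
  finally show ?thesis .
qed

lemma indep_traj_family:
  assumes M: "prob_space M" and ind: "prob_space.indep_vars M (\<lambda>_. traj_space) (\<lambda>i. traj (X i)) UNIV"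
    and F: "finite F" "F \<noteq> {}" and D: "countable D" "D \<subseteq> {0..}" and C: "\<And>i t. C i t \<in> sets borel"
  shows "measure M {\<omega> \<in> space M. \<forall>i\<in>F. \<forall>t\<in>D. X i t \<omega> \<in> C i t} =
    (\<Prod>i\<in>F. measure M {\<omega> \<in> space M. \<forall>t\<in>D. X i t \<omega> \<in> C i t})"
proof -
  interpret prob_space M by (rule M)
  have "prob (\<Inter>i\<in>F. traj (X i) -` {x \<in> space traj_space. \<forall>t\<in>D. x t \<in> C i t} \<inter> space M) =
    (\<Prod>i\<in>F. prob (traj (X i) -` {x \<in> space traj_space. \<forall>t\<in>D. x t \<in> C i t} \<inter> space M))"
    using F by (intro indep_varsD[OF ind] traj_event D C) auto
  moreover have "(\<Inter>i\<in>F. {\<omega> \<in> space M. \<forall>t\<in>D. X i t \<omega> \<in> C i t}) = {\<omega> \<in> space M. \<forall>i\<in>F. \<forall>t\<in>D. X i t \<omega> \<in> C i t}"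
    using F by blast
  ultimately show ?thesis unfolding traj_vimage[OF D(2)] by simp
qed

text \<open>The Borel-Cantelli lemma for an index type without a preferred order: a common bound for
  finite sums stands for summability, and the events are moved to the natural numbers, with empty
  ones outside the range of \<open>to_nat\<close>.\<close>

lemma AE_finite_of_bounded_sums:
  fixes A :: "'i::countable \<Rightarrow> 'w set"
  assumes M: "prob_space M" and A: "\<And>i. A i \<in> sets M"
    and bound: "\<And>F. finite F \<Longrightarrow> (\<Sum>i\<in>F. measure M (A i)) \<le> C"
  shows "AE \<omega> in M. finite {i. \<omega> \<in> A i}"
proof -
  interpret prob_space M by (rule M)
  define A' where "A' n = (if n \<in> range (to_nat :: 'i \<Rightarrow> nat) then A (from_nat n) else {})" for n
  have "summable (\<lambda>n. measure M (A' n))"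
  proof (rule summableI_nonneg_bounded[where x = C])
    fix k
    let ?F = "{i :: 'i. to_nat i < k}"
    have inj: "inj_on (to_nat :: 'i \<Rightarrow> nat) ?F" by (auto simp: inj_on_def)
    have F: "finite ?F"
      by (rule finite_imageD[OF _ inj]) (auto intro: finite_subset[of _ "{..<k}"])
    have "(\<Sum>n<k. measure M (A' n)) = (\<Sum>n\<in>to_nat ` ?F. measure M (A' n))"
      by (rule sum.mono_neutral_right) (auto simp: A'_def)
    also have "\<dots> = (\<Sum>i\<in>?F. measure M (A i))"
      by (subst sum.reindex[OF inj]) (simp add: A'_def)
    finally show "(\<Sum>n<k. measure M (A' n)) \<le> C" using bound[OF F] by simp
  qed auto
  then have "AE \<omega> in M. eventually (\<lambda>n. \<omega> \<in> space M - A' n) sequentially"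
    by (intro borel_cantelli_AE1) (auto simp: A'_def A emeasure_eq_measure)
  then show ?thesis
  proof eventually_elim
    case (elim \<omega>)
    then obtain k where k: "\<And>n. k \<le> n \<Longrightarrow> \<omega> \<notin> A' n" by (auto simp: eventually_sequentially)
    have "to_nat ` {i. \<omega> \<in> A i} \<subseteq> {..<k}"
    proof (rule image_subsetI)
      fix i assume "i \<in> {i. \<omega> \<in> A i}"
      then have "\<omega> \<in> A' (to_nat i)" by (simp add: A'_def)
      then show "to_nat i \<in> {..<k}" using k not_less by auto
    qed
    then have "finite (to_nat ` {i. \<omega> \<in> A i})" by (rule finite_subset) simp
    then show ?case by (rule finite_imageD) simp
  qed
qed

lemma cosh_ge_half_exp: "exp a / 2 \<le> cosh (a::real)"
  by (simp add: cosh_field_def)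

lemma inverse_cosh_le: "1 / cosh a \<le> 2 * exp (- (a::real))"
proof -
  have "1 / cosh a \<le> 1 / (exp a / 2)" using cosh_ge_half_exp[of a] by (intro divide_left_mono) auto
  then show ?thesis by (simp add: exp_minus field_simps)
qed

section \<open>Lattice models\<close>

lemma sum_geometric_int_le:
  fixes q :: real
  assumes q: "0 \<le> q" "q < 1"
  shows "(\<Sum>k\<in>{- int n..int n}. q ^ nat \<bar>k\<bar>) \<le> 2 / (1 - q)"
proof -
  have "(\<Sum>k\<in>{- int n..int n}. q ^ nat \<bar>k\<bar>) \<le> 2 * (\<Sum>j<Suc n. q ^ j)"
  proof (induction n)
    case (Suc n)
    have eq: "{- int (Suc n)..int (Suc n)} = insert (int (Suc n)) (insert (- int (Suc n)) {- int n..int n})"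
      by auto
    have notin: "int (Suc n) \<notin> insert (- int (Suc n)) {- int n..int n}" "- int (Suc n) \<notin> {- int n..int n}"
      by auto
    define f where "f k = q ^ nat \<bar>k\<bar>" for k :: int
    have "f (int (Suc n)) = q ^ Suc n" "f (- int (Suc n)) = q ^ Suc n"
      unfolding f_def by (simp_all only: abs_minus_cancel abs_of_nat nat_int)
    then have "sum f {- int (Suc n)..int (Suc n)} = 2 * q ^ Suc n + sum f {- int n..int n}"
      unfolding eq using sum.insert[OF _ notin(1), of f] sum.insert[OF _ notin(2), of f] by simp
    moreover have "sum f {- int n..int n} \<le> 2 * (\<Sum>j<Suc n. q ^ j)"
      using Suc by (simp only: f_def[abs_def])
    ultimately have "sum f {- int (Suc n)..int (Suc n)} \<le> 2 * (\<Sum>j<Suc (Suc n). q ^ j)"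
      by (subst sum.lessThan_Suc) (simp add: distrib_left)
    then show ?case by (simp only: f_def[abs_def])
  qed simp
  also have "\<dots> = 2 * ((1 - q ^ Suc n) / (1 - q))"
    using q by (subst sum_gp_strict) simp
  also have "\<dots> \<le> 2 * (1 / (1 - q))"
    using q by (intro mult_left_mono divide_right_mono) auto
  finally show ?thesis by simp
qed

lemma sum_geometric_int2_le:
  fixes q :: real
  assumes q: "0 \<le> q" "q < 1" and F: "finite F"
  shows "(\<Sum>(k, l)\<in>F. q ^ nat \<bar>k\<bar> * q ^ nat \<bar>l\<bar>) \<le> (2 / (1 - q))\<^sup>2"
proof -
  define B where "B = Max (abs ` (fst ` F \<union> snd ` F))"
  have B: "\<bar>k\<bar> \<le> B" if "k \<in> fst ` F \<union> snd ` F" for k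
    unfolding B_def using that F by (intro Max_ge) auto
  define n where "n = nat \<bar>B\<bar>"
  let ?I = "{- int n..int n}"
  have "F \<subseteq> ?I \<times> ?I"
  proof
    fix x assume "x \<in> F"
    then have "\<bar>fst x\<bar> \<le> B" "\<bar>snd x\<bar> \<le> B" by (intro B UnI1 UnI2 imageI; assumption)+
    then have "fst x \<in> ?I" "snd x \<in> ?I" by (simp_all add: n_def abs_le_iff)
    then show "x \<in> ?I \<times> ?I" by (simp add: mem_Times_iff)
  qed
  then have "(\<Sum>(k, l)\<in>F. q ^ nat \<bar>k\<bar> * q ^ nat \<bar>l\<bar>) \<le> (\<Sum>(k, l)\<in>?I \<times> ?I. q ^ nat \<bar>k\<bar> * q ^ nat \<bar>l\<bar>)"
    using q by (intro sum_mono2) auto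
  also have "\<dots> = (\<Sum>k\<in>?I. q ^ nat \<bar>k\<bar>) * (\<Sum>k\<in>?I. q ^ nat \<bar>k\<bar>)"
    by (simp add: sum_product sum.cartesian_product)
  also have "\<dots> \<le> 2 / (1 - q) * (2 / (1 - q))"
    using q by (intro mult_mono sum_geometric_int_le sum_nonneg) auto
  finally show ?thesis by (simp add: power2_eq_square)
qed

text \<open>For a site to send a point into the disc, its process must leave a disc whose radius
  grows linearly with the distance of the site. The probability of this decays exponentially and is
  summable over the lattice.\<close>

lemma iid_OU_family_far_finite:
  assumes iid: "iid_OU_family M \<zeta>" and \<alpha>: "0 < \<alpha>" and c: "0 < c" and T: "0 < T"
  shows "AE \<omega> in M. finite {(k, l). \<exists>t\<in>dyadic_times T. \<alpha> * cmod (of_int k + \<i> * of_int l) \<le> R + c * cmod (\<zeta> (k, l) t \<omega>)}"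
proof -
  interpret prob_space M using iid by (simp add: iid_OU_family_def)
  have Z: "complex_OU M (\<zeta> kl)" for kl using iid unfolding iid_OU_family_def by blast
  \<comment> \<open>The subtracted 1 gives strictness: a point that enters forces its process
    outside the closed disc of radius \<open>a kl\<close>.\<close>
  define a where "a kl = (\<alpha> * cmod (of_int (fst kl) + \<i> * of_int (snd kl)) - R - 1) / c" for kl :: "int \<times> int"
  define S where "S kl = {\<omega> \<in> space M. \<forall>t\<in>dyadic_times T. \<zeta> kl t \<omega> \<in> cball 0 (a kl)}" for kl
  have S: "S kl \<in> sets M" for kl
    unfolding S_def using complex_OU_measurable[OF Z[of kl]] dyadic_times_subset[of T] T
    by (intro countable_ball_event countable_dyadic_times) auto
  \<comment> \<open>The 4 is 2 for the coordinates times 2 from \<open>inverse_cosh_le\<close>. The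
    added 1 covers the sites with negative \<open>a\<close>, for which the bound exceeds 1
    anyway.\<close>
  define K where "K = (4 * exp (exp T / 2) + 1) * exp ((R + 1) / c)"
  \<comment> \<open>The exponent is halved because the modulus is bounded below by half of
    \<open>\<bar>k\<bar> + \<bar>l\<bar>\<close>.\<close>
  define q where "q = exp (- (\<alpha> / (2 * c)))"
  have K: "0 \<le> K" by (simp add: K_def)
  have q: "0 \<le> q" "q < 1" using \<alpha> c by (auto simp: q_def)
  have tail: "measure M (space M - S (k, l)) \<le> K * (q ^ nat \<bar>k\<bar> * q ^ nat \<bar>l\<bar>)" for k l
  proof -
    have "measure M (space M - S (k, l)) \<le> (4 * exp (exp T / 2) + 1) * exp (- a (k, l))"
    proof (cases "0 \<le> a (k, l)")
      case True
      have "measure M (space M - S (k, l)) \<le> 2 * (exp (exp T / 2) / cosh (a (k, l)))"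
        using complex_OU_max[OF Z T True, of "(k, l)"] unfolding prob_compl[OF S] by (simp add: S_def)
      also have "\<dots> \<le> 2 * (exp (exp T / 2) * (2 * exp (- a (k, l))))"
        using inverse_cosh_le[of "a (k, l)"]
        by (simp only: divide_inverse mult_1) (intro mult_left_mono; simp)
      also have "\<dots> \<le> (4 * exp (exp T / 2) + 1) * exp (- a (k, l))" by (simp add: algebra_simps)
      finally show ?thesis .
    next
      case False
      then have "1 * 1 \<le> (4 * exp (exp T / 2) + 1) * exp (- a (k, l))" by (intro mult_mono) auto
      then show ?thesis by (intro order_trans[OF prob_le_1]) simp
    qed
    also have "\<dots> \<le> (4 * exp (exp T / 2) + 1) * (exp ((R + 1) / c) * (q ^ nat \<bar>k\<bar> * q ^ nat \<bar>l\<bar>))"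
    proof (intro mult_left_mono)
      let ?w = "cmod (of_int k + \<i> * of_int l)"
      have "\<bar>real_of_int k\<bar> \<le> ?w" using abs_Re_le_cmod[of "of_int k + \<i> * of_int l"] by simp
      moreover have "\<bar>real_of_int l\<bar> \<le> ?w" using abs_Im_le_cmod[of "of_int k + \<i> * of_int l"] by simp
      ultimately have *: "\<alpha> / (2 * c) * (\<bar>real_of_int k\<bar> + \<bar>real_of_int l\<bar>) \<le> \<alpha> / (2 * c) * (2 * ?w)"
        using \<alpha> c by (intro mult_left_mono) auto
      have "- a (k, l) \<le> (R + 1) / c + (- (\<alpha> / (2 * c)) * \<bar>real_of_int k\<bar> + - (\<alpha> / (2 * c)) * \<bar>real_of_int l\<bar>)"
      proof -
        have "- a (k, l) = (R + 1) / c - \<alpha> / (2 * c) * (2 * ?w)"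
          using c by (simp add: a_def field_simps)
        with * show ?thesis unfolding distrib_left by linarith
      qed
      then have "exp (- a (k, l)) \<le> exp ((R + 1) / c) * (exp (- (\<alpha> / (2 * c)) * \<bar>real_of_int k\<bar>) * exp (- (\<alpha> / (2 * c)) * \<bar>real_of_int l\<bar>))"
        by (simp flip: exp_add)
      moreover have "exp (- (\<alpha> / (2 * c)) * \<bar>real_of_int j\<bar>) = q ^ nat \<bar>j\<bar>" for j
        by (simp add: q_def exp_of_nat_mult[symmetric] mult.commute)
      ultimately show "exp (- a (k, l)) \<le> exp ((R + 1) / c) * (q ^ nat \<bar>k\<bar> * q ^ nat \<bar>l\<bar>)" by simp
    qed auto
    finally show ?thesis by (simp add: K_def)
  qed
  have "AE \<omega> in M. finite {kl. \<omega> \<in> space M - S kl}"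
  proof (rule AE_finite_of_bounded_sums[where C = "K * (2 / (1 - q))\<^sup>2"])
    fix F :: "(int \<times> int) set" assume F: "finite F"
    have "(\<Sum>kl\<in>F. measure M (space M - S kl)) \<le> (\<Sum>(k, l)\<in>F. K * (q ^ nat \<bar>k\<bar> * q ^ nat \<bar>l\<bar>))"
      using tail by (intro sum_mono) auto
    also have "\<dots> = K * (\<Sum>(k, l)\<in>F. q ^ nat \<bar>k\<bar> * q ^ nat \<bar>l\<bar>)"
      by (simp add: sum_distrib_left case_prod_unfold)
    also have "\<dots> \<le> K * (2 / (1 - q))\<^sup>2"
      by (intro mult_left_mono sum_geometric_int2_le q F K)
    finally show "(\<Sum>kl\<in>F. measure M (space M - S kl)) \<le> K * (2 / (1 - q))\<^sup>2" .
  qed (use S in \<open>auto intro: prob_space_axioms\<close>)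
  then show ?thesis
    using AE_space
  proof eventually_elim
    case (elim \<omega>)
    have "(k, l) \<in> {kl. \<omega> \<in> space M - S kl}"
      if t: "t \<in> dyadic_times T" and far: "\<alpha> * cmod (of_int k + \<i> * of_int l) \<le> R + c * cmod (\<zeta> (k, l) t \<omega>)" for k l t
    proof -
      have "a (k, l) * c < cmod (\<zeta> (k, l) t \<omega>) * c" using far c by (simp add: a_def mult.commute)
      then have "\<zeta> (k, l) t \<omega> \<notin> cball 0 (a (k, l))" using c by (simp add: mult_less_cancel_right)
      then show ?thesis using t elim by (auto simp: S_def)
    qed
    then show ?case using elim(1) by (rule_tac finite_subset[OF _ elim(1)]) blast
  qed
qed

text \<open>The sites come from a square whose side is \<open>sqrt N\<close> rounded up, hence at
  most \<open>2 * sqrt N\<close>; each of the two squared coordinates is at most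
  \<open>4 * N\<close>.\<close>

lemma exists_lattice_points:
  assumes N: "1 \<le> N"
  shows "\<exists>F :: (int \<times> int) set. finite F \<and> card F = N \<and> (\<forall>(k, l)\<in>F. (real_of_int k)\<^sup>2 + (real_of_int l)\<^sup>2 \<le> 8 * real N)"
proof -
  define m where "m = nat \<lceil>sqrt (real N)\<rceil>"
  have s1: "1 \<le> sqrt (real N)" using N by simp
  have m: "sqrt (real N) \<le> real m" "real m \<le> 2 * sqrt (real N)" using s1 unfolding m_def by linarith+
  have "(sqrt (real N))\<^sup>2 \<le> (real m)\<^sup>2" using m by (intro power_mono) auto
  then have Nm: "N \<le> m * m" by (simp add: power2_eq_square flip: of_nat_mult)
  have "(real m)\<^sup>2 \<le> (2 * sqrt (real N))\<^sup>2" using m by (intro power_mono) auto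
  then have mN: "(real m)\<^sup>2 \<le> 4 * real N" by (simp add: power_mult_distrib)
  have "N \<le> card ({0..<int m} \<times> {0..<int m})" using Nm by simp
  then obtain F where F: "F \<subseteq> {0..<int m} \<times> {0..<int m}" "card F = N" "finite F"
    by (rule obtain_subset_with_card_n)
  have "(real_of_int k)\<^sup>2 + (real_of_int l)\<^sup>2 \<le> 8 * real N" if "(k, l) \<in> F" for k l
  proof -
    have "(k, l) \<in> {0..<int m} \<times> {0..<int m}" using F(1) that by blast
    then have "0 \<le> real_of_int k" "real_of_int k \<le> real m" "0 \<le> real_of_int l" "real_of_int l \<le> real m" by auto
    then have "(real_of_int k)\<^sup>2 \<le> (real m)\<^sup>2" "(real_of_int l)\<^sup>2 \<le> (real m)\<^sup>2"
      by (simp_all only: power_mono)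
    then show ?thesis using mN by linarith
  qed
  then have "\<forall>(k, l)\<in>F. (real_of_int k)\<^sup>2 + (real_of_int l)\<^sup>2 \<le> 8 * real N" by auto
  then show ?thesis using F(2,3) by (intro exI[of _ F] conjI)
qed

text \<open>Splitting the mixed term \<open>\<bar>y\<bar> * r / 2\<close> into squares leaves the
  centre only through \<open>y\<^sup>2\<close>, which adds up to a squared modulus over the two
  coordinates.\<close>

lemma ou_rate_le: "ou_rate r y \<le> 8 / r\<^sup>2 + r\<^sup>2 / 4 + 3 / 4 * y\<^sup>2"
proof -
  have "0 \<le> (\<bar>y\<bar> - r)\<^sup>2" by simp
  then have "2 * (\<bar>y\<bar> * r) \<le> y\<^sup>2 + r\<^sup>2" by (simp add: power2_diff)
  then show ?thesis by (simp add: ou_rate_def algebra_simps power2_eq_square)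
qed

text \<open>The first two terms are the part of \<open>ou_rate_le\<close> without \<open>y\<close>,
  at radius \<open>R / c\<close>, for two coordinates. The 12 is 3 / 4 from
  \<open>ou_rate_le\<close>, times 2 from the normalisation by \<open>sqrt 2\<close>, times 8 from
  \<open>exists_lattice_points\<close>. One site costs at most \<open>a + b * N\<close>, so
  \<open>N\<close> sites cost at most \<open>(a + b) * N\<^sup>2\<close>.\<close>

definition lattice_rate :: "real \<Rightarrow> real \<Rightarrow> real \<Rightarrow> real" where
  "lattice_rate \<alpha> c R = 16 / (R / c)\<^sup>2 + (R / c)\<^sup>2 / 2 + 12 * \<alpha>\<^sup>2 / c\<^sup>2"

text \<open>The ball is the set of values of the process for which the unrotated point of the site
  lies in the disc of radius \<open>R\<close>. Independence of the sites adds their rates.\<close>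

lemma iid_OU_family_stay:
  assumes iid: "iid_OU_family M \<zeta>" and \<alpha>: "0 < \<alpha>" and c: "0 < c" and R: "0 < R"
    and F: "finite F" "card F = N" "\<forall>(k, l)\<in>F. (real_of_int k)\<^sup>2 + (real_of_int l)\<^sup>2 \<le> 8 * real N"
    and N: "1 \<le> N"
  shows "\<exists>q>0. \<forall>T>0. q * exp (- T * (lattice_rate \<alpha> c R * (real N)\<^sup>2)) \<le>
    measure M {\<omega> \<in> space M. \<forall>kl\<in>F. \<forall>t\<in>dyadic_times T.
      \<zeta> kl t \<omega> \<in> cball (- (of_real \<alpha> * (of_int (fst kl) + \<i> * of_int (snd kl)) / of_real c)) (R / c)}"
proof -
  interpret prob_space M using iid by (simp add: iid_OU_family_def)
  have Z: "complex_OU M (\<zeta> kl)" for kl using iid unfolding iid_OU_family_def by blast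
  have ind: "indep_vars (\<lambda>_. traj_space) (\<lambda>kl. traj (\<zeta> kl)) UNIV" using iid by (simp add: iid_OU_family_def)
  define z where "z kl = - (of_real \<alpha> * (of_int (fst kl) + \<i> * of_int (snd kl)) / of_real c)" for kl :: "int \<times> int"
  define \<Lambda> where "\<Lambda> kl = ou_rate (R / c) (sqrt 2 * Re (z kl)) + ou_rate (R / c) (sqrt 2 * Im (z kl))" for kl
  have \<rho>: "0 < R / c" using R c by simp
  have ex: "\<exists>q. 0 < q \<and> (\<forall>T>0. q * exp (- T * \<Lambda> kl) \<le> measure M {\<omega> \<in> space M. \<forall>t\<in>dyadic_times T. \<zeta> kl t \<omega> \<in> cball (z kl) (R / c)})" for kl
    unfolding \<Lambda>_def using complex_OU_stay[OF \<rho>, of "z kl"] Z[of kl] by blast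
  have "\<exists>q. \<forall>kl. 0 < q kl \<and> (\<forall>T>0. q kl * exp (- T * \<Lambda> kl) \<le> measure M {\<omega> \<in> space M. \<forall>t\<in>dyadic_times T. \<zeta> kl t \<omega> \<in> cball (z kl) (R / c)})"
    by (intro choice allI ex)
  then obtain q where q: "\<And>kl. 0 < q kl" and stay: "\<And>kl T. 0 < T \<Longrightarrow>
    q kl * exp (- T * \<Lambda> kl) \<le> measure M {\<omega> \<in> space M. \<forall>t\<in>dyadic_times T. \<zeta> kl t \<omega> \<in> cball (z kl) (R / c)}"
    by blast
  define a where "a = 16 / (R / c)\<^sup>2 + (R / c)\<^sup>2 / 2"
  define b where "b = 12 * \<alpha>\<^sup>2 / c\<^sup>2"
  have "\<Lambda> kl \<le> a + b * real N" if "kl \<in> F" for kl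
  proof -
    obtain k l where kl: "kl = (k, l)" by fastforce
    have "\<Lambda> kl \<le> 2 * (8 / (R / c)\<^sup>2 + (R / c)\<^sup>2 / 4) + 3 / 4 * ((sqrt 2 * Re (z kl))\<^sup>2 + (sqrt 2 * Im (z kl))\<^sup>2)"
      unfolding \<Lambda>_def using ou_rate_le[of "R / c" "sqrt 2 * Re (z kl)"] ou_rate_le[of "R / c" "sqrt 2 * Im (z kl)"]
      by (simp add: distrib_left)
    also have "(sqrt 2 * Re (z kl))\<^sup>2 + (sqrt 2 * Im (z kl))\<^sup>2 = 2 * (\<alpha>\<^sup>2 / c\<^sup>2) * ((real_of_int k)\<^sup>2 + (real_of_int l)\<^sup>2)"
      by (simp add: z_def kl power_mult_distrib power_divide algebra_simps add_divide_distrib)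
    also have "3 / 4 * (2 * (\<alpha>\<^sup>2 / c\<^sup>2) * ((real_of_int k)\<^sup>2 + (real_of_int l)\<^sup>2)) \<le> 3 / 4 * (2 * (\<alpha>\<^sup>2 / c\<^sup>2) * (8 * real N))"
      using F that kl by (intro mult_left_mono) auto
    finally show ?thesis by (simp add: a_def b_def mult_ac)
  qed
  then have "sum \<Lambda> F \<le> (\<Sum>kl\<in>F. a + b * real N)" by (rule sum_mono)
  also have "\<dots> = a * real N + b * (real N * real N)" using F by (simp add: algebra_simps)
  also have "\<dots> \<le> a * (real N * real N) + b * (real N * real N)"
    using N mult_left_mono[of 1 "real N" "real N"] by (intro add_right_mono mult_left_mono) (auto simp: a_def)
  finally have sum\<Lambda>: "sum \<Lambda> F \<le> lattice_rate \<alpha> c R * (real N)\<^sup>2"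
    by (simp add: lattice_rate_def a_def b_def power2_eq_square algebra_simps)
  have "prod q F * exp (- T * (lattice_rate \<alpha> c R * (real N)\<^sup>2)) \<le>
      measure M {\<omega> \<in> space M. \<forall>kl\<in>F. \<forall>t\<in>dyadic_times T. \<zeta> kl t \<omega> \<in> cball (z kl) (R / c)}" if T: "0 < T" for T
  proof -
    have "prod q F * exp (- T * (lattice_rate \<alpha> c R * (real N)\<^sup>2)) \<le> prod q F * exp (- T * sum \<Lambda> F)"
      using sum\<Lambda> T q by (intro mult_left_mono) (auto intro!: prod_nonneg less_imp_le[OF q])
    also have "\<dots> = (\<Prod>kl\<in>F. q kl * exp (- T * \<Lambda> kl))"
      using F by (simp add: prod.distrib exp_sum sum_distrib_left sum_negf flip: exp_sum)
    also have "\<dots> \<le> (\<Prod>kl\<in>F. measure M {\<omega> \<in> space M. \<forall>t\<in>dyadic_times T. \<zeta> kl t \<omega> \<in> cball (z kl) (R / c)})"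
      using stay[OF T] q by (intro prod_mono) (auto intro!: mult_nonneg_nonneg less_imp_le[OF q])
    also have "\<dots> = measure M {\<omega> \<in> space M. \<forall>kl\<in>F. \<forall>t\<in>dyadic_times T. \<zeta> kl t \<omega> \<in> cball (z kl) (R / c)}"
      using dyadic_times_subset[of T] T F N
      by (intro indep_traj_family[OF prob_space_axioms ind, symmetric]) (auto simp: countable_dyadic_times)
    finally show ?thesis .
  qed
  moreover have "0 < prod q F" using q by (simp add: prod_pos)
  ultimately show ?thesis unfolding z_def by blast
qed

text \<open>Covers both lattice models: \<open>\<kappa> i\<close> is the lattice site to which the point \<open>i\<close> belongs,
  \<open>u i\<close> its rotation, and \<open>\<iota>\<close> selects one unrotated point per site.\<close>

lemma lattice_persistence_rate:
  fixes X :: "'i \<Rightarrow> real \<Rightarrow> 'w \<Rightarrow> complex"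
  assumes iid: "iid_OU_family M \<zeta>" and \<alpha>: "0 < \<alpha>" and c: "0 < c" and R: "0 < R" and N: "1 \<le> N"
    and I: "countable I" "\<And>kl. finite {i \<in> I. \<kappa> i = kl}"
    and X: "\<And>i t \<omega>. i \<in> I \<Longrightarrow> X i t \<omega> =
      of_real \<alpha> * (of_int (fst (\<kappa> i)) + \<i> * of_int (snd (\<kappa> i))) + of_real c * u i * \<zeta> (\<kappa> i) t \<omega>"
    and u: "\<And>i. i \<in> I \<Longrightarrow> cmod (u i) = 1"
    and \<iota>: "\<And>kl. \<iota> kl \<in> I" "\<And>kl. \<kappa> (\<iota> kl) = kl" "\<And>kl. u (\<iota> kl) = 1"
  shows "ereal (- (lattice_rate \<alpha> c R * (real N)\<^sup>2)) \<le> persistence_rate M I X R N"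
proof -
  interpret prob_space M using iid by (simp add: iid_OU_family_def)
  have Z: "complex_OU M (\<zeta> kl)" for kl using iid unfolding iid_OU_family_def by blast
  obtain F where F: "finite F" "card F = N" "\<forall>(k, l)\<in>F. (real_of_int k)\<^sup>2 + (real_of_int l)\<^sup>2 \<le> 8 * real N"
    using exists_lattice_points[OF N] by blast
  define z where "z kl = - (of_real \<alpha> * (of_int (fst kl) + \<i> * of_int (snd kl)) / of_real c)" for kl :: "int \<times> int"
  obtain q where q: "0 < q" and stay: "\<And>T. 0 < T \<Longrightarrow> q * exp (- T * (lattice_rate \<alpha> c R * (real N)\<^sup>2)) \<le>
    measure M {\<omega> \<in> space M. \<forall>kl\<in>F. \<forall>t\<in>dyadic_times T. \<zeta> kl t \<omega> \<in> cball (z kl) (R / c)}"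
    using iid_OU_family_stay[OF iid \<alpha> c R F N] unfolding z_def by blast
  show ?thesis
  proof (rule persistence_rate_ge[OF q])
    fix T :: real assume T: "0 < T"
    have dy: "t \<in> dyadic_times T \<Longrightarrow> 0 \<le> t" for t using dyadic_times_subset[of T] T by auto
    have meas: "X i t \<in> borel_measurable M" if "i \<in> I" "0 \<le> t" for i t
    proof -
      have [measurable]: "\<zeta> (\<kappa> i) t \<in> borel_measurable M" using complex_OU_measurable[OF Z that(2)] .
      have "(\<lambda>\<omega>. of_real \<alpha> * (of_int (fst (\<kappa> i)) + \<i> * of_int (snd (\<kappa> i))) + of_real c * u i * \<zeta> (\<kappa> i) t \<omega>) \<in> borel_measurable M"
        by measurable
      then show ?thesis using X[OF that(1)] by (simp cong: measurable_cong)
    qed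
    have near: "X (\<iota> kl) t \<omega> \<in> cball 0 R" if "\<zeta> kl t \<omega> \<in> cball (z kl) (R / c)" for kl t \<omega>
    proof -
      have "X (\<iota> kl) t \<omega> = of_real c * (\<zeta> kl t \<omega> - z kl)"
        using c by (simp add: X \<iota> z_def field_simps)
      then have "cmod (X (\<iota> kl) t \<omega>) = c * dist (z kl) (\<zeta> kl t \<omega>)"
        using c by (simp add: norm_mult dist_norm norm_minus_commute)
      then show ?thesis using that c by (simp add: field_simps)
    qed
    have inj: "inj \<iota>" using \<iota>(2) by (metis injI)
    have "q * exp (- T * (lattice_rate \<alpha> c R * (real N)\<^sup>2)) \<le>
      measure M {\<omega> \<in> space M. \<forall>kl\<in>F. \<forall>t\<in>dyadic_times T. \<zeta> kl t \<omega> \<in> cball (z kl) (R / c)}"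
      by (rule stay[OF T])
    also have "\<dots> \<le> measure M {\<omega> \<in> space M. \<forall>i\<in>\<iota> ` F. \<forall>t\<in>dyadic_times T. X i t \<omega> \<in> cball 0 R}"
    proof (rule finite_measure_mono)
      show "{\<omega> \<in> space M. \<forall>kl\<in>F. \<forall>t\<in>dyadic_times T. \<zeta> kl t \<omega> \<in> cball (z kl) (R / c)} \<subseteq>
        {\<omega> \<in> space M. \<forall>i\<in>\<iota> ` F. \<forall>t\<in>dyadic_times T. X i t \<omega> \<in> cball 0 R}"
        using near by blast
      show "{\<omega> \<in> space M. \<forall>i\<in>\<iota> ` F. \<forall>t\<in>dyadic_times T. X i t \<omega> \<in> cball 0 R} \<in> sets M"
      proof (rule sets.sets_Collect_finite_All')
        show "{\<omega> \<in> space M. \<forall>t\<in>dyadic_times T. X i t \<omega> \<in> cball 0 R} \<in> sets M" if "i \<in> \<iota> ` F" for i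
          using that \<iota>(1) by (intro countable_ball_event countable_dyadic_times meas dy) auto
        show "\<iota> ` F \<noteq> {}" using F N by auto
      qed (use F in auto)
    qed
    also have "\<dots> \<le> measure (completion M) (at_least_points_event M I X T R N)"
    proof (rule measure_at_least_points_ge[OF prob_space_axioms I(1) T meas])
      show "AE \<omega> in M. continuous_on {0..} (\<lambda>t. X i t \<omega>)" if "i \<in> I" for i
      proof -
        have "AE \<omega> in M. continuous_on {0..} (\<lambda>t. \<zeta> (\<kappa> i) t \<omega>)" using Z by (simp add: complex_OU_def)
        then show ?thesis
          by eventually_elim (unfold X[OF that], intro continuous_intros, assumption)
      qed
      show "AE \<omega> in M. finite {i \<in> I. \<exists>t\<in>dyadic_times T. X i t \<omega> \<in> cball 0 R}"
        using iid_OU_family_far_finite[OF iid \<alpha> c T, of R]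
      proof eventually_elim
        case (elim \<omega>)
        let ?S = "{(k, l). \<exists>t\<in>dyadic_times T. \<alpha> * cmod (of_int k + \<i> * of_int l) \<le> R + c * cmod (\<zeta> (k, l) t \<omega>)}"
        have site: "\<kappa> i \<in> ?S" if i: "i \<in> I" and t: "t \<in> dyadic_times T" "X i t \<omega> \<in> cball 0 R" for i t
        proof -
          let ?w = "of_real \<alpha> * (of_int (fst (\<kappa> i)) + \<i> * of_int (snd (\<kappa> i))) :: complex"
          have "cmod ?w = cmod (X i t \<omega> - of_real c * u i * \<zeta> (\<kappa> i) t \<omega>)" using X[OF i] by simp
          also have "\<dots> \<le> cmod (X i t \<omega>) + cmod (of_real c * u i * \<zeta> (\<kappa> i) t \<omega>)" by (rule norm_triangle_ineq4)
          also have "\<dots> \<le> R + c * cmod (\<zeta> (\<kappa> i) t \<omega>)" using t c u[OF i] by (simp add: norm_mult)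
          finally show ?thesis using t \<alpha> by (auto simp: case_prod_unfold norm_mult)
        qed
        \<comment> \<open>Finitely many sites contribute finitely many points, because each fibre of
          \<open>\<kappa>\<close> is finite.\<close>
        have sub: "{i \<in> I. \<exists>t\<in>dyadic_times T. X i t \<omega> \<in> cball 0 R} \<subseteq> (\<Union>kl\<in>?S. {i \<in> I. \<kappa> i = kl})"
        proof
          fix i assume i: "i \<in> {i \<in> I. \<exists>t\<in>dyadic_times T. X i t \<omega> \<in> cball 0 R}"
          then obtain t where "t \<in> dyadic_times T" "X i t \<omega> \<in> cball 0 R" by blast
          with i have "\<kappa> i \<in> ?S" by (intro site[of i t]) simp_all
          then show "i \<in> (\<Union>kl\<in>?S. {i \<in> I. \<kappa> i = kl})" using i by (intro UN_I[of "\<kappa> i"]) simp_all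
        qed
        have "finite (\<Union>kl\<in>?S. {i \<in> I. \<kappa> i = kl})" by (rule finite_UN_I[OF elim I(2)])
        with sub show ?case by (rule finite_subset)
      qed
      show "finite (\<iota> ` F)" "\<iota> ` F \<subseteq> I" using F \<iota>(1) by auto
      show "card (\<iota> ` F) = N" using card_image[OF inj_on_subset[OF inj subset_UNIV], of F] F by simp
    qed
    finally show "q * exp (- T * (lattice_rate \<alpha> c R * (real N)\<^sup>2)) \<le> measure (completion M) (at_least_points_event M I X T R N)" .
  qed
qed

lemma lattice_rate_pos: "0 < R \<Longrightarrow> 0 < c \<Longrightarrow> 0 < lattice_rate \<alpha> c R"
  unfolding lattice_rate_def by (intro add_pos_nonneg) auto

lemma pl_persistence_rate:
  assumes "iid_OU_family M \<zeta>" "0 < c" "0 < R" "1 \<le> N"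
  shows "ereal (- (lattice_rate (sqrt pi) c R * (real N)\<^sup>2)) \<le> persistence_rate M UNIV (pl_points c \<zeta>) R N"
proof (rule lattice_persistence_rate[OF assms(1) _ assms(2-4), where \<kappa> = "\<lambda>i. i" and u = "\<lambda>_. 1" and \<iota> = "\<lambda>i. i"])
  show "pl_points c \<zeta> i t \<omega> = of_real (sqrt pi) * (of_int (fst i) + \<i> * of_int (snd i)) + of_real c * 1 * \<zeta> i t \<omega>" for i t \<omega>
    by (cases i) (simp add: pl_points_def)
qed simp_all

lemma tc_persistence_rate:
  assumes "iid_OU_family M \<zeta>" "0 < c" "0 < R" "1 \<le> N"
  shows "ereal (- (lattice_rate (sqrt (3 * pi)) c R * (real N)\<^sup>2)) \<le>
    persistence_rate M (UNIV \<times> UNIV \<times> {0, 1, 2}) (tc_points c \<zeta>) R N"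
proof (rule lattice_persistence_rate[OF assms(1) _ assms(2-4), where \<kappa> = "\<lambda>(k, l, m). (k, l)"
      and u = "\<lambda>(k, l, m). exp (2 * of_real pi * \<i> * of_nat m / 3)" and \<iota> = "\<lambda>(k, l). (k, l, 0)"])
  show "finite {i \<in> UNIV \<times> UNIV \<times> {0, 1, 2 :: nat}. (case i of (k, l, m) \<Rightarrow> (k, l)) = kl}" for kl :: "int \<times> int"
    by (rule finite_subset[of _ "{fst kl} \<times> {snd kl} \<times> {0, 1, 2}"]) auto
  show "tc_points c \<zeta> i t \<omega> = of_real (sqrt (3 * pi)) * (of_int (fst (case i of (k, l, m) \<Rightarrow> (k, l))) + \<i> * of_int (snd (case i of (k, l, m) \<Rightarrow> (k, l))))
      + of_real c * (case i of (k, l, m) \<Rightarrow> exp (2 * of_real pi * \<i> * of_nat m / 3)) * \<zeta> (case i of (k, l, m) \<Rightarrow> (k, l)) t \<omega>" for i t \<omega>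
    by (cases i) (simp add: tc_points_def)
  show "cmod (case i of (k, l, m) \<Rightarrow> exp (2 * of_real pi * \<i> * of_nat m / 3)) = 1" for i :: "int \<times> int \<times> nat"
    by (cases i) (simp add: norm_exp_eq_Re)
  show "(case kl of (k, l) \<Rightarrow> (k, l, 0)) \<in> (UNIV \<times> UNIV \<times> {0, 1, 2} :: (int \<times> int \<times> nat) set)" for kl
    by (cases kl) simp
  show "(case case kl of (k, l) \<Rightarrow> (k, l, 0) of (k, l, m) \<Rightarrow> (k, l)) = kl" for kl :: "int \<times> int"
    by (cases kl) simp
  show "(case case kl of (k, l) \<Rightarrow> (k, l, 0) of (k, l, m) \<Rightarrow> exp (2 * of_real pi * \<i> * of_nat m / 3)) = 1" for kl :: "int \<times> int"
    by (cases kl) simp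
qed simp_all

section \<open>The Poisson process\<close>

text \<open>The mean of the Poisson distribution, by an index shift in the exponential
  series.\<close>

lemma poisson_mean_sums: "(\<lambda>n. real n * (exp (- \<mu>) * \<mu> ^ n / fact n)) sums (\<mu> :: real)"
proof -
  have "(\<lambda>n. \<mu> ^ n / fact n) sums exp \<mu>"
    using exp_converges[of \<mu>] by (simp add: divide_inverse mult.commute)
  then have "(\<lambda>n. \<mu> * exp (- \<mu>) * (\<mu> ^ n / fact n)) sums (\<mu> * exp (- \<mu>) * exp \<mu>)"
    by (rule sums_mult)
  moreover have "\<mu> * exp (- \<mu>) * exp \<mu> = \<mu>" by (simp add: exp_minus)
  moreover have "real (Suc n) * (exp (- \<mu>) * \<mu> ^ Suc n / fact (Suc n)) = \<mu> * exp (- \<mu>) * (\<mu> ^ n / fact n)" for n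
    by (simp add: divide_simps del: of_nat_Suc)
  ultimately have "(\<lambda>n. real (Suc n) * (exp (- \<mu>) * \<mu> ^ Suc n / fact (Suc n))) sums \<mu>" by (simp only:)
  then show ?thesis by (subst (asm) sums_Suc_iff) simp
qed

text \<open>The sum is at most the mean number of points in \<open>A\<close>. The definition gives
  the law of the count, not that of single points, so this mean is computed over the values of the
  count.\<close>

lemma poisson_points_sum_le:
  assumes M: "prob_space M" and p: "poisson_points M d p" and d: "0 \<le> d"
    and A: "A \<in> sets borel" "emeasure lborel A < \<infinity>" and F: "finite F"
  shows "(\<Sum>i\<in>F. measure M {\<omega> \<in> space M. p i \<omega> \<in> A}) \<le> d * measure lborel A"
proof -
  interpret prob_space M by (rule M)
  have [measurable]: "p i \<in> borel_measurable M" for i using p by (simp add: poisson_points_def)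
  note [measurable] = A(1)
  define \<mu> where "\<mu> = d * measure lborel A"
  define K where "K \<omega> = card {i. p i \<omega> \<in> A}" for \<omega>
  have fin: "AE \<omega> in M. finite {i. p i \<omega> \<in> A}" using p A by (simp add: poisson_points_def)
  have law: "measure M {\<omega> \<in> space M. K \<omega> = n} = exp (- \<mu>) * \<mu> ^ n / fact n" for n
    using p A by (simp add: poisson_points_def \<mu>_def K_def)
  have K[measurable]: "K \<in> measurable M (count_space UNIV)"
  proof -
    have "\<forall>(n::nat) A. (\<forall>j<n. A j \<in> sets borel \<and> emeasure lborel (A j) < \<infinity>) \<and> disjoint_family_on A {..<n} \<longrightarrow>
        indep_vars (\<lambda>_. count_space UNIV) (\<lambda>j \<omega>. card {i. p i \<omega> \<in> A j}) {..<n}"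
      using p unfolding poisson_points_def by blast
    \<comment> \<open>The independence clause for a single set supplies the measurability of the
      count.\<close>
    from this[rule_format, of 1 "\<lambda>_. A"] have "indep_vars (\<lambda>_. count_space UNIV) (\<lambda>j \<omega>. card {i. p i \<omega> \<in> A}) {..<1::nat}"
      using A by (simp add: disjoint_family_on_def)
    then show ?thesis unfolding indep_vars_def2 K_def[abs_def] by auto
  qed
  have \<mu>: "0 \<le> \<mu>" using d by (simp add: \<mu>_def)
  have "ennreal (\<Sum>i\<in>F. measure M {\<omega> \<in> space M. p i \<omega> \<in> A}) = (\<Sum>i\<in>F. emeasure M {\<omega> \<in> space M. p i \<omega> \<in> A})"
    by (simp add: emeasure_eq_measure sum_ennreal)
  also have "\<dots> = (\<Sum>i\<in>F. \<integral>\<^sup>+\<omega>. indicator {\<omega> \<in> space M. p i \<omega> \<in> A} \<omega> \<partial>M)"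
    by (intro sum.cong refl nn_integral_indicator[symmetric]) measurable
  also have "\<dots> = (\<integral>\<^sup>+\<omega>. (\<Sum>i\<in>F. indicator {\<omega> \<in> space M. p i \<omega> \<in> A} \<omega>) \<partial>M)"
    by (rule nn_integral_sum[symmetric]) measurable
  also have "\<dots> \<le> (\<integral>\<^sup>+\<omega>. (\<Sum>n. ennreal (real n) * indicator {\<omega> \<in> space M. K \<omega> = n} \<omega>) \<partial>M)"
  proof (rule nn_integral_mono_AE)
    show "AE \<omega> in M. (\<Sum>i\<in>F. indicator {\<omega> \<in> space M. p i \<omega> \<in> A} \<omega>) \<le> (\<Sum>n. ennreal (real n) * indicator {\<omega> \<in> space M. K \<omega> = n} \<omega>)"
      using fin AE_space
    proof eventually_elim
      case (elim \<omega>)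
      have "(\<Sum>i\<in>F. indicator {\<omega> \<in> space M. p i \<omega> \<in> A} \<omega>) = (\<Sum>i\<in>F. if p i \<omega> \<in> A then 1 else (0::ennreal))"
        using elim by (intro sum.cong) auto
      also have "\<dots> = ennreal (real (card {i\<in>F. p i \<omega> \<in> A}))"
        using F by (simp add: sum.If_cases Int_def ennreal_of_nat_eq_real_of_nat)
      \<comment> \<open>Finiteness matters here: \<open>card\<close> would be 0 on an infinite
        set.\<close>
      also have "\<dots> \<le> ennreal (real (K \<omega>))"
        unfolding K_def using elim by (intro ennreal_leI of_nat_mono card_mono) auto
      also have "\<dots> = (\<Sum>n\<in>{K \<omega>}. ennreal (real n) * indicator {\<omega> \<in> space M. K \<omega> = n} \<omega>)"
        using elim by simp
      also have "\<dots> \<le> (\<Sum>n. ennreal (real n) * indicator {\<omega> \<in> space M. K \<omega> = n} \<omega>)"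
        by (rule sum_le_suminf) auto
      finally show ?case .
    qed
  qed
  also have "\<dots> = (\<Sum>n. \<integral>\<^sup>+\<omega>. ennreal (real n) * indicator {\<omega> \<in> space M. K \<omega> = n} \<omega> \<partial>M)"
    by (rule nn_integral_suminf) measurable
  also have "\<dots> = (\<Sum>n. ennreal (real n * (exp (- \<mu>) * \<mu> ^ n / fact n)))"
  proof (rule suminf_cong)
    fix n
    have "{\<omega> \<in> space M. K \<omega> = n} \<in> sets M" by measurable
    then have "(\<integral>\<^sup>+\<omega>. ennreal (real n) * indicator {\<omega> \<in> space M. K \<omega> = n} \<omega> \<partial>M) = ennreal (real n) * emeasure M {\<omega> \<in> space M. K \<omega> = n}"
      by (rule nn_integral_cmult_indicator)
    also have "\<dots> = ennreal (real n * (exp (- \<mu>) * \<mu> ^ n / fact n))"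
      unfolding emeasure_eq_measure law by (rule ennreal_mult[symmetric]) (use \<mu> in auto)
    finally show "(\<integral>\<^sup>+\<omega>. ennreal (real n) * indicator {\<omega> \<in> space M. K \<omega> = n} \<omega> \<partial>M) = ennreal (real n * (exp (- \<mu>) * \<mu> ^ n / fact n))" .
  qed
  also have "\<dots> = ennreal \<mu>"
    using poisson_mean_sums[of \<mu>] \<mu> by (intro suminf_ennreal_eq) auto
  finally show ?thesis using \<mu> by (simp add: \<mu>_def)
qed

lemma measure_cball_complex:
  assumes "0 \<le> r"
  shows "measure lborel (cball (0 :: complex) r) = pi * r\<^sup>2" "emeasure lborel (cball (0 :: complex) r) < \<infinity>"
  using assms by (simp_all add: content_cball unit_ball_vol_2 emeasure_bounded_finite del: infinity_ennreal_def)

text \<open>The enumeration of the points is arbitrary, so no particular indices are known to start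
  near 0. But the event that the count is \<open>N\<close> is covered by countably many events
  \<open>E F\<close>, and one of them must have positive probability.\<close>

lemma poisson_points_positive:
  assumes M: "prob_space M" and p: "poisson_points M (1 / pi) p" and r: "0 < r"
  shows "\<exists>F. finite F \<and> card F = N \<and> 0 < measure M {\<omega> \<in> space M. \<forall>i\<in>F. p i \<omega> \<in> cball 0 r}"
proof (cases "N = 0")
  case True
  then show ?thesis by (intro exI[of _ "{}"]) (simp add: prob_space.prob_space[OF M])
next
  case False
  interpret prob_space M by (rule M)
  have [measurable]: "p i \<in> borel_measurable M" for i using p by (simp add: poisson_points_def)
  define E where "E F = {\<omega> \<in> space M. \<forall>i\<in>F. p i \<omega> \<in> cball 0 r}" for F
  define FF where "FF = {F. F \<in> {F. finite F \<and> F \<subseteq> (UNIV :: nat set)} \<and> card F = N}"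
  have cFF: "countable FF" unfolding FF_def
    by (rule countable_subset[OF _ countable_Collect_finite_subset[of UNIV]]) auto
  have E: "E F \<in> sets M" if "F \<in> FF" for F
    unfolding E_def using that by (intro countable_ball_event) (auto simp: FF_def countable_finite)
  have pos: "0 < measure M {\<omega> \<in> space M. card {i. p i \<omega> \<in> cball 0 r} = N}"
  proof -
    have "\<forall>A\<in>sets borel. emeasure lborel A < \<infinity> \<longrightarrow>
        (\<forall>n. measure M {\<omega>\<in>space M. card {i. p i \<omega> \<in> A} = n} =
             exp (- (1 / pi * measure lborel A)) * (1 / pi * measure lborel A) ^ n / fact n)"
      using p unfolding poisson_points_def by blast
    from this[THEN bspec, of "cball 0 r"]
    have "measure M {\<omega> \<in> space M. card {i. p i \<omega> \<in> cball 0 r} = N} =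
        exp (- (1 / pi * measure lborel (cball (0::complex) r))) * (1 / pi * measure lborel (cball (0::complex) r)) ^ N / fact N"
      using measure_cball_complex(2)[of r] r by auto
    also have "0 < \<dots>" using measure_cball_complex(1)[of r] r by simp
    finally show ?thesis .
  qed
  have sub: "{\<omega> \<in> space M. card {i. p i \<omega> \<in> cball 0 r} = N} \<subseteq> (\<Union>F\<in>FF. E F)"
  proof
    fix \<omega> assume \<omega>: "\<omega> \<in> {\<omega> \<in> space M. card {i. p i \<omega> \<in> cball 0 r} = N}"
    let ?F = "{i. p i \<omega> \<in> cball 0 r}"
    have "card ?F = N" using \<omega> by simp
    \<comment> \<open>A count of \<open>N\<close>, which is not 0 here, excludes infinite
      sets.\<close>
    moreover from this have "finite ?F" using False card.infinite by metis
    ultimately have "?F \<in> FF" by (simp add: FF_def)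
    then show "\<omega> \<in> (\<Union>F\<in>FF. E F)" using \<omega> by (intro UN_I[of ?F]) (auto simp: E_def)
  qed
  have "\<exists>F\<in>FF. 0 < measure M (E F)"
  proof (rule ccontr)
    assume "\<not> ?thesis"
    then have "E F \<in> null_sets M" if "F \<in> FF" for F
      using E that by (auto simp: null_sets_def emeasure_eq_measure not_less measure_le_0_iff)
    then have null: "(\<Union>F\<in>FF. E F) \<in> null_sets M" using cFF by (intro null_sets_UN') auto
    then have "measure M {\<omega> \<in> space M. card {i. p i \<omega> \<in> cball 0 r} = N} \<le> measure M (\<Union>F\<in>FF. E F)"
      using sub by (intro finite_measure_mono) auto
    also have "\<dots> = 0" using null by (rule measure_eq_0_null_sets)
    finally show False using pos by simp
  qed
  then show ?thesis unfolding E_def FF_def by blast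
qed

lemma poisson_BM_indep:
  assumes pW: "poisson_BM M p W" and F: "finite F" and D: "countable D" "D \<subseteq> {0..}"
    and A: "A \<in> sets borel" and C: "C \<in> sets borel"
  shows "measure M {\<omega> \<in> space M. (\<forall>i\<in>F. p i \<omega> \<in> A) \<and> (\<forall>i\<in>F. \<forall>t\<in>D. W i t \<omega> \<in> C)} =
    measure M {\<omega> \<in> space M. \<forall>i\<in>F. p i \<omega> \<in> A} * measure M {\<omega> \<in> space M. \<forall>i\<in>F. \<forall>t\<in>D. W i t \<omega> \<in> C}"
proof -
  interpret prob_space M using pW by (simp add: poisson_BM_def)
  let ?P = "{f \<in> space (PiM UNIV (\<lambda>_ :: nat. borel :: complex measure)). \<forall>i\<in>F. f i \<in> A}"
  let ?Q = "{g \<in> space (PiM UNIV (\<lambda>_ :: nat. traj_space :: (real \<Rightarrow> complex) measure)). \<forall>i\<in>F. g i \<in> {x \<in> space traj_space. \<forall>t\<in>D. x t \<in> C}}"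
  have "?P \<in> sets (PiM UNIV (\<lambda>_ :: nat. borel :: complex measure))"
  proof (rule sets.sets_Collect_countable_All'[OF _ countable_finite[OF F]])
    fix i
    have "(\<lambda>f. f i) \<in> measurable (PiM UNIV (\<lambda>_ :: nat. borel :: complex measure)) borel"
      by (rule measurable_component_singleton) simp
    from measurable_sets[OF this A]
    show "{f \<in> space (PiM UNIV (\<lambda>_ :: nat. borel :: complex measure)). f i \<in> A} \<in> sets (PiM UNIV (\<lambda>_ :: nat. borel :: complex measure))"
      by (simp add: vimage_def Int_def conj_commute)
  qed
  moreover have "?Q \<in> sets (PiM UNIV (\<lambda>_ :: nat. traj_space :: (real \<Rightarrow> complex) measure))"
  proof (rule sets.sets_Collect_countable_All'[OF _ countable_finite[OF F]])
    fix i
    have "(\<lambda>f. f i) \<in> measurable (PiM UNIV (\<lambda>_ :: nat. traj_space :: (real \<Rightarrow> complex) measure)) traj_space"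
      by (rule measurable_component_singleton) simp
    from measurable_sets[OF this traj_event[OF D C]]
    show "{g \<in> space (PiM UNIV (\<lambda>_ :: nat. traj_space :: (real \<Rightarrow> complex) measure)). g i \<in> {x \<in> space traj_space. \<forall>t\<in>D. x t \<in> C}}
      \<in> sets (PiM UNIV (\<lambda>_ :: nat. traj_space :: (real \<Rightarrow> complex) measure))"
      by (simp only: vimage_def Int_def conj_commute mem_Collect_eq)
  qed
  moreover have "indep_set {(\<lambda>\<omega> i. p i \<omega>) -` A \<inter> space M | A. A \<in> sets (Pi\<^sub>M UNIV (\<lambda>_. borel))}
       {(\<lambda>\<omega> i. traj (W i) \<omega>) -` A \<inter> space M | A. A \<in> sets (Pi\<^sub>M UNIV (\<lambda>_. traj_space))}"
    using pW by (simp only: poisson_BM_def)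
  ultimately have "prob (((\<lambda>\<omega> i. p i \<omega>) -` ?P \<inter> space M) \<inter> ((\<lambda>\<omega> i. traj (W i) \<omega>) -` ?Q \<inter> space M)) =
    prob ((\<lambda>\<omega> i. p i \<omega>) -` ?P \<inter> space M) * prob ((\<lambda>\<omega> i. traj (W i) \<omega>) -` ?Q \<inter> space M)"
    by (intro indep_setD) blast+
  moreover have P: "(\<lambda>\<omega> i. p i \<omega>) -` ?P \<inter> space M = {\<omega> \<in> space M. \<forall>i\<in>F. p i \<omega> \<in> A}"
    by (auto simp: space_PiM)
  moreover have Q: "(\<lambda>\<omega> i. traj (W i) \<omega>) -` ?Q \<inter> space M = {\<omega> \<in> space M. \<forall>i\<in>F. \<forall>t\<in>D. W i t \<omega> \<in> C}"
  proof -
    have traj_in: "traj (W i) \<omega> \<in> space traj_space" for i \<omega> by (auto simp: traj_def space_PiM)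
    have "traj (W i) \<omega> t = W i t \<omega>" if "t \<in> D" for i t \<omega> using that D(2) by (auto simp: traj_def)
    then show ?thesis using traj_in by (auto simp: space_PiM[of UNIV])
  qed
  moreover have "{\<omega> \<in> space M. \<forall>i\<in>F. p i \<omega> \<in> A} \<inter> {\<omega> \<in> space M. \<forall>i\<in>F. \<forall>t\<in>D. W i t \<omega> \<in> C} =
    {\<omega> \<in> space M. (\<forall>i\<in>F. p i \<omega> \<in> A) \<and> (\<forall>i\<in>F. \<forall>t\<in>D. W i t \<omega> \<in> C)}" by blast
  ultimately show ?thesis by simp
qed

lemma summable_square_exp: "summable (\<lambda>n::nat. (real n + 1)\<^sup>2 * exp (- real n))"
proof (rule summable_comparison_test'[of "\<lambda>n. 16 * exp (1 / 2) * exp (- 1 / 2) ^ n" 0])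
  show "summable (\<lambda>n. 16 * exp (1 / 2) * exp (- 1 / 2 :: real) ^ n)"
    by (intro summable_mult summable_geometric) simp
  show "norm ((real n + 1)\<^sup>2 * exp (- real n)) \<le> 16 * exp (1 / 2) * exp (- 1 / 2) ^ n" for n
  proof -
    have "(real n + 1) / 4 \<le> exp ((real n + 1) / 4)" using exp_ge_add_one_self[of "(real n + 1) / 4"] by linarith
    then have "((real n + 1) / 4)\<^sup>2 \<le> (exp ((real n + 1) / 4))\<^sup>2" by (intro power_mono) auto
    also have "\<dots> = exp ((real n + 1) / 2)" by (simp add: power2_eq_square flip: exp_add)
    finally have "(real n + 1)\<^sup>2 \<le> 16 * exp ((real n + 1) / 2)" by (simp add: power_divide)
    then have "(real n + 1)\<^sup>2 * exp (- real n) \<le> 16 * exp ((real n + 1) / 2) * exp (- real n)"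
      by (intro mult_right_mono) auto
    also have "\<dots> = 16 * (exp ((real n + 1) / 2) * exp (- real n))" by simp
    also have "exp ((real n + 1) / 2) * exp (- real n) = exp (1 / 2 + real n * (- 1 / 2))"
      by (simp add: field_simps flip: exp_add)
    also have "16 * exp (1 / 2 + real n * (- 1 / 2)) = 16 * exp (1 / 2) * exp (- 1 / 2) ^ n"
      by (simp only: exp_add exp_of_nat_mult mult.assoc)
    finally show ?thesis by simp
  qed
qed

text \<open>Points are sorted by the annulus in which they start. The mean number in the annulus
  \<open>n\<close> is at most \<open>(real n + 1)\<^sup>2\<close>, and the displacement, independent
  of the start, is large enough with probability at most \<open>c * exp (- real n)\<close>. Overlaps
  of the closed annuli do no harm to an upper bound.\<close>

lemma poisson_BM_near_finite:
  assumes pW: "poisson_BM M p W" and T: "0 < T" and R: "0 < R"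
  shows "AE \<omega> in M. finite {i. \<exists>t\<in>dyadic_times T. pp_points p W i t \<omega> \<in> cball 0 R}"
proof -
  interpret prob_space M using pW by (simp add: poisson_BM_def)
  have p: "poisson_points M (1 / pi) p" and W: "complex_BM M (W i)" for i using pW by (auto simp: poisson_BM_def)
  have p_meas[measurable]: "p i \<in> borel_measurable M" for i using p by (simp add: poisson_points_def)
  have D: "countable (dyadic_times T)" "dyadic_times T \<subseteq> {0..}" using dyadic_times_subset[of T] T by (auto simp: countable_dyadic_times)
  define Ann where "Ann n = cball 0 (real n + 1) - ball (0 :: complex) (real n)" for n :: nat
  have Ann: "Ann n \<in> sets borel" for n unfolding Ann_def by simp
  have Ann_sub: "Ann n \<subseteq> cball 0 (real n + 1)" for n by (auto simp: Ann_def)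
  have Ann_fin: "emeasure lborel (Ann n) < \<infinity>" for n
    using emeasure_mono[OF Ann_sub[of n], of lborel] measure_cball_complex(2)[of "real n + 1"]
    by (auto intro: le_less_trans)
  have Ann_vol: "measure lborel (Ann n) \<le> pi * (real n + 1)\<^sup>2" for n
    using measure_mono_fmeasurable[OF Ann_sub[of n], of lborel] Ann[of n] measure_cball_complex[of "real n + 1"]
    by (simp add: fmeasurable_def)
  \<comment> \<open>From distance at least \<open>n\<close>, reaching the disc takes a displacement
    of at least \<open>real n - R\<close>, which is strictly more than \<open>b n\<close>.\<close>
  define b where "b n = real n - R - 1" for n
  define S where "S i n = {\<omega> \<in> space M. \<forall>t\<in>dyadic_times T. W i t \<omega> \<in> cball 0 (b n)}" for i n
  have S: "S i n \<in> sets M" for i n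
    unfolding S_def using complex_BM_measurable[OF W] D by (intro countable_ball_event) auto
  define c where "c = (4 * exp (T / 2) + 1) * exp (R + 1)"
  have c: "0 \<le> c" by (simp add: c_def)
  have tail: "1 - measure M (S i n) \<le> c * exp (- real n)" for i n
  proof -
    have "1 - measure M (S i n) \<le> (4 * exp (T / 2) + 1) * exp (- b n)"
    proof (cases "0 \<le> b n")
      case True
      have "1 - 2 * (exp (T / 2) / cosh (b n)) \<le> measure M (S i n)"
        unfolding S_def by (rule complex_BM_max[OF prob_space_axioms W D standard_BM_max[OF prob_space_axioms _ True T]])
      then have "1 - measure M (S i n) \<le> 2 * (exp (T / 2) * (1 / cosh (b n)))" by simp
      also have "\<dots> \<le> 2 * (exp (T / 2) * (2 * exp (- b n)))"
        by (intro mult_left_mono inverse_cosh_le) auto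
      also have "\<dots> \<le> (4 * exp (T / 2) + 1) * exp (- b n)" by (simp add: algebra_simps)
      finally show ?thesis .
    next
      case False
      then have "1 * 1 \<le> (4 * exp (T / 2) + 1) * exp (- b n)" by (intro mult_mono) auto
      moreover have "1 - measure M (S i n) \<le> 1" by simp
      ultimately show ?thesis by linarith
    qed
    also have "\<dots> = c * exp (- real n)" by (simp add: c_def b_def mult.assoc flip: exp_add)
    finally show ?thesis .
  qed
  define B where "B i n = {\<omega> \<in> space M. p i \<omega> \<in> Ann n} - S i n" for i n
  have B: "B i n \<in> sets M" for i n
  proof -
    have "{\<omega> \<in> space M. p i \<omega> \<in> Ann n} \<in> sets M" using Ann by measurable
    then show ?thesis unfolding B_def using S by auto
  qed
  have B_le: "measure M (B i n) \<le> measure M {\<omega> \<in> space M. p i \<omega> \<in> Ann n} * (c * exp (- real n))" for i n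
  proof -
    let ?E = "{\<omega> \<in> space M. p i \<omega> \<in> Ann n}"
    have E: "?E \<in> sets M" using Ann by measurable
    have "measure M (B i n) = measure M ?E - measure M (?E \<inter> S i n)"
      unfolding B_def using E S by (rule finite_measure_Diff')
    also have "measure M (?E \<inter> S i n) = measure M ?E * measure M (S i n)"
    proof -
      have "?E \<inter> S i n = {\<omega> \<in> space M. (\<forall>j\<in>{i}. p j \<omega> \<in> Ann n) \<and> (\<forall>j\<in>{i}. \<forall>t\<in>dyadic_times T. W j t \<omega> \<in> cball 0 (b n))}"
        by (auto simp: S_def)
      then show ?thesis
        using poisson_BM_indep[OF pW _ D Ann[of n], of "{i}" "cball 0 (b n)"] by (simp add: S_def)
    qed
    also have "measure M ?E - measure M ?E * measure M (S i n) = measure M ?E * (1 - measure M (S i n))"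
      by (simp add: right_diff_distrib)
    also have "\<dots> \<le> measure M ?E * (c * exp (- real n))" by (intro mult_left_mono tail) simp
    finally show ?thesis .
  qed
  have B_sum: "(\<Sum>i\<in>F. measure M (B i n)) \<le> c * ((real n + 1)\<^sup>2 * exp (- real n))" if F: "finite F" for F n
  proof -
    have "(\<Sum>i\<in>F. measure M (B i n)) \<le> (\<Sum>i\<in>F. measure M {\<omega> \<in> space M. p i \<omega> \<in> Ann n}) * (c * exp (- real n))"
      unfolding sum_distrib_right by (intro sum_mono B_le)
    also have "\<dots> \<le> (1 / pi * measure lborel (Ann n)) * (c * exp (- real n))"
      using c F by (intro mult_right_mono poisson_points_sum_le[OF prob_space_axioms p _ Ann Ann_fin]) auto
    also have "\<dots> \<le> (1 / pi * (pi * (real n + 1)\<^sup>2)) * (c * exp (- real n))"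
      using c Ann_vol by (intro mult_right_mono mult_left_mono) auto
    also have "\<dots> = c * ((real n + 1)\<^sup>2 * exp (- real n))" by simp
    finally show ?thesis .
  qed
  have summ: "summable (\<lambda>n. c * ((real n + 1)\<^sup>2 * exp (- real n)))"
    by (intro summable_mult summable_square_exp)
  have B_summ: "summable (\<lambda>n. measure M (B i n))" for i
    using B_sum[of "{i}"] by (intro summable_comparison_test'[OF summ, of 0]) simp
  have "AE \<omega> in M. finite {i. \<omega> \<in> (\<Union>n. B i n)}"
  proof (rule AE_finite_of_bounded_sums[OF prob_space_axioms])
    show "(\<Union>n. B i n) \<in> sets M" for i using B by auto
    fix F :: "nat set" assume F: "finite F"
    have "(\<Sum>i\<in>F. measure M (\<Union>n. B i n)) \<le> (\<Sum>i\<in>F. \<Sum>n. measure M (B i n))"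
      using B B_summ by (intro sum_mono finite_measure_subadditive_countably) auto
    also have "\<dots> = (\<Sum>n. \<Sum>i\<in>F. measure M (B i n))"
      using B_summ by (rule suminf_sum[symmetric])
    also have "\<dots> \<le> (\<Sum>n. c * ((real n + 1)\<^sup>2 * exp (- real n)))"
      using B_summ by (intro suminf_le B_sum[OF F] summ summable_sum)
    finally show "(\<Sum>i\<in>F. measure M (\<Union>n. B i n)) \<le> (\<Sum>n. c * ((real n + 1)\<^sup>2 * exp (- real n)))" .
  qed
  then show ?thesis
    using AE_space
  proof eventually_elim
    case (elim \<omega>)
    have "\<omega> \<in> (\<Union>n. B i n)" if t: "t \<in> dyadic_times T" and near: "pp_points p W i t \<omega> \<in> cball 0 R" for i t
    proof -
      define n where "n = nat \<lfloor>cmod (p i \<omega>)\<rfloor>"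
      have n: "real n \<le> cmod (p i \<omega>)" "cmod (p i \<omega>) \<le> real n + 1" by (auto simp: n_def of_nat_nat)
      have "cmod (p i \<omega>) \<le> cmod (p i \<omega> + W i t \<omega>) + cmod (W i t \<omega>)"
        by (metis add_diff_cancel_right' norm_triangle_ineq4)
      then have "b n < cmod (W i t \<omega>)" using near n by (simp add: pp_points_def b_def)
      then have "\<omega> \<in> B i n" using t n elim(2) by (auto simp: B_def S_def Ann_def not_le intro!: bexI[of _ t])
      then show ?thesis by blast
    qed
    then have "{i. \<exists>t\<in>dyadic_times T. pp_points p W i t \<omega> \<in> cball 0 R} \<subseteq> {i. \<omega> \<in> (\<Union>n. B i n)}" by blast
    then show ?case using elim(1) by (rule finite_subset)
  qed
qed

text \<open>Half of the radius is left to the starting point and half to the displacement, so each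
  point costs the rate \<open>16 / (R / 2)\<^sup>2\<close>, hence the 64. The starting configuration
  costs a factor that does not depend on \<open>T\<close>.\<close>

lemma pp_persistence_rate:
  assumes pW: "poisson_BM M p W" and R: "0 < R"
  shows "ereal (- (64 * real N / R\<^sup>2)) \<le> persistence_rate M UNIV (pp_points p W) R N"
proof -
  interpret prob_space M using pW by (simp add: poisson_BM_def)
  have p: "poisson_points M (1 / pi) p" and W: "complex_BM M (W i)" for i using pW by (auto simp: poisson_BM_def)
  have p_meas[measurable]: "p i \<in> borel_measurable M" for i using p by (simp add: poisson_points_def)
  have ind: "indep_vars (\<lambda>_. traj_space) (\<lambda>i. traj (W i)) UNIV" using pW by (simp add: poisson_BM_def)
  obtain F where F: "finite F" "card F = N" and pos: "0 < measure M {\<omega> \<in> space M. \<forall>i\<in>F. p i \<omega> \<in> cball 0 (R / 2)}"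
    using poisson_points_positive[OF prob_space_axioms p, of "R / 2" N] R by auto
  define q where "q = measure M {\<omega> \<in> space M. \<forall>i\<in>F. p i \<omega> \<in> cball 0 (R / 2)} * ((1 - exp (- 1))\<^sup>2) ^ N"
  have q: "0 < q" using pos by (simp add: q_def)
  show ?thesis
  proof (rule persistence_rate_ge[OF q])
    fix T :: real assume T: "0 < T"
    have D: "countable (dyadic_times T)" "dyadic_times T \<subseteq> {0..}" using dyadic_times_subset[of T] T by (auto simp: countable_dyadic_times)
    have meas: "pp_points p W i t \<in> borel_measurable M" if "0 \<le> t" for i t
      using complex_BM_measurable[OF W that, of i] unfolding pp_points_def[abs_def] by measurable
    have stay: "((1 - exp (- 1))\<^sup>2) ^ N * exp (- T * (64 * real N / R\<^sup>2)) \<le>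
      measure M {\<omega> \<in> space M. \<forall>i\<in>F. \<forall>t\<in>dyadic_times T. W i t \<omega> \<in> cball 0 (R / 2)}"
    proof (cases "F = {}")
      case True
      then show ?thesis using F prob_space by auto
    next
      case False
      have "((1 - exp (- 1))\<^sup>2) ^ N * exp (- T * (64 * real N / R\<^sup>2)) = (\<Prod>i\<in>F. (1 - exp (- 1))\<^sup>2 * exp (- 16 * T / (R / 2)\<^sup>2))"
      proof -
        have "- T * (64 * real N / R\<^sup>2) = real N * (- 16 * T / (R / 2)\<^sup>2)" by (simp add: power_divide)
        then have "exp (- T * (64 * real N / R\<^sup>2)) = exp (- 16 * T / (R / 2)\<^sup>2) ^ N" by (simp only: exp_of_nat_mult)
        then show ?thesis using F by (simp only: prod_constant power_mult_distrib)
      qed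
      also have "\<dots> \<le> (\<Prod>i\<in>F. measure M {\<omega> \<in> space M. \<forall>t\<in>dyadic_times T. W i t \<omega> \<in> cball 0 (R / 2)})"
        using complex_BM_stay[OF prob_space_axioms W _ T, of "R / 2"] R by (intro prod_mono) auto
      also have "\<dots> = measure M {\<omega> \<in> space M. \<forall>i\<in>F. \<forall>t\<in>dyadic_times T. W i t \<omega> \<in> cball 0 (R / 2)}"
        using F False by (intro indep_traj_family[OF prob_space_axioms ind _ _ D, symmetric]) auto
      finally show ?thesis .
    qed
    have "q * exp (- T * (64 * real N / R\<^sup>2)) = measure M {\<omega> \<in> space M. \<forall>i\<in>F. p i \<omega> \<in> cball 0 (R / 2)} *
        (((1 - exp (- 1))\<^sup>2) ^ N * exp (- T * (64 * real N / R\<^sup>2)))"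
      by (simp only: q_def mult.assoc)
    also have "\<dots> \<le> measure M {\<omega> \<in> space M. \<forall>i\<in>F. p i \<omega> \<in> cball 0 (R / 2)} *
        measure M {\<omega> \<in> space M. \<forall>i\<in>F. \<forall>t\<in>dyadic_times T. W i t \<omega> \<in> cball 0 (R / 2)}"
      using stay by (rule mult_left_mono) simp
    also have "\<dots> = measure M {\<omega> \<in> space M. (\<forall>i\<in>F. p i \<omega> \<in> cball 0 (R / 2)) \<and> (\<forall>i\<in>F. \<forall>t\<in>dyadic_times T. W i t \<omega> \<in> cball 0 (R / 2))}"
      by (rule poisson_BM_indep[OF pW F(1) D, symmetric]) auto
    also have "\<dots> \<le> measure M {\<omega> \<in> space M. \<forall>i\<in>F. \<forall>t\<in>dyadic_times T. pp_points p W i t \<omega> \<in> cball 0 R}"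
    proof (rule finite_measure_mono)
      have "pp_points p W i t \<omega> \<in> cball 0 R" if "p i \<omega> \<in> cball 0 (R / 2)" "W i t \<omega> \<in> cball 0 (R / 2)" for i t \<omega>
        using that norm_triangle_ineq[of "p i \<omega>" "W i t \<omega>"] by (simp add: pp_points_def)
      then show "{\<omega> \<in> space M. (\<forall>i\<in>F. p i \<omega> \<in> cball 0 (R / 2)) \<and> (\<forall>i\<in>F. \<forall>t\<in>dyadic_times T. W i t \<omega> \<in> cball 0 (R / 2))}
        \<subseteq> {\<omega> \<in> space M. \<forall>i\<in>F. \<forall>t\<in>dyadic_times T. pp_points p W i t \<omega> \<in> cball 0 R}" by blast
      show "{\<omega> \<in> space M. \<forall>i\<in>F. \<forall>t\<in>dyadic_times T. pp_points p W i t \<omega> \<in> cball 0 R} \<in> sets M"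
      proof (rule sets.sets_Collect_countable_All'[OF _ countable_finite[OF F(1)]])
        show "{\<omega> \<in> space M. \<forall>t\<in>dyadic_times T. pp_points p W i t \<omega> \<in> cball 0 R} \<in> sets M" for i
          using D meas by (intro countable_ball_event) auto
      qed
    qed
    also have "\<dots> \<le> measure (completion M) (at_least_points_event M UNIV (pp_points p W) T R N)"
    proof (rule measure_at_least_points_ge[OF prob_space_axioms _ T meas])
      show "AE \<omega> in M. continuous_on {0..} (\<lambda>t. pp_points p W i t \<omega>)" for i
      proof -
        obtain B1 B2 where B: "standard_BM M B1" "standard_BM M B2"
          "\<forall>t\<ge>0. \<forall>\<omega>\<in>space M. W i t \<omega> = (of_real (B1 t \<omega>) + \<i> * of_real (B2 t \<omega>)) / of_real (sqrt 2)"
          using W[of i] unfolding complex_BM_def by blast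
        have "AE \<omega> in M. continuous_on {0..} (\<lambda>t. B1 t \<omega>)" "AE \<omega> in M. continuous_on {0..} (\<lambda>t. B2 t \<omega>)"
          using B by (auto simp: standard_BM_def)
        then show ?thesis
          using AE_space
        proof eventually_elim
          case (elim \<omega>)
          then have "continuous_on {0..} (\<lambda>t. p i \<omega> + (of_real (B1 t \<omega>) + \<i> * of_real (B2 t \<omega>)) / of_real (sqrt 2))"
            by (intro continuous_intros) auto
          then show ?case using B(3) elim(3) by (subst continuous_on_cong[OF refl]) (auto simp: pp_points_def)
        qed
      qed
      show "AE \<omega> in M. finite {i \<in> UNIV. \<exists>t\<in>dyadic_times T. pp_points p W i t \<omega> \<in> cball 0 R}"
        using poisson_BM_near_finite[OF pW T R] by simp
    qed (use F in auto)
    finally show "q * exp (- T * (64 * real N / R\<^sup>2)) \<le> measure (completion M) (at_least_points_event M UNIV (pp_points p W) T R N)" .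
  qed
qed

theorem proposition4:
  shows
    "(\<exists>C>0. \<forall>(M :: 'a measure) p W. poisson_BM M p W \<longrightarrow>
        (\<forall>R>0. \<forall>N\<ge>1.
           persistence_rate M UNIV (pp_points p W) R N \<ge> ereal (- (C * real N / R\<^sup>2))))
   \<and> (\<forall>c>0. \<forall>R>0. \<exists>C>0. \<forall>(M :: 'b measure) \<zeta>. iid_OU_family M \<zeta> \<longrightarrow>
        (\<forall>N\<ge>1.
           persistence_rate M UNIV (pl_points c \<zeta>) R N \<ge> ereal (- (C * (real N)\<^sup>2))))
   \<and> (\<forall>c>0. \<forall>R>0. \<exists>C>0. \<forall>(M :: 'b measure) \<zeta>. iid_OU_family M \<zeta> \<longrightarrow>
        (\<forall>N\<ge>1.
           persistence_rate M (UNIV \<times> UNIV \<times> {0,1,2}) (tc_points c \<zeta>) R N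
             \<ge> ereal (- (C * (real N)\<^sup>2))))"
proof (intro conjI allI impI)
  show "\<exists>C>0. \<forall>(M :: 'a measure) p W. poisson_BM M p W \<longrightarrow>
      (\<forall>R>0. \<forall>N\<ge>1. persistence_rate M UNIV (pp_points p W) R N \<ge> ereal (- (C * real N / R\<^sup>2)))"
    by (intro exI[of _ 64] conjI allI impI pp_persistence_rate) simp_all
next
  fix c R :: real assume cR: "0 < c" "0 < R"
  show "\<exists>C>0. \<forall>(M :: 'b measure) \<zeta>. iid_OU_family M \<zeta> \<longrightarrow>
      (\<forall>N\<ge>1. persistence_rate M UNIV (pl_points c \<zeta>) R N \<ge> ereal (- (C * (real N)\<^sup>2)))"
    using cR by (intro exI[of _ "lattice_rate (sqrt pi) c R"] conjI allI impI pl_persistence_rate lattice_rate_pos)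
  show "\<exists>C>0. \<forall>(M :: 'b measure) \<zeta>. iid_OU_family M \<zeta> \<longrightarrow>
      (\<forall>N\<ge>1. persistence_rate M (UNIV \<times> UNIV \<times> {0,1,2}) (tc_points c \<zeta>) R N \<ge> ereal (- (C * (real N)\<^sup>2)))"
    using cR by (intro exI[of _ "lattice_rate (sqrt (3 * pi)) c R"] conjI allI impI tc_persistence_rate lattice_rate_pos)
qed

end
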